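(* Let $A,B,C\in\mathbb{R}$ with $C\neq0$ and consider the planar map $F(x,y)=\left(y,\dfrac{A+By+Cy^2}{x}\right)$. Suppose that $F$ has an elliptic fixed point $p$ which is not $5$-resonant. Then $F$ is $\mathcal{C}^{6}$-locally integrable at $p$ if and only if $C=1$. Moreover, when $C=1$ the map has the rational first integral $V(x,y)=\dfrac{x^2+y^2+B(x+y)+A}{xy}$, that is, $V\circ F=V$.
   Context: Elliptic fixed point: a fixed point $p$ of $F$ such that the eigenvalues $\lambda,\bar\lambda=1/\lambda$ of $DF(p)$ lie on the unit circle of $\mathbb{C}$ and are different from $\pm1$. It is not $k$-resonant if $\lambda^\ell\neq 1$ for all $0<\ell\le k$. $\mathcal{C}^m$-locally integrable at an elliptic fixed point $p$ ($m\ge2$): there exist a neighborhood $\mathcal{U}$ of $p$ and a locally non-constant real valued function $V\in\mathcal{C}^m(\mathcal{U})$ (a first integral) such that $V(F(x))=V(x)$, all the level curves $\{V=h\}\cap\mathcal{U}$ are closed curves surrounding $p$ and, moreover, $p$ is an isolated non-degenerate critical point of $V$ in $\mathcal{U}$. *)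

theory Defs
  imports "HOL-Analysis.Analysis"
begin

text \<open>
  Planar maps are total functions on \<open>real^2\<close> together with an explicit domain \<open>D\<close>;
  values outside \<open>D\<close> (such as those produced by division by zero) carry no meaning.
\<close>

text \<open>
  Class \<open>C^k\<close> on an open set \<open>U\<close>: all iterated directional derivatives of order at most \<open>k\<close>
  exist and are continuous on \<open>U\<close>.
\<close>

primrec Ck_on :: "nat \<Rightarrow> ('a::euclidean_space \<Rightarrow> 'b::real_normed_vector) \<Rightarrow> 'a set \<Rightarrow> bool" where
  "Ck_on 0 f U \<longleftrightarrow> continuous_on U f"
| "Ck_on (Suc k) f U \<longleftrightarrow>
     (\<forall>x\<in>U. f differentiable (at x)) \<and> (\<forall>v. Ck_on k (\<lambda>x. frechet_derivative f (at x) v) U)"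

definition complex_eigenvalue :: "real^'n^'n \<Rightarrow> complex \<Rightarrow> bool" where
  "complex_eigenvalue M \<mu> \<longleftrightarrow>
     (\<exists>v::complex^'n. v \<noteq> 0 \<and> map_matrix complex_of_real M *v v = \<mu> *s v)"

definition elliptic_fixed_point ::
  "(real^2) set \<Rightarrow> (real^2 \<Rightarrow> real^2) \<Rightarrow> real^2 \<Rightarrow> bool" where
  "elliptic_fixed_point D F p \<longleftrightarrow>
     p \<in> D \<and> F p = p \<and> F differentiable (at p) \<and>
     (\<exists>\<mu>. cmod \<mu> = 1 \<and> \<mu> \<noteq> 1 \<and> \<mu> \<noteq> -1 \<and>
          {\<nu>. complex_eigenvalue (jacobian F (at p)) \<nu>} = {\<mu>, cnj \<mu>})"

definition resonant :: "nat \<Rightarrow> (real^2 \<Rightarrow> real^2) \<Rightarrow> real^2 \<Rightarrow> bool" where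
  "resonant k F p \<longleftrightarrow>
     (\<exists>\<mu> l. complex_eigenvalue (jacobian F (at p)) \<mu> \<and> 0 < l \<and> l \<le> k \<and> \<mu> ^ l = 1)"

definition locally_nonconstant_on :: "(real^2) set \<Rightarrow> (real^2 \<Rightarrow> real) \<Rightarrow> bool" where
  "locally_nonconstant_on U V \<longleftrightarrow>
     (\<forall>W. open W \<and> W \<noteq> {} \<and> W \<subseteq> U \<longrightarrow> \<not> V constant_on W)"

text \<open>
  A first integral is only defined on \<open>U\<close>, so invariance is required exactly where
  both \<open>x\<close> and \<open>F x\<close> lie in \<open>U\<close>.
\<close>

definition first_integral ::
  "(real^2) set \<Rightarrow> (real^2 \<Rightarrow> real^2) \<Rightarrow> (real^2) set \<Rightarrow> (real^2 \<Rightarrow> real) \<Rightarrow> bool" where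
  "first_integral D F U V \<longleftrightarrow>
     U \<subseteq> D \<and> locally_nonconstant_on U V \<and> (\<forall>x\<in>U. F x \<in> U \<longrightarrow> V (F x) = V x)"

definition closed_curve_surrounding :: "real^2 \<Rightarrow> (real^2) set \<Rightarrow> bool" where
  "closed_curve_surrounding p S \<longleftrightarrow>
     (\<exists>g. simple_path g \<and> pathfinish g = pathstart g \<and> path_image g = S \<and>
          p \<in> inside (path_image g))"

definition hessian :: "(real^2 \<Rightarrow> real) \<Rightarrow> real^2 \<Rightarrow> real^2^2" where
  "hessian V p = (\<chi> i j. frechet_derivative
     (\<lambda>x. frechet_derivative V (at x) (axis j 1)) (at p) (axis i 1))"

definition critical_points :: "(real^2) set \<Rightarrow> (real^2 \<Rightarrow> real) \<Rightarrow> (real^2) set" where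
  "critical_points U V = {x\<in>U. (V has_derivative (\<lambda>_. 0)) (at x)}"

text \<open>
  Meaningful for \<open>m \<ge> 2\<close>. The level curves in \<open>U\<close> are the level sets through the points of
  \<open>U - {p}\<close>. As none of them may contain \<open>p\<close>, which lies inside each, the level set of \<open>V p\<close>
  in \<open>U\<close> is the degenerate curve \<open>{p}\<close>.
\<close>

definition Cm_locally_integrable ::
  "nat \<Rightarrow> (real^2) set \<Rightarrow> (real^2 \<Rightarrow> real^2) \<Rightarrow> real^2 \<Rightarrow> bool" where
  "Cm_locally_integrable m D F p \<longleftrightarrow>
     (\<exists>U V. open U \<and> p \<in> U \<and> Ck_on m V U \<and> first_integral D F U V \<and>
        (\<forall>q\<in>U - {p}. closed_curve_surrounding p {x\<in>U. V x = V q}) \<and>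
        p isolated_in (critical_points U V) \<and> det (hessian V p) \<noteq> 0)"

definition F_dom :: "(real^2) set" where
  "F_dom = {z. z$1 \<noteq> 0}"

definition F_map :: "real \<Rightarrow> real \<Rightarrow> real \<Rightarrow> real^2 \<Rightarrow> real^2" where
  "F_map A B C z = vector [z$2, (A + B * z$2 + C * (z$2)\<^sup>2) / z$1]"

end

theory Submission
  imports Defs "HOL-Library.Multiset" "HOL-Library.Function_Algebras"
    "HOL-Computational_Algebra.Polynomial" "HOL-Complex_Analysis.Contour_Integration"
begin

text \<open>
  For \<open>C = 1\<close> the rational function is a first integral, and a radial change of variables turns
  its level curves near \<open>p\<close> into ellipses.

  Let \<open>C \<noteq> 1\<close> and suppose that there is a first integral. Its Hessian at \<open>p\<close> is invariant under
  the differential of the map, hence definite, so it increases along rays from \<open>p\<close> and orbits stay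
  near \<open>p\<close>. One of the first two Birkhoff constants is nonzero, so the angle by which an iterate of
  the map turns a point varies along every ray, and by the intermediate value theorem every ray
  carries a point that the \<open>N\<close>-th iterate, for some odd \<open>N\<close>, maps to its own ray; as the integral
  is preserved, that point is fixed. This yields infinitely many \<open>N\<close>-periodic points. But the equations
  \<open>x\<^sub>i\<^sub>-\<^sub>1 x\<^sub>i\<^sub>+\<^sub>1 = A + B x\<^sub>i + C x\<^sub>i\<^sup>2\<close> for \<open>N\<close>-cycles have no solution at infinity when \<open>C\<^sup>N \<noteq> 1\<close>, so there are only
  finitely many.
\<close>

section \<open>Cycles of the recurrence\<close>

text \<open>An odd length is wanted because a real \<open>C \<noteq> 1\<close> satisfies
  \<open>C ^ N = 1\<close> only for \<open>C = -1\<close> and even \<open>N\<close>. How long the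
  cycles must be depends on the size of the disc in which the estimates hold, so finiteness of
  cycles is proved for every such \<open>N\<close>.

  Non-resonance enters through small divisors. Solving for the invariant curve up to degree five
  meets the divisors \<open>2 cos (l \<theta>) - t\<close> with \<open>t = 2 cos \<theta>\<close>
  and \<open>l \<noteq> 1\<close>, \<open>l \<le> 5\<close>. Apart from \<open>t = 2\<close> and
  \<open>t = -2\<close>, they vanish only for \<open>t = -1\<close>, \<open>t = 0\<close>,
  \<open>t^2 + t - 1 = 0\<close> and \<open>t = 1\<close>, which are eigenvalues of order 3, 4, 5
  and 6. The hypothesis leaves order 6 open. That divisor occurs only in degree five, which is
  reached only if the first Birkhoff constant vanishes, and for \<open>t = 1\<close> this would
  force \<open>C = 0\<close>.

  No exact normal form is constructed: it suffices that the conjugated map is a rotation with an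
  angle varying like \<open>cmod w ^ (2 * m)\<close>, up to an error that turns points by less than
  this variation.\<close>

global_interpretation funvec: vector_space "\<lambda>(c::real) (f::'a \<Rightarrow> real) x. c * f x"
  by unfold_locales (auto simp: fun_eq_iff algebra_simps)

definition mon :: "nat multiset \<Rightarrow> (nat \<Rightarrow> real) \<Rightarrow> real" where
  "mon M x = (\<Prod>i\<in>#M. x i)"

lemma mon_simps [simp]:
  "mon {#} x = 1" "mon (add_mset i M) x = x i * mon M x" "mon (M + L) x = mon M x * mon L x"
  "mon (replicate_mset n i) x = x i ^ n"
  by (simp_all add: mon_def)

text \<open>
  On the set of \<open>N\<close>-cycles \<open>C x\<^sub>i\<^sup>2\<close> equals \<open>x\<^sub>i\<^sub>-\<^sub>1 x\<^sub>i\<^sub>+\<^sub>1\<close> up to terms of lower degree. Read on exponents, this is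
  chip firing on a cycle graph: vertex \<open>i\<close> passes one chip to each neighbour. If every vertex has two chips,
  firing each vertex once restores the configuration, so that the monomial agrees with \<open>C\<^sup>N\<close> times itself
  up to lower degree. Hence all monomials of high degree reduce to lower ones.
\<close>

inductive fires :: "nat \<Rightarrow> nat \<Rightarrow> nat multiset \<Rightarrow> nat multiset \<Rightarrow> bool" for N where
  refl: "fires N 0 M M"
| step: "fires N n M (L + {#i, i#}) \<Longrightarrow> i < N \<Longrightarrow>
          fires N (Suc n) M (L + {#(i + N - 1) mod N, (i + 1) mod N#})"

lemma fires_trans:
  assumes "fires N n M M'" "fires N k M' M''"
  shows "fires N (n + k) M M''"
  using assms(2,1)
proof (induction rule: fires.induct)
  case (step k M' L i)
  from fires.step[OF step.IH[OF step.prems] step.hyps(2)] show ?case by simp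
qed simp

lemma fires_add:
  assumes "fires N n M M'"
  shows "fires N n (M + L) (M' + L)"
  using assms
proof (induction rule: fires.induct)
  case (step n M L' i)
  from step.IH have "fires N n (M + L) ((L' + L) + {#i, i#})"
    by (simp add: ac_simps)
  from fires.step[OF this step.hyps(2)] show ?case
    by (simp add: ac_simps)
qed (rule fires.refl)

lemma fires_size: "fires N n M M' \<Longrightarrow> size M' = size M"
  by (induction rule: fires.induct) auto

lemma fires_set:
  "fires N n M M' \<Longrightarrow> 0 < N \<Longrightarrow> set_mset M \<subseteq> {..<N} \<Longrightarrow> set_mset M' \<subseteq> {..<N}"
  by (induction rule: fires.induct) auto

lemma fires_pile:
  assumes "i < N"
  shows "fires N a (replicate_mset (2 * a) i)
           (replicate_mset a ((i + N - 1) mod N) + replicate_mset a ((i + 1) mod N))"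
proof (induction a)
  case (Suc a)
  let ?p = "(i + N - 1) mod N" and ?q = "(i + 1) mod N"
  have "fires N a (replicate_mset (2 * a) i + {#i, i#})
          ((replicate_mset a ?p + replicate_mset a ?q) + {#i, i#})"
    using fires_add[OF Suc] by blast
  from fires.step[OF this assms] show ?case
    by (simp add: ac_simps)
qed (simp add: fires.refl)

text \<open>Induction on \<open>r\<close> with \<open>a\<close> tripled: firing the last loaded
  vertex \<open>a\<close> times costs \<open>2 * a\<close> of its \<open>3 * a\<close> chips, leaves
  \<open>a\<close> there and passes \<open>a\<close> to the next vertex. No other vertex loses a
  chip.\<close>

lemma fires_spread:
  assumes "0 < N" "i < N"
  shows "\<exists>n M'. fires N n (replicate_mset (3 ^ r * a) i) M' \<and> (\<forall>t\<le>r. a \<le> count M' ((i + t) mod N))"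
proof (induction r arbitrary: a)
  case 0
  show ?case using assms by (intro exI[of _ 0] exI[of _ "replicate_mset (3 ^ 0 * a) i"]) (auto intro: fires.refl)
next
  case (Suc r)
  from Suc[of "3 * a"] obtain n M' where M': "fires N n (replicate_mset (3 ^ r * (3 * a)) i) M'"
    and cnt: "\<And>t. t \<le> r \<Longrightarrow> 3 * a \<le> count M' ((i + t) mod N)" by blast
  define v where "v = (i + r) mod N"
  have vN: "v < N" using assms by (simp add: v_def)
  have "replicate_mset (2 * a) v \<subseteq># M'"
    using cnt[of r] by (simp flip: v_def count_le_replicate_mset_subset_eq)
  then obtain L where L: "M' = replicate_mset (2 * a) v + L"
    by (metis subset_mset.add_diff_inverse)
  define M'' where "M'' = replicate_mset a ((v + N - 1) mod N) + replicate_mset a ((v + 1) mod N) + L"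
  have "fires N a M' M''"
    unfolding L M''_def by (intro fires_add fires_pile vN)
  from fires_trans[OF M' this]
  have f: "fires N (n + a) (replicate_mset (3 ^ Suc r * a) i) M''" by (simp add: ac_simps)
  have "a \<le> count M'' ((i + t) mod N)" if "t \<le> Suc r" for t
  proof (cases "t = Suc r")
    case True
    then have "(i + t) mod N = (v + 1) mod N" by (simp add: v_def mod_simps)
    then show ?thesis by (simp add: M''_def)
  next
    case False
    with that have "3 * a \<le> count M' ((i + t) mod N)" by (intro cnt) auto
    then show ?thesis by (auto simp: M''_def L split: if_splits)
  qed
  with f show ?case by blast
qed

lemma fires_round:
  assumes N: "0 < N" and M: "\<And>i. i < N \<Longrightarrow> 2 \<le> count M i"
  shows "fires N N M M"
proof -
  let ?p = "\<lambda>i. (i + N - 1) mod N" and ?q = "\<lambda>i. (i + 1) mod N"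
  \<comment> \<open>Every vertex fires the two chips it holds at the start, so no received chip is
    ever spent and the vertices can be fired in the order of their indices.\<close>
  have part: "k \<le> N \<Longrightarrow> fires N k (\<Sum>i<k. {#i, i#}) (\<Sum>i<k. {#?p i, ?q i#})" for k
  proof (induction k)
    case (Suc k)
    then have "fires N k ((\<Sum>i<k. {#i, i#}) + {#k, k#}) ((\<Sum>i<k. {#?p i, ?q i#}) + {#k, k#})"
      by (intro fires_add) simp
    from fires.step[OF this] Suc.prems show ?case by (simp add: ac_simps)
  qed (simp add: fires.refl)
  have bij: "bij_betw (\<lambda>i. (i + c) mod N) {..<N} {..<N}" for c
  proof -
    have "j \<in> (\<lambda>i. (i + c) mod N) ` {..<N}" if "j < N" for j
    proof
      have "((j + (N - c mod N)) mod N + c) mod N = (j + (N - c mod N) + c) mod N"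
        by (simp add: mod_simps)
      also have "j + (N - c mod N) + c = j + N * (1 + c div N)"
        using mod_less_divisor[OF N, of c] mult_div_mod_eq[of N c]
        unfolding distrib_left mult_1_right by linarith
      also have "\<dots> mod N = j" using that by (simp only: mod_mult_self2) simp
      finally show "j = ((j + (N - c mod N)) mod N + c) mod N" by simp
    qed (use N in auto)
    then have "(\<lambda>i. (i + c) mod N) ` {..<N} = {..<N}" using N by auto
    then show ?thesis by (simp add: bij_betw_def eq_card_imp_inj_on)
  qed
  have sh: "(\<Sum>i<N. {#(i + c) mod N#}) = (\<Sum>i<N. {#i#})" for c
    by (rule sum.reindex_bij_betw[OF bij, of "\<lambda>i. {#i#}"])
  have "?p i = (i + (N - 1)) mod N" for i using N by simp
  then have "(\<Sum>i<N. {#?p i, ?q i#}) = (\<Sum>i<N. {#(i + (N - 1)) mod N#}) + (\<Sum>i<N. {#(i + 1) mod N#})"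
    unfolding sum.distrib[symmetric] by (intro sum.cong) auto
  also have "\<dots> = (\<Sum>i<N. {#i, i#})"
    unfolding sh sum.distrib[symmetric] by (intro sum.cong) auto
  finally have full: "fires N N (\<Sum>i<N. {#i, i#}) (\<Sum>i<N. {#i, i#})"
    using part[of N] by simp
  have cnt: "count (\<Sum>i<k. {#i, i#}) j = (if j < k then 2 else 0)" for k j :: nat
    by (induction k) auto
  have "(\<Sum>i<N. {#i, i#}) \<subseteq># M"
    using M by (auto simp: subseteq_mset_def cnt)
  then obtain L where "M = (\<Sum>i<N. {#i, i#}) + L"
    by (metis subset_mset.add_diff_inverse)
  with fires_add[OF full, of L] show ?thesis by simp
qed

section \<open>Monomials as functions on the solution set\<close>

definition restr :: "'a set \<Rightarrow> ('a \<Rightarrow> real) \<Rightarrow> 'a \<Rightarrow> real" where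
  "restr S f x = (if x \<in> S then f x else 0)"

text \<open>Truncation to \<open>S\<close> stands in for the coordinate ring of \<open>S\<close>:
  polynomials that agree on \<open>S\<close> become equal, so reduction by the recurrence is an
  equality in a vector space of functions.\<close>

definition low :: "nat \<Rightarrow> (nat \<Rightarrow> real) set \<Rightarrow> nat \<Rightarrow> ((nat \<Rightarrow> real) \<Rightarrow> real) set" where
  "low N S k = funvec.span ((\<lambda>M. restr S (mon M)) ` {M. set_mset M \<subseteq> {..<N} \<and> size M < k})"

lemma mon_in_low: "set_mset M \<subseteq> {..<N} \<Longrightarrow> size M < k \<Longrightarrow> restr S (mon M) \<in> low N S k"
  unfolding low_def by (intro funvec.span_base) auto

text \<open>A firing at \<open>i\<close> exchanges \<open>C * (x i)^2\<close> for the product of the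
  neighbours and leaves \<open>mon L x * (A + B * x i)\<close>, of degree below
  \<open>size M\<close>. Each firing contributes one factor \<open>C\<close>.\<close>

lemma fires_low:
  assumes "fires N n M M'" "set_mset M \<subseteq> {..<N}"
    and S: "\<And>x i. x \<in> S \<Longrightarrow> i < N \<Longrightarrow>
      x ((i + N - 1) mod N) * x ((i + 1) mod N) = A + B * x i + C * (x i)\<^sup>2"
  shows "(\<lambda>x. C ^ n * restr S (mon M) x) - restr S (mon M') \<in> low N S (size M)"
  using assms(1,2)
proof (induction rule: fires.induct)
  case (refl M)
  have "(\<lambda>x. C ^ 0 * restr S (mon M) x) - restr S (mon M) = 0" by (auto simp: fun_eq_iff)
  then show ?case unfolding low_def by (simp only: funvec.span_zero)
next
  case (step n M L i)
  let ?p = "(i + N - 1) mod N" and ?q = "(i + 1) mod N"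
  have "set_mset (L + {#i, i#}) \<subseteq> {..<N}"
    using fires_set[OF step.hyps(1)] step.hyps(2) step.prems by (metis gr_zeroI less_zeroE)
  then have L: "set_mset L \<subseteq> {..<N}" by simp
  from fires_size[OF step.hyps(1)] have sz: "size M = size L + 2" by simp
  have l1: "restr S (mon L) \<in> low N S (size M)" using L sz by (intro mon_in_low) auto
  have l2: "restr S (mon (add_mset i L)) \<in> low N S (size M)"
    using L sz step.hyps(2) by (intro mon_in_low) auto
  have pq: "mon (L + {#?p, ?q#}) x = mon L x * (A + B * x i + C * (x i)\<^sup>2)" if "x \<in> S" for x
    by (simp only: mon_simps mult_1_right S[OF that step.hyps(2)])
  obtain L' where L': "L' = L + {#?p, ?q#}" by simp
  have "(\<lambda>x. C ^ Suc n * restr S (mon M) x) - restr S (mon L') =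
      (\<lambda>x. C * ((\<lambda>x. C ^ n * restr S (mon M) x) - restr S (mon (L + {#i, i#}))) x)
      - ((\<lambda>x. A * restr S (mon L) x) + (\<lambda>x. B * restr S (mon (add_mset i L)) x))" (is "?lhs = ?rhs")
  proof (rule ext)
    fix x
    show "?lhs x = ?rhs x"
    proof (cases "x \<in> S")
      case True
      have "C ^ Suc n * m - l * (A + B * t + C * t\<^sup>2) = C * (C ^ n * m - l * (t * t)) - (A * l + B * (t * l))"
        for m l t :: real by (simp add: algebra_simps power2_eq_square)
      from this[of "mon M x" "mon L x" "x i"] show ?thesis
        using True by (simp only: restr_def if_True minus_apply plus_fun_apply mon_simps mult_1_right
            pq[OF True, folded L'])
    qed (simp add: restr_def)
  qed
  also have "\<dots> \<in> low N S (size M)"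
    unfolding low_def
    by (rule funvec.span_diff funvec.span_scale funvec.span_add
        step.IH[OF step.prems, unfolded low_def] l1[unfolded low_def] l2[unfolded low_def])+
  finally show ?case by (simp only: L')
qed

lemma mon_reduce:
  assumes N: "0 < N" and C: "C ^ N \<noteq> 1" "C \<noteq> 0"
    and S: "\<And>x i. x \<in> S \<Longrightarrow> i < N \<Longrightarrow>
      x ((i + N - 1) mod N) * x ((i + 1) mod N) = A + B * x i + C * (x i)\<^sup>2"
    and M: "set_mset M \<subseteq> {..<N}" "N * (3 ^ N * 2) \<le> size M"
  shows "restr S (mon M) \<in> low N S (size M)"
proof -
  \<comment> \<open>Pigeonhole. A pile of \<open>3 ^ N * 2\<close> chips is what
    \<open>fires_spread\<close> needs to supply two chips to every vertex of the cycle.\<close>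
  have "\<exists>i<N. 3 ^ N * 2 \<le> count M i"
  proof (rule ccontr)
    assume "\<not> ?thesis"
    then have *: "count M i < 3 ^ N * 2" if "i < N" for i using that by (meson not_le)
    have "size M = (\<Sum>i\<in>set_mset M. count M i)" by (simp add: size_multiset_overloaded_eq)
    also have "\<dots> = (\<Sum>i<N. count M i)"
      using M(1) by (intro sum.mono_neutral_left) (auto simp: not_in_iff)
    also have "\<dots> < (\<Sum>i<N. 3 ^ N * 2)"
      using N by (intro sum_strict_mono *) auto
    finally show False using M(2) by simp
  qed
  then obtain i where i: "i < N" and "replicate_mset (3 ^ N * 2) i \<subseteq># M"
    by (auto simp: count_le_replicate_mset_subset_eq)
  then obtain L where L: "M = replicate_mset (3 ^ N * 2) i + L"
    by (metis subset_mset.add_diff_inverse)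
  from fires_spread[OF N i, of N 2] obtain n M' where
    f: "fires N n (replicate_mset (3 ^ N * 2) i) M'"
    and cnt: "\<And>t. t \<le> N \<Longrightarrow> 2 \<le> count M' ((i + t) mod N)" by blast
  define M'' where "M'' = M' + L"
  have f1: "fires N n M M''" unfolding L M''_def by (rule fires_add[OF f])
  have "2 \<le> count M'' j" if "j < N" for j
  proof -
    define t where "t = (if i \<le> j then j - i else j + N - i)"
    have "(i + t) mod N = j" "t \<le> N" using i that by (auto simp: t_def)
    with cnt[of t] show ?thesis by (simp add: M''_def)
  qed
  from fires_round[OF N this] have f2: "fires N N M'' M''" .
  note sz = fires_size[OF f1]
  let ?m = "restr S (mon M)" and ?m' = "restr S (mon M'')"
  have 1: "(\<lambda>x. C ^ n * ?m x) - ?m' \<in> low N S (size M)"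
    by (rule fires_low[OF f1 M(1) S])
  have 2: "(\<lambda>x. C ^ N * ?m' x) - ?m' \<in> low N S (size M)"
    using fires_low[OF f2 fires_set[OF f1 N M(1)] S] by (simp add: sz)
  \<comment> \<open>A full round returns to the same monomial, so \<open>(C ^ N - 1) * ?m'\<close>
    is of lower degree; dividing by the nonzero factor reduces \<open>?m'\<close> itself, and then
    \<open>?m\<close>.\<close>
  have "(\<lambda>x. (1 / (C ^ N - 1)) * ((\<lambda>x. C ^ N * ?m' x) - ?m') x) \<in> low N S (size M)"
    using 2 unfolding low_def by (rule funvec.span_scale)
  moreover have "(\<lambda>x. (1 / (C ^ N - 1)) * ((\<lambda>x. C ^ N * ?m' x) - ?m') x) = ?m'"
    using C(1) by (simp add: fun_eq_iff field_simps)
  ultimately have 3: "?m' \<in> low N S (size M)" by simp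
  have "((\<lambda>x. C ^ n * ?m x) - ?m') + ?m' \<in> low N S (size M)"
    using 1 3 unfolding low_def by (rule funvec.span_add)
  then have "(\<lambda>x. (1 / C ^ n) * (((\<lambda>x. C ^ n * ?m x) - ?m') + ?m') x) \<in> low N S (size M)"
    unfolding low_def by (rule funvec.span_scale)
  moreover have "(\<lambda>x. (1 / C ^ n) * (((\<lambda>x. C ^ n * ?m x) - ?m') + ?m') x) = ?m"
    using C(2) by (simp add: fun_eq_iff field_simps)
  ultimately show ?thesis by simp
qed

lemma mon_in_low_bound:
  assumes N: "0 < N" and C: "C ^ N \<noteq> 1" "C \<noteq> 0"
    and S: "\<And>x i. x \<in> S \<Longrightarrow> i < N \<Longrightarrow>
      x ((i + N - 1) mod N) * x ((i + 1) mod N) = A + B * x i + C * (x i)\<^sup>2"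
    and M: "set_mset M \<subseteq> {..<N}"
  shows "restr S (mon M) \<in> low N S (N * (3 ^ N * 2))"
  using M
proof (induction "size M" arbitrary: M rule: less_induct)
  case less
  show ?case
  proof (cases "size M < N * (3 ^ N * 2)")
    case True
    then show ?thesis using less.prems by (intro mon_in_low)
  next
    case False
    then have "restr S (mon M) \<in> low N S (size M)"
      using less.prems by (intro mon_reduce[OF N C S]) auto
    also have "low N S (size M) \<subseteq> low N S (N * (3 ^ N * 2))"
      unfolding low_def[of _ _ "size M"]
    proof (intro funvec.span_minimal)
      show "(\<lambda>M. restr S (mon M)) ` {Ma. set_mset Ma \<subseteq> {..<N} \<and> size Ma < size M}
          \<subseteq> low N S (N * (3 ^ N * 2))"
        using less.hyps by auto
      show "funvec.subspace (low N S (N * (3 ^ N * 2)))"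
        unfolding low_def by (rule funvec.subspace_span)
    qed
    finally show ?thesis .
  qed
qed

lemma finite_multisets_bounded:
  assumes "finite A" shows "finite {M. set_mset M \<subseteq> A \<and> size M < k}"
proof -
  have "{M. set_mset M \<subseteq> A \<and> size M < k} \<subseteq> mset ` {xs. set xs \<subseteq> A \<and> length xs \<le> k}"
  proof
    fix M assume M: "M \<in> {M. set_mset M \<subseteq> A \<and> size M < k}"
    obtain xs where "M = mset xs" by (metis ex_mset)
    with M show "M \<in> mset ` {xs. set xs \<subseteq> A \<and> length xs \<le> k}" by auto
  qed
  then show ?thesis
    by (rule finite_subset) (intro finite_imageI finite_lists_length_le assms)
qed

text \<open>A linear relation between powers of \<open>g\<close> is a polynomial with infinitely
  many roots. Injectivity is recorded too, because independence concerns the set of powers and their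
  number must be counted.\<close>

lemma powers_independent:
  fixes g :: "'a \<Rightarrow> real"
  assumes "infinite (g ` S)"
  shows "inj (\<lambda>n. restr S (\<lambda>x. g x ^ n))"
    and "funvec.independent ((\<lambda>n. restr S (\<lambda>x. g x ^ n)) ` {..d})"
proof -
  let ?f = "\<lambda>n. restr S (\<lambda>x. g x ^ n)"
  have zero: "p = 0" if "\<And>x. x \<in> S \<Longrightarrow> poly p (g x) = 0" for p :: "real poly"
  proof (rule ccontr)
    assume "p \<noteq> 0"
    then have "finite {t. poly p t = 0}" by (rule poly_roots_finite)
    moreover have "g ` S \<subseteq> {t. poly p t = 0}" using that by auto
    ultimately show False using assms finite_subset by blast
  qed
  show inj: "inj ?f"
  proof (rule injI)
    fix m n assume eq: "?f m = ?f n"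
    have "monom (1::real) m - monom 1 n = 0"
    proof (rule zero)
      fix x assume "x \<in> S"
      with fun_cong[OF eq, of x] show "poly (monom (1::real) m - monom 1 n) (g x) = 0"
        by (simp add: restr_def poly_monom)
    qed
    then have "coeff (monom (1::real) m) n = coeff (monom 1 n) n" by simp
    then show "m = n" by (simp split: if_splits)
  qed
  show "funvec.independent (?f ` {..d})"
  proof (rule funvec.independent_if_scalars_zero)
    fix u v
    assume sum: "(\<Sum>w\<in>?f ` {..d}. (\<lambda>x. u w * w x)) = 0" and v: "v \<in> ?f ` {..d}"
    from v obtain n where n: "n \<le> d" "v = ?f n" by auto
    have fin: "(\<Sum>n\<in>X. (\<lambda>x. h n x)) x = (\<Sum>n\<in>X. h n x)" for h :: "nat \<Rightarrow> 'a \<Rightarrow> real" and X x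
      by (induction X rule: infinite_finite_induct) auto
    have sum': "(\<Sum>n\<le>d. (\<lambda>x. u (?f n) * ?f n x)) = 0"
      using sum by (subst (asm) sum.reindex[OF inj_on_subset[OF inj]]) (auto simp: o_def)
    define p where "p = (\<Sum>n\<le>d. monom (u (?f n)) n)"
    have "p = 0"
    proof (rule zero)
      fix x assume "x \<in> S"
      with fun_cong[OF sum', of x] show "poly p (g x) = 0"
        by (simp add: fin p_def poly_sum poly_monom restr_def)
    qed
    moreover have "coeff p n = u v"
      using n by (simp add: p_def coeff_sum coeff_monom)
    ultimately show "u v = 0" by simp
  qed simp
qed

text \<open>All monomials lie in the span of the finite set \<open>T\<close>. If a coordinate took
  infinitely many values, its powers up to \<open>card T\<close> would be \<open>card T + 1\<close>
  independent elements of that span.\<close>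

lemma finite_coordinate:
  fixes S :: "(nat \<Rightarrow> real) set"
  assumes N: "0 < N" and C: "C ^ N \<noteq> 1" "C \<noteq> 0"
    and S: "\<And>x i. x \<in> S \<Longrightarrow> i < N \<Longrightarrow>
      x ((i + N - 1) mod N) * x ((i + 1) mod N) = A + B * x i + C * (x i)\<^sup>2"
    and j: "j < N"
  shows "finite ((\<lambda>x. x j) ` S)"
proof (rule ccontr)
  assume inf: "infinite ((\<lambda>x. x j) ` S)"
  let ?f = "\<lambda>n. restr S (\<lambda>x. x j ^ n)"
  define T where "T = (\<lambda>M. restr S (mon M)) ` {M. set_mset M \<subseteq> {..<N} \<and> size M < N * (3 ^ N * 2)}"
  have fin: "finite T" unfolding T_def by (intro finite_imageI finite_multisets_bounded) simp
  have "?f n \<in> funvec.span T" for n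
  proof -
    have "mon (replicate_mset n j) = (\<lambda>x. x j ^ n)" by auto
    then show ?thesis
      using mon_in_low_bound[OF N C S, where M = "replicate_mset n j"] j
      by (simp add: low_def T_def split: if_splits)
  qed
  then have "card (?f ` {..card T}) \<le> card T"
    using funvec.independent_span_bound[OF fin powers_independent(2)[OF inf, of "card T"]] by blast
  moreover have "card (?f ` {..card T}) = card T + 1"
    using powers_independent(1)[OF inf] by (subst card_image) (auto intro: inj_on_subset)
  ultimately show False by simp
qed

text \<open>The sequence runs over all naturals so that an orbit of the map can be inserted as it
  is; \<open>N\<close> is a period, not necessarily the least one.\<close>

definition QRT_cycle :: "real \<Rightarrow> real \<Rightarrow> real \<Rightarrow> nat \<Rightarrow> (nat \<Rightarrow> real) \<Rightarrow> bool" where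
  "QRT_cycle A B C N x \<longleftrightarrow>
     (\<forall>i. x (i + N) = x i \<and> x i * x (i + 2) = A + B * x (i + 1) + C * (x (i + 1))\<^sup>2)"

lemma finite_QRT_cycles:
  assumes N: "0 < N" and C: "C ^ N \<noteq> 1" "C \<noteq> 0"
  shows "finite {x j |x. QRT_cycle A B C N x}"
proof -
  let ?S = "{x. QRT_cycle A B C N x}"
  have per: "x (i mod N) = x i" if "QRT_cycle A B C N x" for x i
  proof -
    have "x (k + N * n) = x k" for k n
    proof (induction n)
      case (Suc n)
      have "x (k + N * n + N) = x (k + N * n)" using that unfolding QRT_cycle_def by blast
      with Suc show ?case by (simp add: algebra_simps)
    qed simp
    from this[of "i mod N" "i div N"] show ?thesis by simp
  qed
  have "x ((i + N - 1) mod N) * x ((i + 1) mod N) = A + B * x i + C * (x i)\<^sup>2"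
    if "x \<in> ?S" "i < N" for x i
  proof -
    have x: "QRT_cycle A B C N x" using that by simp
    have "x (i + N - 1) * x (i + N - 1 + 2) = A + B * x (i + N - 1 + 1) + C * (x (i + N - 1 + 1))\<^sup>2"
      using x unfolding QRT_cycle_def by blast
    moreover have "i + N - 1 + 2 = (i + 1) + N" "i + N - 1 + 1 = i + N" using N by auto
    moreover have "x ((i + 1) + N) = x (i + 1)" "x (i + N) = x i"
      using x unfolding QRT_cycle_def by blast+
    ultimately show ?thesis using per[OF x] by simp
  qed
  from finite_coordinate[OF N C this, of ?S "j mod N"]
  have "finite ((\<lambda>x. x (j mod N)) ` ?S)" using N by auto
  also have "(\<lambda>x. x (j mod N)) ` ?S = {x j |x. QRT_cycle A B C N x}"
    using per by (auto simp: image_iff) metis+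
  finally show ?thesis .
qed

section \<open>Periodic points of a twist\<close>

text \<open>With \<open>q = cis x * (1 + e)\<close> the argument moves by
  \<open>Im (Ln (1 + e))\<close>, which is at most \<open>2 * cmod e\<close>. Since
  \<open>\<bar>x\<bar> \<le> 1\<close>, the branch cut is never met, so the principal argument can
  serve as a continuous angle.\<close>

lemma cis_perturb_Ln:
  assumes x: "\<bar>x\<bar> \<le> 1" and q: "cmod (q / cis x - 1) \<le> \<bar>x\<bar> / 8"
  shows "\<bar>Im (Ln q) - x\<bar> \<le> \<bar>x\<bar> / 4" "q \<notin> \<real>\<^sub>\<le>\<^sub>0" "q = of_real (cmod q) * cis (Im (Ln q))"
proof -
  define e where "e = q / cis x - 1"
  have e: "cmod e \<le> \<bar>x\<bar> / 8" using q by (simp add: e_def)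
  have l: "cmod (Ln (1 + e)) \<le> 2 * cmod e" using e x by (intro norm_Ln_le) auto
  have ne: "1 + e \<noteq> 0"
  proof
    assume "1 + e = 0"
    then have "e = -1" by (simp add: add_eq_0_iff)
    with e x show False by simp
  qed
  have im: "\<bar>Im (Ln (1 + e))\<bar> \<le> \<bar>x\<bar> / 4"
    using l e abs_Im_le_cmod[of "Ln (1 + e)"] by linarith
  have "q = cis x * (1 + e)" by (simp add: e_def)
  also have "\<dots> = exp (\<i> * of_real x + Ln (1 + e))"
    using ne by (simp add: exp_add cis_conv_exp)
  finally have qe: "q = exp (\<i> * of_real x + Ln (1 + e))" .
  have "Ln q = \<i> * of_real x + Ln (1 + e)"
    unfolding qe using im x pi_gt3 by (intro Ln_exp) auto
  then show I: "\<bar>Im (Ln q) - x\<bar> \<le> \<bar>x\<bar> / 4" using im by simp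
  have q0: "q \<noteq> 0" unfolding qe by simp
  show "q \<notin> \<real>\<^sub>\<le>\<^sub>0"
  proof
    assume "q \<in> \<real>\<^sub>\<le>\<^sub>0"
    then obtain t where t: "q = of_real t" "t \<le> 0" by (auto elim!: nonpos_Reals_cases)
    then have "t < 0" using q0 by (cases "t = 0") auto
    then have "Im (Ln q) = pi" unfolding t by (simp add: Ln_of_real')
    with I x pi_gt3 show False by (auto simp: abs_if split: if_splits)
  qed
  have "q = exp (Ln q)" using q0 by simp
  also have "\<dots> = of_real (exp (Re (Ln q))) * cis (Im (Ln q))"
    by (simp only: exp_eq_polar)
  also have "exp (Re (Ln q)) = cmod q" using q0 by simp
  finally show "q = of_real (cmod q) * cis (Im (Ln q))" .
qed

text \<open>A variant of the Poincare-Birkhoff theorem in which an invariant function replaces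
  preservation of area. The bound on \<open>W\<close> concerns differences: it makes
  \<open>W\<close> comparable with \<open>(cmod w)^2\<close> and strictly increasing along
  rays.\<close>

lemma twist_periodic:
  fixes f :: "complex \<Rightarrow> complex" and W :: "complex \<Rightarrow> real"
  assumes R: "0 < R" and cont: "continuous_on (ball 0 R) f" and m: "1 \<le> m" and om: "\<omega> \<noteq> 0"
    and f: "\<And>w. cmod w < R \<Longrightarrow>
      cmod (f w - cis (\<theta> + \<omega> * cmod w ^ (2 * m)) * w) \<le> K * cmod w ^ (2 * m + 2)"
    and W: "\<And>w w'. cmod w < R \<Longrightarrow> cmod w' < R \<Longrightarrow>
      \<bar>W w' - W w - ((cmod w')\<^sup>2 - (cmod w)\<^sup>2)\<bar> \<le> 1 / 4 * max (cmod w) (cmod w') * cmod (w' - w)"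
    and inv: "\<And>w. cmod w < R \<Longrightarrow> cmod (f w) < R \<Longrightarrow> W (f w) = W w"
  shows "\<exists>N. odd N \<and> infinite {w. (\<forall>j. cmod ((f ^^ j) w) < R) \<and> (f ^^ N) w = w}"
proof -
  define K' where "K' = max K 1"
  have K': "K' \<ge> 1" "K \<le> K'" by (auto simp: K'_def)
  \<comment> \<open>The terms in turn: powers of \<open>cmod w\<close> decrease with the exponent,
    images stay within \<open>R\<close>, the relative error of \<open>f\<close> is at most an eighth
    of the twist, and the twist is at most 1.\<close>
  define \<rho> where "\<rho> = min (min 1 (R / 2)) (min (\<bar>\<omega>\<bar> / (8 * K')) (1 / (1 + \<bar>\<omega>\<bar>)))"
  have \<rho>0: "0 < \<rho>" using R om K' by (auto simp: \<rho>_def)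
  have \<rho>: "\<rho> \<le> 1" "\<rho> \<le> R / 2" "8 * K' * \<rho> \<le> \<bar>\<omega>\<bar>" "\<bar>\<omega>\<bar> * \<rho> \<le> 1"
  proof -
    show "\<rho> \<le> 1" "\<rho> \<le> R / 2" by (auto simp: \<rho>_def)
    have "\<rho> \<le> \<bar>\<omega>\<bar> / (8 * K')" "\<rho> \<le> 1 / (1 + \<bar>\<omega>\<bar>)" by (auto simp: \<rho>_def)
    with K' show "8 * K' * \<rho> \<le> \<bar>\<omega>\<bar>" by (simp add: field_simps)
    have "\<rho> * (1 + \<bar>\<omega>\<bar>) \<le> 1"
      using \<open>\<rho> \<le> 1 / (1 + \<bar>\<omega>\<bar>)\<close> by (simp add: field_simps)
    then show "\<bar>\<omega>\<bar> * \<rho> \<le> 1" using \<rho>0 by (simp add: algebra_simps)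
  qed
  \<comment> \<open>\<open>\<alpha> w\<close> is the angle beyond \<open>\<theta>\<close> by which
    \<open>f\<close> turns \<open>w\<close>, and \<open>x w\<close> is its leading term.\<close>
  define q where "q w = f w / (cis \<theta> * w)" for w
  define \<alpha> where "\<alpha> w = Im (Ln (q w))" for w
  define x where "x w = \<omega> * cmod w ^ (2 * m)" for w
  have pow: "cmod w ^ (2 * m) \<le> (cmod w)\<^sup>2" "cmod w ^ (2 * m) \<le> cmod w" if "cmod w < \<rho>" for w
  proof -
    show "cmod w ^ (2 * m) \<le> (cmod w)\<^sup>2" using that \<rho>(1) m by (intro power_decreasing) auto
    show "cmod w ^ (2 * m) \<le> cmod w"
      using that \<rho>(1) m power_decreasing[of 1 "2 * m" "cmod w"] by auto
  qed
  have x1: "\<bar>x w\<bar> \<le> 1" if "cmod w < \<rho>" for w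
  proof -
    have "\<bar>x w\<bar> \<le> \<bar>\<omega>\<bar> * \<rho>"
      unfolding x_def abs_mult using pow(2)[OF that] that by (intro mult_left_mono) auto
    with \<rho>(4) show ?thesis by simp
  qed
  have qx: "cmod (q w / cis (x w) - 1) \<le> \<bar>x w\<bar> / 8" if w: "cmod w < \<rho>" "w \<noteq> 0" for w
  proof -
    have "q w / cis (x w) - 1 = (f w - cis (\<theta> + x w) * w) / (cis (\<theta> + x w) * w)"
      using w(2) by (simp add: q_def cis_mult[symmetric] field_simps)
    then have "cmod (q w / cis (x w) - 1) = cmod (f w - cis (\<theta> + x w) * w) / cmod w"
      by (simp add: norm_divide norm_mult)
    also have "\<dots> \<le> (K * cmod w ^ (2 * m + 2)) / cmod w"
      using f[of w] w \<rho>(2) R by (intro divide_right_mono) (auto simp: x_def)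
    also have "\<dots> = K * cmod w * cmod w ^ (2 * m)"
      using w(2) by (simp add: field_simps power2_eq_square)
    also have "\<dots> \<le> (\<bar>\<omega>\<bar> / 8) * cmod w ^ (2 * m)"
    proof (rule mult_right_mono)
      have "K * cmod w \<le> K' * \<rho>" using w K' by (intro mult_mono) auto
      with \<rho>(3) show "K * cmod w \<le> \<bar>\<omega>\<bar> / 8" by simp
    qed simp
    finally show ?thesis by (simp add: x_def abs_mult)
  qed
  note est = cis_perturb_Ln[OF x1 qx]
  have fpolar: "f w = of_real (cmod (f w) / cmod w) * cis (\<theta> + \<alpha> w) * w"
    and fnz: "f w \<noteq> 0" if w: "cmod w < \<rho>" "w \<noteq> 0" for w
  proof -
    have "f w = q w * (cis \<theta> * w)" using w(2) by (simp add: q_def)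
    also have "q w = of_real (cmod (q w)) * cis (\<alpha> w)" unfolding \<alpha>_def by (rule est(3)[OF w(1) w])
    also have "cmod (q w) = cmod (f w) / cmod w" by (simp add: q_def norm_divide norm_mult)
    finally show "f w = of_real (cmod (f w) / cmod w) * cis (\<theta> + \<alpha> w) * w"
      by (simp add: cis_mult[symmetric] mult_ac)
    show "f w \<noteq> 0" using est(2)[OF w(1) w] by (auto simp: q_def)
  qed
  have fle: "cmod (f w) < R" if w: "cmod w < \<rho>" for w
  proof -
    have "cmod (f w) \<le> cmod (f w - cis (\<theta> + x w) * w) + cmod (cis (\<theta> + x w) * w)"
      by (metis norm_triangle_sub add.commute)
    also have "\<dots> \<le> K * cmod w ^ (2 * m + 2) + cmod w"
      using f[of w] w \<rho>(2) R by (auto simp: x_def norm_mult)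
    also have "K * cmod w ^ (2 * m + 2) \<le> 1 / 8 * cmod w"
    proof -
      have "K * cmod w \<le> K' * \<rho>" using w K' by (intro mult_mono) auto
      with \<rho>(3) have "K * cmod w \<le> \<bar>\<omega>\<bar> / 8" by simp
      then have "K * cmod w * cmod w ^ (2 * m) \<le> \<bar>\<omega>\<bar> / 8 * cmod w ^ (2 * m)"
        by (rule mult_right_mono) simp
      also have "\<dots> \<le> 1 / 8" using x1[OF w] by (simp add: x_def abs_mult)
      finally have "K * cmod w * cmod w ^ (2 * m) * cmod w \<le> 1 / 8 * cmod w"
        by (rule mult_right_mono) simp
      then show ?thesis by (simp add: power_add power2_eq_square mult_ac)
    qed
    finally have "cmod (f w) \<le> 9 / 8 * cmod w" by simp
    also have "\<dots> < R" using w \<rho>(2) \<rho>0 by simp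
    finally show ?thesis .
  qed
  define U where "U w = W w - W 0" for w
  have U: "3 / 4 * (cmod w)\<^sup>2 \<le> U w" "U w \<le> 5 / 4 * (cmod w)\<^sup>2" if "cmod w < R" for w
  proof -
    have "\<bar>U w - (cmod w)\<^sup>2\<bar> \<le> 1 / 4 * (cmod w)\<^sup>2"
      using W[of 0 w] that R by (simp add: U_def power2_eq_square)
    then show "3 / 4 * (cmod w)\<^sup>2 \<le> U w" "U w \<le> 5 / 4 * (cmod w)\<^sup>2" by linarith+
  qed
  \<comment> \<open>\<open>U\<close> is constant along orbits and lies between 3/4 and 5/4 of the
    squared modulus. So squared moduli change at most by the factor 5/3, which is below 4, and an
    orbit starting below \<open>\<rho> / 2\<close> stays below \<open>\<rho>\<close>.\<close>
  have orbit: "cmod ((f ^^ j) w) < \<rho> \<and> U ((f ^^ j) w) = U w"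
    and orbit_le: "(cmod ((f ^^ j) w))\<^sup>2 \<le> 5 / 3 * (cmod w)\<^sup>2"
    and orbit_ge: "3 / 5 * (cmod w)\<^sup>2 \<le> (cmod ((f ^^ j) w))\<^sup>2"
    if w: "cmod w < \<rho> / 2" for w j
  proof -
    have comp: "(cmod z)\<^sup>2 \<le> 5 / 3 * (cmod w)\<^sup>2" "3 / 5 * (cmod w)\<^sup>2 \<le> (cmod z)\<^sup>2"
      if "cmod z < R" "U z = U w" for z
      using U[OF that(1)] U[of w] w that(2) \<rho>(2) \<rho>0 by auto
    show *: "cmod ((f ^^ j) w) < \<rho> \<and> U ((f ^^ j) w) = U w" for j
    proof (induction j)
      case (Suc j)
      let ?z = "(f ^^ j) w"
      have z: "cmod ?z < \<rho>" "U ?z = U w" using Suc by auto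
      have "U (f ?z) = U w"
        using inv[of ?z] fle[OF z(1)] z \<rho>(2) R by (simp add: U_def)
      moreover have "(cmod (f ?z))\<^sup>2 < \<rho>\<^sup>2"
      proof -
        have "(cmod (f ?z))\<^sup>2 \<le> 5 / 3 * (cmod w)\<^sup>2"
          using comp(1)[OF fle[OF z(1)]] calculation by simp
        also have "\<dots> \<le> (2 * cmod w)\<^sup>2" by (simp add: power_mult_distrib)
        also have "\<dots> < \<rho>\<^sup>2" using w by (intro power_strict_mono) auto
        finally show ?thesis .
      qed
      then have "cmod (f ?z) < \<rho>" using \<rho>0 by (meson less_imp_le power2_less_imp_less)
      ultimately show ?case by simp
    qed (use w \<rho>0 in auto)
    show "(cmod ((f ^^ j) w))\<^sup>2 \<le> 5 / 3 * (cmod w)\<^sup>2" "3 / 5 * (cmod w)\<^sup>2 \<le> (cmod ((f ^^ j) w))\<^sup>2"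
      using *[of j] \<rho>(2) R comp[of "(f ^^ j) w"] by auto
  qed
  have orbit_nz: "(f ^^ j) w \<noteq> 0" if "cmod w < \<rho> / 2" "w \<noteq> 0" for w j
    using orbit_ge[OF that(1), of j] that(2) by auto
  \<comment> \<open>The angles are added as real numbers, not modulo \<open>2 * pi\<close>; thus the
    total is continuous and can exceed a full turn.\<close>
  define \<Theta> where "\<Theta> N w = (\<Sum>j<N. \<alpha> ((f ^^ j) w))" for N :: nat and w
  have polar: "(f ^^ N) w = of_real (cmod ((f ^^ N) w) / cmod w) * cis (real N * \<theta> + \<Theta> N w) * w"
    if w: "cmod w < \<rho> / 2" "w \<noteq> 0" for N w
  proof (induction N)
    case (Suc N)
    let ?z = "(f ^^ N) w"
    have z: "cmod ?z < \<rho>" "?z \<noteq> 0" using orbit[OF w(1)] orbit_nz[OF w] by auto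
    have "f ?z = of_real (cmod (f ?z) / cmod ?z) * cis (\<theta> + \<alpha> ?z) * ?z" by (rule fpolar[OF z])
    also have "\<dots> = of_real (cmod (f ?z) / cmod ?z) * cis (\<theta> + \<alpha> ?z) *
        (of_real (cmod ?z / cmod w) * cis (real N * \<theta> + \<Theta> N w) * w)"
      by (rule arg_cong[OF Suc.IH, of "\<lambda>y. of_real (cmod (f ?z) / cmod ?z) * cis (\<theta> + \<alpha> ?z) * y"])
    also have "\<dots> = of_real ((cmod (f ?z) / cmod ?z) * (cmod ?z / cmod w)) *
        (cis (\<theta> + \<alpha> ?z) * cis (real N * \<theta> + \<Theta> N w)) * w"
      by (simp only: of_real_mult mult_ac)
    also have "(cmod (f ?z) / cmod ?z) * (cmod ?z / cmod w) = cmod (f ?z) / cmod w"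
      using z(2) by simp
    also have "cis (\<theta> + \<alpha> ?z) * cis (real N * \<theta> + \<Theta> N w) = cis (real (Suc N) * \<theta> + \<Theta> (Suc N) w)"
      by (simp add: cis_mult \<Theta>_def algebra_simps)
    finally show ?case unfolding funpow.simps o_apply .
  qed (use w in \<open>simp add: \<Theta>_def\<close>)
  have f_cont: "continuous_on (ball 0 (\<rho> / 2)) (f ^^ j)" for j
  proof (induction j)
    case (Suc j)
    have "(f ^^ j) ` ball 0 (\<rho> / 2) \<subseteq> ball 0 R" using orbit[of _ j] \<rho>(2) R by fastforce
    with Suc show ?case
      by (simp add: o_def) (rule continuous_on_compose2[OF cont])
  qed (simp add: id_def)
  have q_cont: "continuous_on (ball 0 \<rho> - {0}) \<alpha>"
    unfolding \<alpha>_def q_def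
    by (intro continuous_intros continuous_on_subset[OF cont])
      (use est(2) \<rho>(2) R in \<open>auto simp: q_def\<close>)
  have \<Theta>_cont: "continuous_on (ball 0 (\<rho> / 2) - {0}) (\<Theta> N)" for N
    unfolding \<Theta>_def
  proof (intro continuous_on_sum)
    fix j
    show "continuous_on (ball 0 (\<rho> / 2) - {0}) (\<lambda>w. \<alpha> ((f ^^ j) w))"
      by (rule continuous_on_compose2[OF q_cont continuous_on_subset[OF f_cont[of j]]])
        (use orbit[of _ j] orbit_nz[of _ j] in auto)
  qed
  define s where "s = sgn \<omega>"
  have s: "s * s = 1" "s * \<omega> = \<bar>\<omega>\<bar>" "\<bar>s\<bar> = 1" using om by (auto simp: s_def sgn_if)
  have \<alpha>s: "3 / 4 * \<bar>x w\<bar> \<le> s * \<alpha> w" "s * \<alpha> w \<le> 5 / 4 * \<bar>x w\<bar>" if w: "cmod w < \<rho>" "w \<noteq> 0" for w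
  proof -
    have "\<bar>s * \<alpha> w - s * x w\<bar> \<le> \<bar>x w\<bar> / 4"
      using est(1)[OF w(1) w] s(3) unfolding \<alpha>_def by (simp add: abs_mult flip: right_diff_distrib)
    moreover have "s * x w = \<bar>x w\<bar>" using s(2) by (simp add: x_def abs_mult)
    ultimately show "3 / 4 * \<bar>x w\<bar> \<le> s * \<alpha> w" "s * \<alpha> w \<le> 5 / 4 * \<bar>x w\<bar>" by linarith+
  qed
  define r where "r = \<rho> / 4"
  have r: "0 < r" "r < \<rho> / 2" using \<rho>0 by (auto simp: r_def)
  \<comment> \<open>A lower bound for the excess angle of a single step on orbits starting at
    modulus \<open>r\<close>: 3/4 is the loss in \<open>\<alpha>\<close>, 3/5 the loss in the
    squared modulus.\<close>
  define L where "L = 3 / 4 * (\<bar>\<omega>\<bar> * (3 / 5 * r\<^sup>2) ^ m)"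
  have L: "L > 0" using om r by (simp add: L_def)
  obtain n where n: "2 * pi / L < real n" using reals_Archimedean2 by blast
  define N where "N = 2 * n + 1"
  have N: "odd N" "2 * pi < real N * L"
  proof -
    have "2 * pi < real n * L" using n L by (simp add: field_simps)
    also have "\<dots> \<le> real N * L" using L by (intro mult_right_mono) (auto simp: N_def)
    finally show "2 * pi < real N * L" .
  qed (simp add: N_def)
  have far: "2 * pi < s * \<Theta> N w" if "cmod w = r" for w
  proof -
    have w: "cmod w < \<rho> / 2" "w \<noteq> 0" using that r by auto
    have "real N * L = (\<Sum>j<N. L)" by simp
    also have "\<dots> \<le> (\<Sum>j<N. s * \<alpha> ((f ^^ j) w))"
    proof (rule sum_mono)
      fix j
      let ?z = "(f ^^ j) w"
      have "(3 / 5 * r\<^sup>2) ^ m \<le> ((cmod ?z)\<^sup>2) ^ m"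
        using orbit_ge[OF w(1), of j] that by (intro power_mono) auto
      then have "L \<le> 3 / 4 * \<bar>x ?z\<bar>"
        by (simp add: L_def x_def abs_mult power_mult mult_left_mono)
      also have "\<dots> \<le> s * \<alpha> ?z" using orbit[OF w(1)] orbit_nz[OF w] by (intro \<alpha>s(1)) auto
      finally show "L \<le> s * \<alpha> ?z" .
    qed
    also have "\<dots> = s * \<Theta> N w" by (simp add: \<Theta>_def sum_distrib_left)
    finally show ?thesis using N(2) by simp
  qed
  define c where "c = real N * (5 / 4 * (\<bar>\<omega>\<bar> * (5 / 3)))"
  have near: "s * \<Theta> N w \<le> c * (cmod w)\<^sup>2" if w: "cmod w < \<rho> / 2" "w \<noteq> 0" for w
  proof -
    have "s * \<Theta> N w = (\<Sum>j<N. s * \<alpha> ((f ^^ j) w))" by (simp add: \<Theta>_def sum_distrib_left)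
    also have "\<dots> \<le> (\<Sum>j<N. 5 / 4 * (\<bar>\<omega>\<bar> * (5 / 3 * (cmod w)\<^sup>2)))"
    proof (rule sum_mono)
      fix j
      let ?z = "(f ^^ j) w"
      have z: "cmod ?z < \<rho>" "?z \<noteq> 0" using orbit[OF w(1)] orbit_nz[OF w] by auto
      have "cmod ?z ^ (2 * m) \<le> 5 / 3 * (cmod w)\<^sup>2"
        using pow(1)[OF z(1)] orbit_le[OF w(1), of j] by linarith
      then have "\<bar>\<omega>\<bar> * cmod ?z ^ (2 * m) \<le> \<bar>\<omega>\<bar> * (5 / 3 * (cmod w)\<^sup>2)"
        by (rule mult_left_mono) simp
      then have "5 / 4 * \<bar>x ?z\<bar> \<le> 5 / 4 * (\<bar>\<omega>\<bar> * (5 / 3 * (cmod w)\<^sup>2))"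
        unfolding x_def abs_mult by simp
      with \<alpha>s(2)[OF z] show "s * \<alpha> ?z \<le> 5 / 4 * (\<bar>\<omega>\<bar> * (5 / 3 * (cmod w)\<^sup>2))" by linarith
    qed
    also have "\<dots> = c * (cmod w)\<^sup>2" by (simp add: c_def)
    finally show ?thesis .
  qed
  have c: "0 < c" using om N by (auto simp: c_def intro!: mult_pos_pos odd_pos)
  \<comment> \<open>\<open>g\<close> is the total excess, measured in the direction of the twist,
    that completes \<open>N * \<theta>\<close> to a multiple of \<open>2 * pi\<close>. The floor
    plus one makes \<open>g\<close> strictly positive, so it exceeds the excess near 0, and keeps it
    at most \<open>2 * pi\<close>, so it is exceeded at modulus \<open>r\<close>.\<close>
  define k where "k = \<lfloor>s * (real N * \<theta>) / (2 * pi)\<rfloor> + 1"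
  define g where "g = s * (2 * pi * (s * of_int k) - real N * \<theta>)"
  have g: "0 < g" "g \<le> 2 * pi"
  proof -
    define y where "y = s * (real N * \<theta>) / (2 * pi)"
    have "g = (s * s) * (2 * pi * of_int k) - s * (real N * \<theta>)"
      by (simp add: g_def algebra_simps)
    also have "s * (real N * \<theta>) = 2 * pi * y" by (simp add: y_def)
    finally have "g = 2 * pi * (of_int k - y)"
      unfolding s(1) by (simp add: right_diff_distrib)
    moreover have "0 < of_int k - y" "of_int k - y \<le> 1"
      unfolding k_def y_def[symmetric] by linarith+
    ultimately show "0 < g" "g \<le> 2 * pi" by (auto simp: mult_left_le)
  qed
  define t0 where "t0 = min (r / 2) (sqrt (g / c) / 2)"
  have t0: "0 < t0" "t0 \<le> r" "c * t0\<^sup>2 \<le> g"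
  proof -
    show "0 < t0" "t0 \<le> r" using r g c by (auto simp: t0_def)
    have "0 < sqrt (g / c)" using g c by simp
    then have "t0 \<le> sqrt (g / c)" unfolding t0_def by linarith
    then have "t0\<^sup>2 \<le> (sqrt (g / c))\<^sup>2" using \<open>0 < t0\<close> by (intro power_mono) auto
    then show "c * t0\<^sup>2 \<le> g" using g c by (simp add: field_simps)
  qed
  have periodic: "\<exists>t>0. t \<le> r \<and> (f ^^ N) (of_real t * u) = of_real t * u" if u: "cmod u = 1" for u
  proof -
    have u0: "u \<noteq> 0" using u by auto
    have cm: "cmod (of_real t * u) = t" if "0 \<le> t" for t using u that by (simp add: norm_mult)
    have "continuous_on {t0..r} (\<lambda>t. s * \<Theta> N (of_real t * u))"
      by (intro continuous_intros continuous_on_compose2[OF \<Theta>_cont])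
        (use cm t0 r u in \<open>auto simp: dist_norm norm_mult\<close>)
    moreover have "s * \<Theta> N (of_real t0 * u) \<le> g"
      using near[of "of_real t0 * u"] cm[of t0] t0 r u0 by (auto simp: norm_mult)
    moreover have "g \<le> s * \<Theta> N (of_real r * u)"
      using far[of "of_real r * u"] cm[of r] r g(2) by auto
    ultimately obtain t where t: "t0 \<le> t" "t \<le> r" "s * \<Theta> N (of_real t * u) = g"
      using IVT'[of "\<lambda>t. s * \<Theta> N (of_real t * u)" t0 g r] t0(2) by auto
    define w where "w = of_real t * u"
    have cw: "cmod w = t" using cm[of t] t t0 by (simp add: w_def)
    have w: "cmod w < \<rho> / 2" "w \<noteq> 0" using cw t t0 r by auto
    have "s * (s * \<Theta> N w) = s * (s * (2 * pi * (s * of_int k) - real N * \<theta>))"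
      using t(3) by (simp add: g_def w_def)
    then have "s * s * \<Theta> N w = s * s * (2 * pi * (s * of_int k) - real N * \<theta>)"
      by (simp only: mult.assoc)
    then have \<Theta>w: "real N * \<theta> + \<Theta> N w = 2 * pi * (s * of_int k)"
      unfolding s(1) by simp
    have "s * of_int k \<in> \<int>" by (auto simp: s_def sgn_if)
    then have "cis (real N * \<theta> + \<Theta> N w) = 1" unfolding \<Theta>w by (rule cis_multiple_2pi)
    with polar[OF w, of N] obtain d where d: "d > 0" "(f ^^ N) w = of_real d * w"
      using orbit_nz[OF w, of N] w(2) by (metis divide_pos_pos mult.right_neutral zero_less_norm_iff)
    \<comment> \<open>With equal values of \<open>W\<close> at \<open>w\<close> and
      \<open>d * w\<close>, the bound on \<open>W\<close> says that the difference of the squared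
      moduli is at most a quarter of itself.\<close>
    have "d = 1"
    proof (rule ccontr)
      assume "d \<noteq> 1"
      have cd: "cmod (of_real d * w) = d * t" using d(1) cw by (simp add: norm_mult)
      have cd': "cmod (of_real d * w - w) = \<bar>d - 1\<bar> * t"
      proof -
        have "of_real d * w - w = of_real (d - 1) * w" by (simp add: algebra_simps)
        then show ?thesis using cw by (simp only: norm_mult norm_of_real)
      qed
      have eq: "W (of_real d * w) = W w" using orbit[OF w(1), of N] d(2) by (simp add: U_def)
      have "d * t < R" using orbit[OF w(1), of N] cd d(2) \<rho>(2) R by simp
      then have "\<bar>(d * t)\<^sup>2 - t\<^sup>2\<bar> \<le> 1 / 4 * max t (d * t) * (\<bar>d - 1\<bar> * t)"
        using W[of w "of_real d * w"] eq cd cd' cw w(1) \<rho>(2) \<rho>0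
        by (simp add: abs_minus_commute)
      also have "\<dots> \<le> 1 / 4 * ((d + 1) * t) * (\<bar>d - 1\<bar> * t)"
        using d(1) t(1) t0(1) by (intro mult_mono mult_nonneg_nonneg) (auto simp: algebra_simps max_def)
      also have "\<dots> = 1 / 4 * (\<bar>d - 1\<bar> * ((d + 1) * t\<^sup>2))" by (simp add: power2_eq_square)
      also have "(d * t)\<^sup>2 - t\<^sup>2 = (d - 1) * ((d + 1) * t\<^sup>2)" by (simp add: power2_eq_square algebra_simps)
      also have "\<bar>(d - 1) * ((d + 1) * t\<^sup>2)\<bar> = \<bar>d - 1\<bar> * ((d + 1) * t\<^sup>2)"
        using d(1) by (simp add: abs_mult)
      finally have "\<bar>d - 1\<bar> * ((d + 1) * t\<^sup>2) \<le> 1 / 4 * (\<bar>d - 1\<bar> * ((d + 1) * t\<^sup>2))" .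
      moreover have "0 < \<bar>d - 1\<bar> * ((d + 1) * t\<^sup>2)"
        using \<open>d \<noteq> 1\<close> d(1) t(1) t0(1) by (intro mult_pos_pos) auto
      ultimately show False by linarith
    qed
    with d(2) have "(f ^^ N) w = w" by simp
    then show ?thesis using t t0 unfolding w_def by (intro exI[of _ t]) auto
  qed
  define P where "P = {w. (\<forall>j. cmod ((f ^^ j) w) < R) \<and> (f ^^ N) w = w}"
  \<comment> \<open>The directions of the periodic points cover an arc; \<open>cis\<close> is
    injective on \<open>{0..1}\<close> because 1 is less than \<open>pi\<close>.\<close>
  have "cis ` {0..1} \<subseteq> sgn ` P"
  proof
    fix u assume "u \<in> cis ` {0..1}"
    then have u: "cmod u = 1" by auto
    from periodic[OF u] obtain t where t: "t > 0" "t \<le> r" "(f ^^ N) (of_real t * u) = of_real t * u"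
      by auto
    have "cmod (of_real t * u) < \<rho> / 2" using t r u by (simp add: norm_mult)
    then have "cmod ((f ^^ j) (of_real t * u)) < R" for j
      using orbit[of "of_real t * u" j] \<rho>(2) R by auto
    with t(3) have "of_real t * u \<in> P" by (auto simp: P_def)
    moreover have "sgn (of_real t * u) = u"
      unfolding sgn_eq using t(1) u by (simp add: norm_mult)
    ultimately show "u \<in> sgn ` P" by (metis image_eqI)
  qed
  moreover have "infinite (cis ` {0..1})"
  proof -
    have "inj_on cis {0..1}"
    proof (rule inj_onI)
      fix a b :: real assume "a \<in> {0..1}" "b \<in> {0..1}" "cis a = cis b"
      then have "Arg (cis a) = Arg (cis b)" "a \<in> {-pi<..pi}" "b \<in> {-pi<..pi}" using pi_gt3 by auto
      then show "a = b" by (simp only: Arg_cis)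
    qed
    moreover have "infinite {0..1::real}" by (simp add: infinite_Icc)
    ultimately show ?thesis by (simp add: finite_image_iff)
  qed
  ultimately have "infinite P" using finite_subset by blast
  with N(1) show ?thesis unfolding P_def by blast
qed

section \<open>Approximate invariant curves\<close>

text \<open>
  An approximate invariant curve is sought in the form \<open>x\<^sub>n = x\<^sub>0 (1 + K (a cos (\<phi> + n \<Omega>)))\<close>, where \<open>K\<close> is the
  polynomial \<open>X + al r + be X\<^sup>2 + \<dots>\<close> in \<open>X\<close> and \<open>r = a\<^sup>2\<close>, and \<open>2 cos \<Omega> = t + k1 r + k2 r\<^sup>2\<close>. Since the sum and
  the product of \<open>a cos (\<phi> \<plusminus> \<Omega>)\<close> are polynomials in \<open>X\<close> and \<open>r\<close>, the recurrence becomes the following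
  equations for the coefficients of the monomials of degree at most five (three if \<open>k1 \<noteq> 0\<close>), with \<open>r\<close>
  of degree two. The numbers \<open>k1\<close> and \<open>k2\<close> are multiples of the first two Birkhoff constants.
\<close>

definition param_eqs ::
  "real \<Rightarrow> real \<Rightarrow> real \<Rightarrow> real \<Rightarrow> real \<Rightarrow> real \<Rightarrow> real \<Rightarrow> real \<Rightarrow> real \<Rightarrow> real \<Rightarrow> real \<Rightarrow> real \<Rightarrow> bool" where
  "param_eqs t C k1 k2 al be ga de ep io et xi \<longleftrightarrow> (let s = 1 - t\<^sup>2 / 4 in
     be * (t\<^sup>2 - 2) + 1 - t * be - C = 0 \<and>
     2 * al + 2 * be * s - s - t * al = 0 \<and>
     ga * (t ^ 3 - 3 * t) + be * t - t * ga - 2 * C * be = 0 \<and>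
     3 * ga * t * s + al * t - be * t * s - 2 * C * al + k1 = 0 \<and>
     (k1 \<noteq> 0 \<and> de = 0 \<and> ep = 0 \<and> io = 0 \<and> et = 0 \<and> xi = 0 \<or>
      k1 = 0 \<and> k2 \<noteq> 0 \<and>
      io * (t ^ 4 - 4 * t\<^sup>2 + 2 - t) + ga * (t\<^sup>2 - 2) + be\<^sup>2 - C * (2 * ga + be\<^sup>2) = 0 \<and>
      ep * (t\<^sup>2 - 2 - t) + io * (4 * (t\<^sup>2 - 2) * s + 4 * s) + ga * (2 * s - s * (t\<^sup>2 - 2))
        + al * be * (t\<^sup>2 - 2) - 2 * be\<^sup>2 * s - 2 * C * al * be = 0 \<and>
      de * (2 - t) + 2 * s * ep + 2 * io * s\<^sup>2 - 2 * ga * s\<^sup>2 + al\<^sup>2 + 2 * al * be * s + be\<^sup>2 * s\<^sup>2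
        - C * al\<^sup>2 = 0 \<and>
      et * (t ^ 5 - 5 * t ^ 3 + 5 * t - t) + io * (t ^ 3 - 3 * t) + be * ga * t - 2 * C * (io + be * ga) = 0 \<and>
      et * (5 * t ^ 3 - 10 * t) * s + xi * (t ^ 3 - 3 * t) - xi * t + ep * t
        + io * (3 * t * s - s * (t ^ 3 - 3 * t)) + al * ga * (t ^ 3 - 3 * t) - 2 * be * ga * t * s
        - 2 * C * (ep + al * ga) = 0 \<and>
      et * (5 * t * s\<^sup>2) + xi * (3 * t * s) + de * t - ep * t * s - io * (3 * t * s\<^sup>2) + al * ga * (3 * t * s)
        + be * ga * t * s\<^sup>2 - 2 * C * de + k2 = 0))"

definition second_twist :: "real \<Rightarrow> real \<Rightarrow> real" where
  "second_twist t b = b * (- 36 - 32 * t - 51 * t^2 - 28 * t^3 + 7 * t^4 + 9 * t^5 + 2 * t^6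
     + b * (156 + 262 * t + 218 * t^2 + 170 * t^3 + 8 * t^4 - 49 * t^5 - 19 * t^6 - 2 * t^7)
     + b^2 * (- 192 - 544 * t - 484 * t^2 - 242 * t^3 - 90 * t^4 + 62 * t^5 + 52 * t^6 + 10 * t^7)
     + b^3 * (48 + 296 * t + 440 * t^2 + 196 * t^3 - 28 * t^5 - 32 * t^6 - 8 * t^7))"

text \<open>
  The assumption says that the first Birkhoff constant vanishes, the polynomial in the conclusion is the
  numerator of the second one; here \<open>C = 1 - b (2 - t) (1 + t)\<close>. Pseudo-division of the second by the
  first leaves a remainder linear in \<open>b\<close>, whose root \<open>r0 / r1\<close> is substituted into the first.
\<close>

lemma second_twist_nonzero:
  fixes t b :: real
  assumes t: "-2 < t" "t < 2" "t \<noteq> -1" "t \<noteq> 0" "t \<noteq> 1" "t\<^sup>2 + t - 1 \<noteq> 0"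
    and q1: "2 * (1 + t) * (1 + 2 * t) * b\<^sup>2 - (t + 1) * (t + 5) * b + 2 + t = 0"
  shows "second_twist t b \<noteq> 0"
proof
  define n where "n = (- 36 - 32 * t - 51 * t^2 - 28 * t^3 + 7 * t^4 + 9 * t^5 + 2 * t^6
     + b * (156 + 262 * t + 218 * t^2 + 170 * t^3 + 8 * t^4 - 49 * t^5 - 19 * t^6 - 2 * t^7)
     + b^2 * (- 192 - 544 * t - 484 * t^2 - 242 * t^3 - 90 * t^4 + 62 * t^5 + 52 * t^6 + 10 * t^7)
     + b^3 * (48 + 296 * t + 440 * t^2 + 196 * t^3 - 28 * t^5 - 32 * t^6 - 8 * t^7))"
  assume "second_twist t b = 0"
  moreover have "b \<noteq> 0" using q1 t by auto
  ultimately have N: "n = 0" by (simp add: second_twist_def n_def)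
  define r0 r1 g where "r0 = 3 + 2 * t + t\<^sup>2" and "r1 = 6 + 6 * t + 2 * t\<^sup>2 + t ^ 3"
    and "g = 12 * ((2 - t) * (1 + t)\<^sup>2 * (2 + t) * (t\<^sup>2 + t - 1) * (t - 1))"
  define q where "q = 2 * (1 + t) * (1 + 2 * t) * b\<^sup>2 - (t + 1) * (t + 5) * b + 2 + t"
  define h0 h1 where
    "h0 = 6 + 55 * t + 178 * t^2 + 527 / 2 * t^3 + 367 / 2 * t^4 + 91 / 2 * t^5 - 29 / 2 * t^6 - 20 * t^7 - 11 * t^8 - 2 * t^9"
    and "h1 = - 9 - 59 / 2 * t - 61 * t^2 - 103 * t^3 - 122 * t^4 - 83 * t^5 - 53 / 4 * t^6 + 20 * t^7 + 47 / 4 * t^8 + 2 * t^9"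
  have "(2 * (1 + t) * (1 + 2 * t))\<^sup>2 * n = 16 * (h0 * b + h1) * q + g * (r0 - r1 * b)"
    unfolding n_def h0_def h1_def q_def g_def r0_def r1_def by algebra
  then have "g * (r0 - r1 * b) = 0" using N q1 by (simp add: q_def)
  moreover have "g \<noteq> 0" using t by (simp add: g_def)
  ultimately have b: "r1 * b = r0" by simp
  \<comment> \<open>The right side is \<open>r1^2\<close> times the first constant evaluated at
    \<open>r0 / r1\<close>, written without division in case \<open>r1\<close> vanishes.\<close>
  have "t\<^sup>2 * (2 + t) * (2 * t + 1)\<^sup>2 =
      2 * (1 + t) * (1 + 2 * t) * r0\<^sup>2 - (t + 1) * (t + 5) * r0 * r1 + (2 + t) * r1\<^sup>2"
    unfolding r0_def r1_def by algebra
  also have "\<dots> = r1\<^sup>2 * q" unfolding b[symmetric] q_def by algebra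
  finally have "t\<^sup>2 * (2 + t) * (2 * t + 1)\<^sup>2 = 0" using q1 by (simp add: q_def)
  \<comment> \<open>Here the leading coefficient of \<open>q\<close> is zero, so the pseudo-division
    carries no information about \<open>n\<close>; but \<open>q\<close> is then linear in
    \<open>b\<close> and determines it.\<close>
  then have t': "t = - 1 / 2" using t by auto
  with q1 have "b = 2 / 3" by (simp add: power2_eq_square)
  with N show False unfolding n_def t' by (simp add: power2_eq_square power_numeral_reduce)
qed

text \<open>The system is triangular: each equation fixes one new unknown, whose divisor is
  \<open>2 cos (l \<theta>) - t\<close> for the harmonic \<open>l\<close> concerned. For
  \<open>r X\<close> and \<open>r^2 X\<close> this divisor would be that of the first harmonic,
  which is zero, and the frequency corrections \<open>k1\<close> and \<open>k2\<close> are the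
  unknowns instead.\<close>

lemma param_eqs_exist:
  fixes t C :: real
  assumes t: "-2 < t" "t < 2" "t \<noteq> -1" "t \<noteq> 0" "t\<^sup>2 + t - 1 \<noteq> 0" and C: "C \<noteq> 0"
  shows "\<exists>k1 k2 al be ga de ep io et xi. param_eqs t C k1 k2 al be ga de ep io et xi"
proof -
  \<comment> \<open>The solution of the first equation, as
    \<open>t^2 - t - 2 = (t - 2) * (t + 1)\<close>. Everything else becomes polynomial in
    \<open>b\<close> and \<open>t\<close> up to denominators in \<open>t\<close>.\<close>
  define b where "b = (1 - C) / ((2 - t) * (1 + t))"
  have Cb: "C = 1 - b * (2 - t) * (1 + t)" using t by (simp add: b_def)
  have nz: "2 - t \<noteq> 0" "1 + t \<noteq> 0" "t \<noteq> 0" "2 + t \<noteq> 0" "t\<^sup>2 + t - 1 \<noteq> 0" using t by auto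
  define q1 where "q1 = 2 * (1 + t) * (1 + 2 * t) * b\<^sup>2 - (t + 1) * (t + 5) * b + 2 + t"
  define k1 where "k1 = (2 - t) / 4 * q1"
  define al where "al = (1 / 2 + 1 / 4 * t) + b * (- 1 - 1 / 2 * t)"
  define ga where "ga = (b * (- 1) + b ^ 2 * (2 + 2 * t)) / (t * (2 + t))"
  have low: "b * (t\<^sup>2 - 2) + 1 - t * b - C = 0"
    "2 * al + 2 * b * (1 - t\<^sup>2 / 4) - (1 - t\<^sup>2 / 4) - t * al = 0"
    unfolding Cb al_def by algebra+
  have ga: "ga * (t * (2 + t)) = b * (- 1) + b ^ 2 * (2 + 2 * t)"
    using nz by (simp add: ga_def)
  have low3: "ga * (t ^ 3 - 3 * t) + b * t - t * ga - 2 * C * b = 0"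
  proof -
    have "ga * (t ^ 3 - 3 * t) + b * t - t * ga - 2 * C * b = (t - 2) * (ga * (t * (2 + t))) + b * t - 2 * C * b"
      by algebra
    also have "\<dots> = 0" unfolding ga Cb by algebra
    finally show ?thesis .
  qed
  have low3': "3 * ga * t * (1 - t\<^sup>2 / 4) + al * t - b * t * (1 - t\<^sup>2 / 4) - 2 * C * al + k1 = 0"
  proof -
    have "3 * ga * t * (1 - t\<^sup>2 / 4) + al * t - b * t * (1 - t\<^sup>2 / 4) - 2 * C * al + k1
      = 3 / 4 * (2 - t) * (ga * (t * (2 + t))) + al * t - b * t * (1 - t\<^sup>2 / 4) - 2 * C * al + k1"
      by algebra
    also have "\<dots> = 0" unfolding ga Cb al_def k1_def q1_def by algebra
    finally show ?thesis .
  qed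
  show ?thesis
  proof (cases "k1 = 0")
    case False
    with low low3 low3' have "param_eqs t C k1 0 al b ga 0 0 0 0 0" by (simp add: param_eqs_def Let_def)
    then show ?thesis by blast
  next
    case True
    then have q0: "q1 = 0" using t by (simp add: k1_def)
    \<comment> \<open>The divisor of the fifth harmonic contains \<open>t - 1\<close>. At
      \<open>t = 1\<close> the vanishing of \<open>q1\<close> is a double root in \<open>b\<close>
      that corresponds to \<open>C = 0\<close>.\<close>
    have t1: "t \<noteq> 1"
    proof
      assume "t = 1"
      then have "3 * (2 * b - 1)\<^sup>2 = 0" using q0 by (simp add: q1_def power2_eq_square algebra_simps)
      then have "b = 1 / 2" by simp
      with Cb C \<open>t = 1\<close> show False by simp
    qed
    \<comment> \<open>A common denominator for all coefficients. Each unknown is specified by its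
      product with \<open>D\<close>, so that the equations, multiplied by \<open>D\<close>, are
      polynomial identities in \<open>b\<close> and \<open>t\<close>.\<close>
    define D where "D = (1 + t) * t\<^sup>2 * (2 + t)\<^sup>2 * (t\<^sup>2 + t - 1) * (t - 1)"
    have D: "D \<noteq> 0" using nz t1 by (simp add: D_def)
    have solve: "\<exists>x. x * D = y" for y using D by (intro exI[of _ "y / D"]) simp
    have gaD: "ga * D = (b * (- 1) + b ^ 2 * (2 + 2 * t)) * ((1 + t) * t * (2 + t) * (t\<^sup>2 + t - 1) * (t - 1))"
      unfolding ga[symmetric] D_def by algebra
    obtain io where ioD: "io * D = (b * (2 + t) + b ^ 2 * (- 6 - 8 * t - 2 * t ^ 2) + b ^ 3 * (4 + 10 * t + 7 * t ^ 2
        + t ^ 3)) * (t * (2 + t) * (t - 1))"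
      using solve by blast
    obtain ep where epD: "ep * D = (b * (- 1 + t - 1 / 4 * t ^ 2 - 3 / 2 * t ^ 3 - t ^ 4 - 1 / 4 * t ^ 5) + b ^ 2 * (4
        - 5 / 2 * t ^ 2 + 4 * t ^ 3 + 3 * t ^ 4 + 1 / 2 * t ^ 5) + b ^ 3 * (- 4 - 4 * t + 4 * t ^ 2 + 2 * t ^ 3 - 3 * t ^ 4
        - t ^ 5)) * (t * (2 + t)\<^sup>2 * (t - 1))"
      using solve by blast
    obtain de where deD: "de * D = (b * (1 / 2 - 1 / 4 * t - 1 / 8 * t ^ 2 + 3 / 16 * t ^ 3 - 11 / 16 * t ^ 4 - t ^ 5
        - 7 / 16 * t ^ 6 - 1 / 16 * t ^ 7) + b ^ 2 * (- 2 - 1 / 2 * t + 9 / 4 * t ^ 2 + 7 / 8 * t ^ 3 + 31 / 16 * t ^ 4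
        + 13 / 4 * t ^ 5 + 7 / 4 * t ^ 6 + 5 / 16 * t ^ 7) + b ^ 3 * (2 + 2 * t - 3 * t ^ 2 - 4 * t ^ 3 - 15 / 8 * t ^ 4
        - 15 / 8 * t ^ 5 - 5 / 4 * t ^ 6 - 1 / 4 * t ^ 7)) * (t * (2 + t)\<^sup>2 * (t - 1))"
      using solve by blast
    obtain et where etD: "et * D = (b * (- 2 - 3 * t - t ^ 2) + b ^ 2 * (9 + 17 * t + 11 * t ^ 2 + 2 * t ^ 3) + b ^ 3 * (- 12
        - 30 * t - 29 * t ^ 2 - 12 * t ^ 3 - t ^ 4) + b ^ 4 * (4 + 16 * t + 22 * t ^ 2 + 14 * t ^ 3 + 4 * t ^ 4)) * (1)"
      using solve by blast
    obtain xi where xiD: "xi * D = (b * (7 / 2 + 21 / 4 * t - 7 / 4 * t ^ 2 - 19 / 4 * t ^ 3 - 1 / 2 * t ^ 4 + 3 * t ^ 5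
        + 9 / 4 * t ^ 6 + 1 / 2 * t ^ 7) + b ^ 2 * (- 27 / 2 - 34 * t - 37 / 4 * t ^ 2 + 123 / 4 * t ^ 3 + 59 / 4 * t ^ 4
        - 14 * t ^ 5 - 16 * t ^ 6 - 13 / 2 * t ^ 7 - t ^ 8) + b ^ 3 * (12 + 58 * t + 123 / 2 * t ^ 2 - 61 / 2 * t ^ 3
        - 225 / 4 * t ^ 4 + 12 * t ^ 5 + 67 / 2 * t ^ 6 + 13 * t ^ 7 + 7 / 4 * t ^ 8) + b ^ 4 * (2 - 22 * t - 64 * t ^ 2
        - 33 * t ^ 3 + 75 / 2 * t ^ 4 + 59 / 2 * t ^ 5 - 11 * t ^ 6 - 12 * t ^ 7 - 2 * t ^ 8)) * (1)"
      using solve by blast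
    define k2 where "k2 = second_twist t b / (16 * (t * (2 + t)))"
    have k2D: "k2 * D = second_twist t b / 16 * ((1 + t) * t * (2 + t) * (t\<^sup>2 + t - 1) * (t - 1))"
    proof -
      have "k2 * (t * (2 + t)) = second_twist t b / 16" using nz by (simp add: k2_def)
      moreover have "k2 * D = (k2 * (t * (2 + t))) * ((1 + t) * t * (2 + t) * (t\<^sup>2 + t - 1) * (t - 1))"
        unfolding D_def by algebra
      ultimately show ?thesis by (simp only:)
    qed
    define s where "s = 1 - t\<^sup>2 / 4"
    have e1: "io * (t ^ 4 - 4 * t\<^sup>2 + 2 - t) + ga * (t\<^sup>2 - 2) + b\<^sup>2 - C * (2 * ga + b\<^sup>2) = 0" (is "?E = 0")
    proof -
      have "?E * D = (t ^ 4 - 4 * t\<^sup>2 + 2 - t) * (io * D) + (t\<^sup>2 - 2 - 2 * C) * (ga * D) + (b\<^sup>2 - C * b\<^sup>2) * D"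
        by algebra
      also have "\<dots> = 0"
        unfolding ioD gaD unfolding D_def Cb al_def s_def by algebra
      finally show ?thesis using D by simp
    qed
    have e2: "ep * (t\<^sup>2 - 2 - t) + io * (4 * (t\<^sup>2 - 2) * s + 4 * s) + ga * (2 * s - s * (t\<^sup>2 - 2)) + al * b
        * (t\<^sup>2 - 2) - 2 * b\<^sup>2 * s - 2 * C * al * b = 0" (is "?E = 0")
    proof -
      have "?E * D = (t\<^sup>2 - 2 - t) * (ep * D) + (4 * (t\<^sup>2 - 2) * s + 4 * s) * (io * D) + (2 * s - s * (t\<^sup>2
          - 2)) * (ga * D) + (al * b * (t\<^sup>2 - 2) - 2 * b\<^sup>2 * s - 2 * C * al * b) * D"
        by algebra
      also have "\<dots> = 0"
        unfolding epD ioD gaD unfolding D_def Cb al_def s_def by algebra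
      finally show ?thesis using D by simp
    qed
    have e3: "de * (2 - t) + 2 * s * ep + 2 * io * s\<^sup>2 - 2 * ga * s\<^sup>2 + al\<^sup>2 + 2 * al * b * s
        + b\<^sup>2 * s\<^sup>2 - C * al\<^sup>2 = 0" (is "?E = 0")
    proof -
      have "?E * D = (2 - t) * (de * D) + (2 * s) * (ep * D) + (2 * s\<^sup>2) * (io * D) + (- 2 * s\<^sup>2) * (ga * D)
          + (al\<^sup>2 + 2 * al * b * s + b\<^sup>2 * s\<^sup>2 - C * al\<^sup>2) * D"
        by algebra
      also have "\<dots> = 0"
        unfolding deD epD ioD gaD unfolding D_def Cb al_def s_def by algebra
      finally show ?thesis using D by simp
    qed
    have e4: "et * (t ^ 5 - 5 * t ^ 3 + 5 * t - t) + io * (t ^ 3 - 3 * t) + b * ga * t - 2 * C * (io + b * ga) = 0" (is "?E = 0")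
    proof -
      have "?E * D = (t ^ 5 - 5 * t ^ 3 + 4 * t) * (et * D) + (t ^ 3 - 3 * t - 2 * C) * (io * D) + (b * t - 2 * C * b) * (ga * D) + 0 * D"
        by algebra
      also have "\<dots> = 0"
        unfolding etD ioD gaD unfolding D_def Cb al_def s_def by algebra
      finally show ?thesis using D by simp
    qed
    have e5: "et * (5 * t ^ 3 - 10 * t) * s + xi * (t ^ 3 - 3 * t) - xi * t + ep * t + io * (3 * t * s - s * (t ^ 3 - 3 * t))
        + al * ga * (t ^ 3 - 3 * t) - 2 * b * ga * t * s - 2 * C * (ep + al * ga) = 0" (is "?E = 0")
    proof -
      have "?E * D = ((5 * t ^ 3 - 10 * t) * s) * (et * D) + (t ^ 3 - 4 * t) * (xi * D) + (t - 2 * C) * (ep * D) + (3 * t * s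
          - s * (t ^ 3 - 3 * t)) * (io * D) + (al * (t ^ 3 - 3 * t) - 2 * b * t * s - 2 * C * al) * (ga * D) + 0 * D"
        by algebra
      also have "\<dots> = 0"
        unfolding etD xiD epD ioD gaD unfolding D_def Cb al_def s_def by algebra
      finally show ?thesis using D by simp
    qed
    have e6: "et * (5 * t * s\<^sup>2) + xi * (3 * t * s) + de * t - ep * t * s - io * (3 * t * s\<^sup>2) + al * ga
        * (3 * t * s) + b * ga * t * s\<^sup>2 - 2 * C * de + k2 = 0" (is "?E = 0")
    proof -
      have "?E * D = (5 * t * s\<^sup>2) * (et * D) + (3 * t * s) * (xi * D) + (t - 2 * C) * (de * D) + (- t * s) * (ep * D)
          + (- 3 * t * s\<^sup>2) * (io * D) + (al * (3 * t * s) + b * t * s\<^sup>2) * (ga * D) + 1 * (k2 * D) + 0 * D"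
        by algebra
      also have "\<dots> = 0"
        unfolding etD xiD deD epD ioD gaD k2D unfolding D_def Cb al_def s_def second_twist_def by algebra
      finally show ?thesis using D by simp
    qed
    have "k2 \<noteq> 0"
      using second_twist_nonzero[OF t(1-4) _ t(5) q0[unfolded q1_def]] t1 nz by (simp add: k2_def)
    with True low low3 low3' e1 e2 e3 e4 e5 e6
    have "param_eqs t C k1 k2 al b ga de ep io et xi"
      unfolding param_eqs_def Let_def s_def by blast
    then show ?thesis by blast
  qed
qed

section \<open>Orders of vanishing at the origin\<close>

definition vanishes :: "nat \<Rightarrow> (complex \<Rightarrow> real) \<Rightarrow> bool" where
  "vanishes k g \<longleftrightarrow> (\<exists>M r. 0 < r \<and> (\<forall>w. cmod w < r \<longrightarrow> \<bar>g w\<bar> \<le> M * cmod w ^ k))"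

lemma vanishesI: "0 < r \<Longrightarrow> (\<And>w. cmod w < r \<Longrightarrow> \<bar>g w\<bar> \<le> M * cmod w ^ k) \<Longrightarrow> vanishes k g"
  by (auto simp: vanishes_def)

lemma vanishesE:
  assumes "vanishes k g"
  obtains M r where "0 \<le> M" "0 < r" "r \<le> 1" "\<And>w. cmod w < r \<Longrightarrow> \<bar>g w\<bar> \<le> M * cmod w ^ k"
proof -
  from assms obtain M r where r: "0 < r" and *: "\<And>w. cmod w < r \<Longrightarrow> \<bar>g w\<bar> \<le> M * cmod w ^ k"
    by (auto simp: vanishes_def)
  have "\<bar>g w\<bar> \<le> max M 0 * cmod w ^ k" if "cmod w < min r 1" for w
  proof -
    have "M * cmod w ^ k \<le> max M 0 * cmod w ^ k" by (intro mult_right_mono) auto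
    with *[of w] that show ?thesis by simp
  qed
  with r that[of "max M 0" "min r 1"] show thesis by simp
qed

lemma vanishes_mono:
  assumes "vanishes l g" "k \<le> l" shows "vanishes k g"
proof -
  from assms(1) obtain M r where *: "0 \<le> M" "0 < r" "r \<le> 1" "\<And>w. cmod w < r \<Longrightarrow> \<bar>g w\<bar> \<le> M * cmod w ^ l"
    by (rule vanishesE) blast
  have "\<bar>g w\<bar> \<le> M * cmod w ^ k" if "cmod w < r" for w
  proof -
    have "cmod w ^ l \<le> cmod w ^ k" using that * assms(2) by (intro power_decreasing) auto
    with *(1) have "M * cmod w ^ l \<le> M * cmod w ^ k" by (intro mult_left_mono) auto
    with *(4)[OF that] show ?thesis by simp
  qed
  with *(2) show ?thesis by (rule vanishesI)
qed

lemma vanishes_const: "vanishes 0 (\<lambda>w. c)"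
  by (rule vanishesI[of 1 _ "\<bar>c\<bar>"]) auto

lemma vanishes_mult:
  assumes "vanishes k f" "vanishes l g" shows "vanishes (k + l) (\<lambda>w. f w * g w)"
proof -
  from assms(1) obtain M r where 1: "0 \<le> M" "0 < r" "r \<le> 1" "\<And>w. cmod w < r \<Longrightarrow> \<bar>f w\<bar> \<le> M * cmod w ^ k"
    by (rule vanishesE) blast
  from assms(2) obtain M' r' where 2: "0 \<le> M'" "0 < r'" "r' \<le> 1" "\<And>w. cmod w < r'
      \<Longrightarrow> \<bar>g w\<bar> \<le> M' * cmod w ^ l"
    by (rule vanishesE) blast
  show ?thesis
  proof (rule vanishesI)
    show "0 < min r r'" using 1 2 by simp
    fix w assume "cmod w < min r r'"
    then have "\<bar>f w\<bar> * \<bar>g w\<bar> \<le> (M * cmod w ^ k) * (M' * cmod w ^ l)"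
      using 1 2 by (intro mult_mono) auto
    then show "\<bar>f w * g w\<bar> \<le> (M * M') * cmod w ^ (k + l)" by (simp add: abs_mult power_add mult_ac)
  qed
qed

lemma vanishes_add:
  assumes "vanishes k f" "vanishes l g" shows "vanishes (min k l) (\<lambda>w. f w + g w)"
proof -
  from vanishes_mono[OF assms(1), of "min k l"] obtain M r where
    1: "0 \<le> M" "0 < r" "r \<le> 1" "\<And>w. cmod w < r \<Longrightarrow> \<bar>f w\<bar> \<le> M * cmod w ^ min k l"
    by (rule vanishesE) auto
  from vanishes_mono[OF assms(2), of "min k l"] obtain M' r' where
    2: "0 \<le> M'" "0 < r'" "r' \<le> 1" "\<And>w. cmod w < r' \<Longrightarrow> \<bar>g w\<bar> \<le> M' * cmod w ^ min k l"
    by (rule vanishesE) auto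
  show ?thesis
  proof (rule vanishesI)
    show "0 < min r r'" using 1 2 by simp
    fix w assume "cmod w < min r r'"
    then have "\<bar>f w\<bar> \<le> M * cmod w ^ min k l" "\<bar>g w\<bar> \<le> M' * cmod w ^ min k l"
      using 1(4)[of w] 2(4)[of w] by simp_all
    then show "\<bar>f w + g w\<bar> \<le> (M + M') * cmod w ^ min k l" unfolding distrib_right by linarith
  qed
qed

lemma vanishes_minus: "vanishes k f \<Longrightarrow> vanishes k (\<lambda>w. - f w)"
  by (simp add: vanishes_def)

lemma vanishes_diff:
  assumes "vanishes k f" "vanishes l g" shows "vanishes (min k l) (\<lambda>w. f w - g w)"
  using vanishes_add[OF assms(1) vanishes_minus[OF assms(2)]] by simp

lemma vanishes_power:
  assumes "vanishes k f" shows "vanishes (k * n) (\<lambda>w. f w ^ n)"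
proof (induction n)
  case 0
  show ?case using vanishes_const[of 1] by simp
next
  case (Suc n)
  from vanishes_mult[OF assms Suc] show ?case by (simp add: algebra_simps)
qed

lemma vanishes_linear: "vanishes 1 (\<lambda>w. a * Re w + b * Im w)"
proof (rule vanishesI[of 1 _ "\<bar>a\<bar> + \<bar>b\<bar>"])
  fix w :: complex
  have "\<bar>a * Re w + b * Im w\<bar> \<le> \<bar>a\<bar> * \<bar>Re w\<bar> + \<bar>b\<bar> * \<bar>Im w\<bar>"
    using abs_triangle_ineq[of "a * Re w" "b * Im w"] by (simp add: abs_mult)
  also have "\<dots> \<le> \<bar>a\<bar> * cmod w + \<bar>b\<bar> * cmod w"
    by (intro add_mono mult_left_mono abs_Re_le_cmod abs_Im_le_cmod) auto
  finally show "\<bar>a * Re w + b * Im w\<bar> \<le> (\<bar>a\<bar> + \<bar>b\<bar>) * cmod w ^ 1" by (simp add: algebra_simps)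
qed simp

lemma vanishes_norm_power: "vanishes k (\<lambda>w. cmod w ^ k)"
  by (rule vanishesI[of 1 _ 1]) auto

text \<open>The rules compute the order of a compound from those of its parts. Repeated resolution
  therefore finds some order for a whole expression, which \<open>vanishes_mono\<close> lowers to
  the required one.\<close>

lemmas vanishes_rules = vanishes_mult vanishes_add vanishes_diff vanishes_power vanishes_const

definition hpart :: "real \<Rightarrow> real \<Rightarrow> real \<Rightarrow> real \<Rightarrow> real \<Rightarrow> real \<Rightarrow> real \<Rightarrow> real \<Rightarrow> real \<Rightarrow> real \<Rightarrow> real" where
  "hpart al be ga de ep io et xi x r =
     al * r + be * x\<^sup>2 + ga * x ^ 3 + (de * r\<^sup>2 + ep * r * x\<^sup>2 + io * x ^ 4) + (et * x ^ 5 + xi * x ^ 3 * r)"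

text \<open>\<open>X\<close>, \<open>A\<close>, \<open>A'\<close> stand for
  \<open>a cos \<phi>\<close> and its two rotates by the unperturbed angle; \<open>h2\<close> to
  \<open>h5\<close> are the homogeneous parts of \<open>hpart\<close>. Expressions symmetric in
  \<open>A\<close> and \<open>A'\<close> reduce to the sum and product by Newton's identities, and
  the coefficients that appear are the left sides in \<open>param_eqs\<close>. The remainders with
  \<open>k1\<close> and \<open>k2\<close> are left for the change of angle.\<close>

lemma graded_identities:
  fixes t C X r A A' k1 k2 al be ga de ep io et xi :: real
  assumes eqs: "param_eqs t C k1 k2 al be ga de ep io et xi"
    and e1: "A + A' = t * X" and e2: "A * A' = X\<^sup>2 - (1 - t\<^sup>2 / 4) * r"
  defines "h2 \<equiv> \<lambda>x. al * r + be * x\<^sup>2" and "h3 \<equiv> \<lambda>x. ga * x ^ 3"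
    and "h4 \<equiv> \<lambda>x. de * r\<^sup>2 + ep * r * x\<^sup>2 + io * x ^ 4" and "h5 \<equiv> \<lambda>x. et * x ^ 5 + xi * x ^ 3 * r"
  shows "h2 A + h2 A' + A * A' - t * h2 X - C * X\<^sup>2 = 0"
    and "h3 A + h3 A' + (A * h2 A' + A' * h2 A) - t * h3 X - C * (2 * X * h2 X) = - k1 * r * X"
    and "k1 = 0 \<Longrightarrow> h4 A + h4 A' + (A * h3 A' + A' * h3 A + h2 A * h2 A') - t * h4 X
            - C * (2 * X * h3 X + h2 X * h2 X) = 0"
    and "k1 = 0 \<Longrightarrow> h5 A + h5 A' + (A * h4 A' + A' * h4 A + h2 A * h3 A' + h3 A * h2 A') - t * h5 X
            - C * (2 * X * h4 X + 2 * h2 X * h3 X) = - k2 * r\<^sup>2 * X"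
proof -
  define s where "s = 1 - t\<^sup>2 / 4"
  note eqs = eqs[unfolded param_eqs_def Let_def, folded s_def]
  have e2: "A * A' = X\<^sup>2 - s * r" using e2 by (simp add: s_def)
  have p2: "A\<^sup>2 + A'\<^sup>2 = (t\<^sup>2 - 2) * X\<^sup>2 + 2 * s * r"
    using e1 e2 by algebra
  have p3: "A ^ 3 + A' ^ 3 = (t ^ 3 - 3 * t) * X ^ 3 + 3 * t * s * r * X"
    using e1 e2 by algebra
  have p4: "A ^ 4 + A' ^ 4 = (t ^ 4 - 4 * t\<^sup>2 + 2) * X ^ 4 + (4 * (t\<^sup>2 - 2) * s + 4 * s) * r * X\<^sup>2 + 2 * s\<^sup>2 * r\<^sup>2"
    using e1 e2 by algebra
  have p5: "A ^ 5 + A' ^ 5 = (t ^ 5 - 5 * t ^ 3 + 5 * t) * X ^ 5 + (5 * t ^ 3 - 10 * t) * s * r * X ^ 3 + 5 * t * s\<^sup>2 * r\<^sup>2 * X"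
    using e1 e2 by algebra
  show "h2 A + h2 A' + A * A' - t * h2 X - C * X\<^sup>2 = 0"
  proof -
    have "h2 A + h2 A' + A * A' - t * h2 X - C * X\<^sup>2
      = 2 * al * r + be * (A\<^sup>2 + A'\<^sup>2) + A * A' - t * h2 X - C * X\<^sup>2"
      unfolding h2_def by algebra
    also have "\<dots> = (be * (t\<^sup>2 - 2) + 1 - t * be - C) * X\<^sup>2 + (2 * al + 2 * be * s - s - t * al) * r"
      unfolding p2 e2 h2_def by algebra
    finally show ?thesis using eqs by simp
  qed
  show "h3 A + h3 A' + (A * h2 A' + A' * h2 A) - t * h3 X - C * (2 * X * h2 X) = - k1 * r * X"
  proof -
    have "h3 A + h3 A' + (A * h2 A' + A' * h2 A) - t * h3 X - C * (2 * X * h2 X)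
      = ga * (A ^ 3 + A' ^ 3) + al * r * (A + A') + be * (A * A') * (A + A') - t * h3 X - C * (2 * X * h2 X)"
      unfolding h2_def h3_def by algebra
    also have "\<dots> = (ga * (t ^ 3 - 3 * t) + be * t - t * ga - 2 * C * be) * X ^ 3
        + (3 * ga * t * s + al * t - be * t * s - 2 * C * al + k1) * r * X - k1 * r * X"
      unfolding p3 e1 e2 h2_def h3_def by algebra
    finally show ?thesis using eqs by simp
  qed
  assume k1: "k1 = 0"
  show "h4 A + h4 A' + (A * h3 A' + A' * h3 A + h2 A * h2 A') - t * h4 X
            - C * (2 * X * h3 X + h2 X * h2 X) = 0"
  proof -
    have "h4 A + h4 A' + (A * h3 A' + A' * h3 A + h2 A * h2 A') - t * h4 X - C * (2 * X * h3 X + h2 X * h2 X)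
      = 2 * de * r\<^sup>2 + ep * r * (A\<^sup>2 + A'\<^sup>2) + io * (A ^ 4 + A' ^ 4) + ga * (A * A') * (A\<^sup>2 + A'\<^sup>2)
        + al\<^sup>2 * r\<^sup>2 + al * be * r * (A\<^sup>2 + A'\<^sup>2) + be\<^sup>2 * (A * A')\<^sup>2 - t * h4 X
        - C * (2 * X * h3 X + h2 X * h2 X)"
      unfolding h2_def h3_def h4_def by algebra
    also have "\<dots> = (io * (t ^ 4 - 4 * t\<^sup>2 + 2 - t) + ga * (t\<^sup>2 - 2) + be\<^sup>2 - C * (2 * ga + be\<^sup>2)) * X ^ 4
       + (ep * (t\<^sup>2 - 2 - t) + io * (4 * (t\<^sup>2 - 2) * s + 4 * s) + ga * (2 * s - s * (t\<^sup>2 - 2))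
        + al * be * (t\<^sup>2 - 2) - 2 * be\<^sup>2 * s - 2 * C * al * be) * r * X\<^sup>2
       + (de * (2 - t) + 2 * s * ep + 2 * io * s\<^sup>2 - 2 * ga * s\<^sup>2 + al\<^sup>2 + 2 * al * be * s + be\<^sup>2 * s\<^sup>2
        - C * al\<^sup>2) * r\<^sup>2"
      unfolding p2 p4 e2 h2_def h3_def h4_def by algebra
    also have "\<dots> = 0" using eqs k1 by (elim conjE disjE) (simp_all only: mult_zero_left add_0_left add_0_right)
    finally show ?thesis .
  qed
  show "h5 A + h5 A' + (A * h4 A' + A' * h4 A + h2 A * h3 A' + h3 A * h2 A') - t * h5 X
            - C * (2 * X * h4 X + 2 * h2 X * h3 X) = - k2 * r\<^sup>2 * X"
  proof -
    have "h5 A + h5 A' + (A * h4 A' + A' * h4 A + h2 A * h3 A' + h3 A * h2 A') - t * h5 X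
            - C * (2 * X * h4 X + 2 * h2 X * h3 X)
      = et * (A ^ 5 + A' ^ 5) + xi * r * (A ^ 3 + A' ^ 3) + de * r\<^sup>2 * (A + A') + ep * r * (A * A') * (A + A')
        + io * (A * A') * (A ^ 3 + A' ^ 3) + al * ga * r * (A ^ 3 + A' ^ 3) + be * ga * (A * A')\<^sup>2 * (A + A')
        - t * h5 X - C * (2 * X * h4 X + 2 * h2 X * h3 X)"
      unfolding h2_def h3_def h4_def h5_def by algebra
    also have "\<dots> = (et * (t ^ 5 - 5 * t ^ 3 + 5 * t - t) + io * (t ^ 3 - 3 * t) + be * ga * t - 2 * C * (io + be * ga)) * X ^ 5
      + (et * (5 * t ^ 3 - 10 * t) * s + xi * (t ^ 3 - 3 * t) - xi * t + ep * t
        + io * (3 * t * s - s * (t ^ 3 - 3 * t)) + al * ga * (t ^ 3 - 3 * t) - 2 * be * ga * t * s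
        - 2 * C * (ep + al * ga)) * r * X ^ 3
      + (et * (5 * t * s\<^sup>2) + xi * (3 * t * s) + de * t - ep * t * s - io * (3 * t * s\<^sup>2) + al * ga * (3 * t * s)
        + be * ga * t * s\<^sup>2 - 2 * C * de + k2) * r\<^sup>2 * X - k2 * r\<^sup>2 * X"
      unfolding p3 p5 e1 e2 h2_def h3_def h4_def h5_def by algebra
    also have "\<dots> = - k2 * r\<^sup>2 * X"
      using eqs k1 by (elim conjE disjE) (simp_all only: mult_zero_left add_0_left add_0_right diff_0 mult_minus_left)
    finally show ?thesis .
  qed
qed


lemma cos_sin_perturb:
  fixes y :: real
  shows "\<bar>cos (a + y) - cos a\<bar> \<le> \<bar>y\<bar>" "\<bar>sin (a + y) - sin a\<bar> \<le> \<bar>y\<bar>"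
    "\<bar>cos (a + y) - cos a + y * sin a\<bar> \<le> y\<^sup>2"
proof -
  have s2: "\<bar>sin (y / 2)\<bar> \<le> \<bar>y\<bar> / 2" using abs_sin_x_le_abs_x[of "y / 2"] by simp
  have "cos (a + y) - cos a = 2 * sin (a + y / 2) * sin (- y / 2)"
    using cos_diff_cos[of "a + y" a] by (simp add: add_divide_distrib)
  then have "\<bar>cos (a + y) - cos a\<bar> = 2 * \<bar>sin (a + y / 2)\<bar> * \<bar>sin (y / 2)\<bar>"
    by (simp add: abs_mult)
  also have "\<dots> \<le> 2 * 1 * (\<bar>y\<bar> / 2)" using s2 by (intro mult_mono) auto
  finally show "\<bar>cos (a + y) - cos a\<bar> \<le> \<bar>y\<bar>" by simp
  have "sin (a + y) - sin a = 2 * sin (y / 2) * cos (a + y / 2)"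
    using sin_diff_sin[of "a + y" a] by (simp add: add_divide_distrib)
  then have "\<bar>sin (a + y) - sin a\<bar> = 2 * \<bar>cos (a + y / 2)\<bar> * \<bar>sin (y / 2)\<bar>"
    by (simp add: abs_mult)
  also have "\<dots> \<le> 2 * 1 * (\<bar>y\<bar> / 2)" using s2 by (intro mult_mono) auto
  finally show "\<bar>sin (a + y) - sin a\<bar> \<le> \<bar>y\<bar>" by simp
  have "\<bar>sin y - y\<bar> \<le> y\<^sup>2 / 2"
    using Maclaurin_sin_bound[of y 2] by (simp add: numeral_2_eq_2 sin_coeff_def)
  moreover have "\<bar>cos y - 1\<bar> \<le> y\<^sup>2 / 2"
  proof -
    have "cos y - 1 = - 2 * (sin (y / 2))\<^sup>2" using cos_double_sin[of "y / 2"] by simp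
    moreover have "(sin (y / 2))\<^sup>2 \<le> (y / 2)\<^sup>2" using s2 abs_le_square_iff[of "sin (y / 2)" "y / 2"] by simp
    ultimately show ?thesis by (simp add: power_divide)
  qed
  ultimately have b: "\<bar>cos a\<bar> * \<bar>cos y - 1\<bar> \<le> 1 * (y\<^sup>2 / 2)" "\<bar>sin a\<bar> * \<bar>sin y
      - y\<bar> \<le> 1 * (y\<^sup>2 / 2)"
    by (intro mult_mono; simp)+
  have "cos (a + y) - cos a + y * sin a = cos a * (cos y - 1) - sin a * (sin y - y)"
    by (simp add: cos_add algebra_simps)
  then have "\<bar>cos (a + y) - cos a + y * sin a\<bar> \<le> \<bar>cos a * (cos y - 1)\<bar> + \<bar>sin a * (sin y - y)\<bar>"
    by (simp only: abs_triangle_ineq4)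
  also have "\<dots> \<le> y\<^sup>2" using b unfolding abs_mult by linarith
  finally show "\<bar>cos (a + y) - cos a + y * sin a\<bar> \<le> y\<^sup>2" .
qed

lemma vanishes_cong: "vanishes k f \<Longrightarrow> (\<And>w. f w = g w) \<Longrightarrow> vanishes k g"
  by (metis ext)

lemma vanishes_perturb:
  assumes "vanishes k y" and "\<And>w. \<bar>g w\<bar> \<le> \<bar>y w\<bar>"
  shows "vanishes k g"
  using assms unfolding vanishes_def by (meson order_trans)

text \<open>The recurrence in the relative coordinate \<open>u = x / x0 - 1\<close>: at a fixed
  point \<open>x0\<close> it reads \<open>u' + u'' + u' * u'' = t * u + C * u^2\<close>.\<close>

definition curve_defect :: "real \<Rightarrow> real \<Rightarrow> (complex \<Rightarrow> real) \<Rightarrow> complex \<Rightarrow> complex \<Rightarrow> complex \<Rightarrow> real" where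
  "curve_defect t C K w' w'' w = K w' + K w'' + K w' * K w'' - t * K w - C * (K w)\<^sup>2"

text \<open>At the constant angle \<open>\<theta>\<close> the defect is \<open>- k * r^m * X\<close>
  up to order \<open>2 * m + 2\<close>. Turning by \<open>\<omega> * r^m\<close> more adds
  \<open>k * r^m * X\<close> through the linear terms, and affects the nonlinear ones only at order
  \<open>2 * m + 2\<close>.\<close>

lemma approx_invariance:
  fixes \<theta> C t :: real
  assumes eqs: "param_eqs t C k1 k2 al be ga de ep io et xi" and t: "t = 2 * cos \<theta>" "sin \<theta> \<noteq> 0"
  defines "K \<equiv> \<lambda>w. Re w + hpart al be ga de ep io et xi (Re w) ((cmod w)\<^sup>2)"
  shows "\<exists>m \<omega>. 1 \<le> m \<and> \<omega> \<noteq> 0 \<and> vanishes (2 * m + 2) (\<lambda>w.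
    curve_defect t C K (cis (\<theta> + \<omega> * cmod w ^ (2 * m)) * w) (cis (- (\<theta> + \<omega> * cmod w ^ (2 * m))) * w) w)"
proof -
  define m :: nat where "m = (if k1 = 0 then 2 else 1)"
  define k where "k = (if k1 = 0 then k2 else k1)"
  have m: "1 \<le> m" by (simp add: m_def)
  have k0: "k \<noteq> 0" using eqs by (auto simp: k_def param_eqs_def Let_def)
  \<comment> \<open>From \<open>2 cos (\<theta> + y) = 2 cos \<theta> - 2 y sin \<theta> +
    O(y^2)\<close>: with \<open>y = \<omega> * r^m\<close> the doubled cosine grows by
    \<open>k * r^m\<close>.\<close>
  define \<omega> where "\<omega> = - k / (2 * sin \<theta>)"
  have \<omega>: "\<omega> \<noteq> 0" using k0 t(2) by (simp add: \<omega>_def)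
  define y where "y w = \<omega> * cmod w ^ (2 * m)" for w
  define r where "r w = (cmod w)\<^sup>2" for w
  define P where "P w = Re (cis (\<theta> + y w) * w)" for w
  define P' where "P' w = Re (cis (- (\<theta> + y w)) * w)" for w
  define A where "A w = Re (cis \<theta> * w)" for w
  define A' where "A' w = Re (cis (- \<theta>) * w)" for w
  define h2 where "h2 x w = al * r w + be * (x w)\<^sup>2" for x and w :: complex
  define h3 where "h3 x w = ga * (x w) ^ 3" for x and w :: complex
  define h4 where "h4 x w = de * (r w)\<^sup>2 + ep * r w * (x w)\<^sup>2 + io * (x w) ^ 4" for x and w :: complex
  define h5 where "h5 x w = et * (x w) ^ 5 + xi * (x w) ^ 3 * r w" for x and w :: complex
  define h where "h x w = h2 x w + h3 x w + h4 x w + h5 x w" for x and w :: complex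
  have y: "vanishes (2 * m) y"
    unfolding y_def using vanishes_mult[OF vanishes_const vanishes_norm_power] by simp
  have r: "vanishes 2 r" unfolding r_def by (rule vanishes_norm_power)
  have X: "vanishes 1 Re" and Y: "vanishes 1 Im"
    using vanishes_linear[of 1 0] vanishes_linear[of 0 1] by simp_all
  have A: "vanishes 1 A" "vanishes 1 A'"
    unfolding A_def A'_def using vanishes_linear[of "cos \<theta>" "- sin \<theta>"] vanishes_linear[of "cos \<theta>" "sin \<theta>"]
    by simp_all
  have dc: "vanishes (2 * m) (\<lambda>w. cos (\<theta> + y w) - cos \<theta>)" "vanishes (2 * m) (\<lambda>w. sin (\<theta> + y w) - sin \<theta>)"
    by (rule vanishes_perturb[OF y]; rule cos_sin_perturb)+
  have PA: "vanishes (2 * m + 1) (\<lambda>w. P w - A w)" "vanishes (2 * m + 1) (\<lambda>w. P' w - A' w)"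
  proof -
    have "vanishes (2 * m + 1) (\<lambda>w. (cos (\<theta> + y w) - cos \<theta>) * Re w - (sin (\<theta> + y w) - sin \<theta>) * Im w)"
      using vanishes_diff[OF vanishes_mult[OF dc(1) X] vanishes_mult[OF dc(2) Y]] by simp
    then show "vanishes (2 * m + 1) (\<lambda>w. P w - A w)"
      by (rule vanishes_cong) (simp add: P_def A_def algebra_simps)
    have "vanishes (2 * m + 1) (\<lambda>w. (cos (\<theta> + y w) - cos \<theta>) * Re w + (sin (\<theta> + y w) - sin \<theta>) * Im w)"
      using vanishes_add[OF vanishes_mult[OF dc(1) X] vanishes_mult[OF dc(2) Y]] by simp
    then show "vanishes (2 * m + 1) (\<lambda>w. P' w - A' w)"
      by (rule vanishes_cong)
        (simp only: P'_def A'_def complex_mult cis.sel times_complex.sel cos_minus sin_minus, simp add: algebra_simps)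
  qed
  have P: "vanishes 1 P" "vanishes 1 P'"
    using vanishes_mono[OF vanishes_add[OF PA(1) A(1)], of 1] vanishes_mono[OF vanishes_add[OF PA(2) A(2)], of 1]
    by simp_all
  have h2: "vanishes 2 (h2 x)" and h3: "vanishes 3 (h3 x)" and h4: "vanishes 4 (h4 x)" and h5: "vanishes 5 (h5 x)"
    if x: "vanishes 1 x" for x
  proof -
    show "vanishes 2 (h2 x)" unfolding h2_def
      by (rule vanishes_mono, (rule vanishes_rules x r)+) simp
    show "vanishes 3 (h3 x)" unfolding h3_def
      by (rule vanishes_mono, (rule vanishes_rules x r)+) simp
    show "vanishes 4 (h4 x)" unfolding h4_def
      by (rule vanishes_mono, (rule vanishes_rules x r)+) simp
    show "vanishes 5 (h5 x)" unfolding h5_def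
      by (rule vanishes_mono, (rule vanishes_rules x r)+) simp
  qed
  have hx: "vanishes 2 (h x)" if x: "vanishes 1 x" for x
    unfolding h_def by (rule vanishes_mono, (rule vanishes_rules h2[OF x] h3[OF x] h4[OF x] h5[OF x])+) simp
  \<comment> \<open>\<open>h\<close> has no linear term, so the cofactor of \<open>x - x'\<close> in
    the difference vanishes at least to order one.\<close>
  have hdiff: "vanishes (2 * m + 2) (\<lambda>w. h x w - h x' w)"
    if x: "vanishes 1 x" "vanishes 1 x'" and d: "vanishes (2 * m + 1) (\<lambda>w. x w - x' w)" for x x'
  proof -
    have "vanishes (2 * m + 2) (\<lambda>w. (x w - x' w) * (be * (x w + x' w) + ga * ((x w)\<^sup>2 + x w * x' w + (x' w)\<^sup>2)
        + ep * r w * (x w + x' w) + io * (x w + x' w) * ((x w)\<^sup>2 + (x' w)\<^sup>2)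
        + et * ((x w) ^ 4 + (x w) ^ 3 * x' w + (x w)\<^sup>2 * (x' w)\<^sup>2 + x w * (x' w) ^ 3 + (x' w) ^ 4)
        + xi * ((x w)\<^sup>2 + x w * x' w + (x' w)\<^sup>2) * r w))"
      by (rule vanishes_mono, rule vanishes_mult[OF d], (rule vanishes_rules x r)+) simp
    then show ?thesis
      by (rule vanishes_cong) (simp only: h_def h2_def h3_def h4_def h5_def, algebra)
  qed
  \<comment> \<open>The part of degree at least six in the product of \<open>x + h x\<close> and
    \<open>x' + h x'\<close>.\<close>
  define T where "T x x' w = x w * h5 x' w + x' w * h5 x w + h2 x w * (h4 x' w + h5 x' w)
      + h3 x w * (h3 x' w + h4 x' w + h5 x' w) + h4 x w * (h2 x' w + h3 x' w + h4 x' w + h5 x' w)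
      + h5 x w * (h2 x' w + h3 x' w + h4 x' w + h5 x' w)" for x x' and w :: complex
  have T: "vanishes 6 (T x x')" if x: "vanishes 1 x" "vanishes 1 x'" for x x'
    unfolding T_def
    by (rule vanishes_mono, (rule vanishes_rules x h2[OF x(1)] h3[OF x(1)] h4[OF x(1)] h5[OF x(1)]
        h2[OF x(2)] h3[OF x(2)] h4[OF x(2)] h5[OF x(2)])+) simp
  define EA where "EA w = (A w + h A w) + (A' w + h A' w) + (A w + h A w) * (A' w + h A' w)
      - t * (Re w + h Re w) - C * (Re w + h Re w)\<^sup>2" for w
  have e1: "A w + A' w = t * Re w" for w by (simp add: A_def A'_def t(1))
  have e2: "A w * A' w = (Re w)\<^sup>2 - (1 - t\<^sup>2 / 4) * r w" for w
  proof -
    have "A w * A' w = (cos \<theta>)\<^sup>2 * (Re w)\<^sup>2 - (sin \<theta>)\<^sup>2 * (Im w)\<^sup>2"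
      by (simp add: A_def A'_def power2_eq_square algebra_simps)
    also have "\<dots> = (Re w)\<^sup>2 - (1 - t\<^sup>2 / 4) * r w"
      unfolding t(1) r_def cmod_power2 sin_squared_eq by algebra
    finally show ?thesis .
  qed
  note gr = graded_identities[OF eqs e1 e2, folded h2_def h3_def h4_def h5_def]
  define G2 where "G2 w = h2 A w + h2 A' w + A w * A' w - t * h2 Re w - C * (Re w)\<^sup>2" for w
  define G3 where "G3 w = h3 A w + h3 A' w + (A w * h2 A' w + A' w * h2 A w) - t * h3 Re w
      - C * (2 * Re w * h2 Re w)" for w
  define G4 where "G4 w = h4 A w + h4 A' w + (A w * h3 A' w + A' w * h3 A w + h2 A w * h2 A' w) - t * h4 Re w
      - C * (2 * Re w * h3 Re w + h2 Re w * h2 Re w)" for w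
  define G5 where "G5 w = h5 A w + h5 A' w + (A w * h4 A' w + A' w * h4 A w + h2 A w * h3 A' w + h3 A w * h2 A' w)
      - t * h5 Re w - C * (2 * Re w * h4 Re w + 2 * h2 Re w * h3 Re w)" for w
  have EA_split: "EA w = (A w + A' w - t * Re w) + G2 w + G3 w + G4 w + G5 w + T A A' w - C * T Re Re w" for w
    unfolding EA_def h_def T_def G2_def G3_def G4_def G5_def by algebra
  have G2: "G2 w = 0" and G3: "G3 w = - k1 * r w * Re w" for w
    using gr(1,2)[of w] by (simp_all only: G2_def G3_def)
  have EA: "vanishes (2 * m + 2) (\<lambda>w. EA w + k * r w ^ m * Re w)"
  proof (cases "k1 = 0")
    case True
    then have m2: "m = 2" "k = k2" by (simp_all add: m_def k_def)
    have "EA w + k * r w ^ m * Re w = T A A' w - C * T Re Re w" for w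
    proof -
      have "G4 w = 0" "G5 w = - k2 * (r w)\<^sup>2 * Re w"
        using gr(3,4)[of w, OF True] by (simp_all only: G4_def G5_def)
      then show ?thesis unfolding EA_split G2 G3 e1 m2 True by simp
    qed
    moreover have "vanishes 6 (\<lambda>w. T A A' w - C * T Re Re w)"
      by (rule vanishes_mono, (rule vanishes_rules T A X)+) simp
    ultimately show ?thesis by (simp add: m2)
  next
    case False
    then have m1: "m = 1" "k = k1" by (simp_all add: m_def k_def)
    have z: "de = 0" "ep = 0" "io = 0" "et = 0" "xi = 0"
      using eqs False by (auto simp: param_eqs_def Let_def)
    have "EA w + k * r w ^ m * Re w = (A w * h3 A' w + A' w * h3 A w + h2 A w * h2 A' w)
        - C * (2 * Re w * h3 Re w + h2 Re w * h2 Re w) + (h2 A w * h3 A' w + h3 A w * h2 A' w)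
        - C * (2 * h2 Re w * h3 Re w) + T A A' w - C * T Re Re w" for w
    proof -
      have z': "h4 x w = 0" "h5 x w = 0" for x by (simp_all add: h4_def h5_def z)
      show ?thesis unfolding EA_split G2 G3 e1 m1 G4_def G5_def z' by simp
    qed
    moreover have "vanishes 4 (\<lambda>w. (A w * h3 A' w + A' w * h3 A w + h2 A w * h2 A' w)
        - C * (2 * Re w * h3 Re w + h2 Re w * h2 Re w) + (h2 A w * h3 A' w + h3 A w * h2 A' w)
        - C * (2 * h2 Re w * h3 Re w) + T A A' w - C * T Re Re w)"
      by (rule vanishes_mono, (rule vanishes_rules T A X h2[OF A(1)] h2[OF A(2)] h2[OF X]
          h3[OF A(1)] h3[OF A(2)] h3[OF X])+) simp
    ultimately show ?thesis by (simp add: m1)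
  qed
  have S: "vanishes (2 * m + 2) (\<lambda>w. P w + P' w - t * Re w - k * r w ^ m * Re w)"
  proof -
    have "vanishes (4 * m) (\<lambda>w. cos (\<theta> + y w) - cos \<theta> + y w * sin \<theta>)"
    proof (rule vanishes_perturb)
      show "vanishes (4 * m) (\<lambda>w. (y w)\<^sup>2)" using vanishes_power[OF y, of 2] by simp
      show "\<bar>cos (\<theta> + y w) - cos \<theta> + y w * sin \<theta>\<bar> \<le> \<bar>(y w)\<^sup>2\<bar>" for w
        using cos_sin_perturb(3)[of \<theta> "y w"] by simp
    qed
    from vanishes_mult[OF vanishes_const[of 2] vanishes_mult[OF this X]]
    have "vanishes (2 * m + 2) (\<lambda>w. 2 * ((cos (\<theta> + y w) - cos \<theta> + y w * sin \<theta>) * Re w))"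
      by (rule vanishes_mono) (use m in simp)
    then show ?thesis
    proof (rule vanishes_cong)
      fix w
      have 1: "2 * (y w * sin \<theta>) = - k * r w ^ m"
        using t(2) by (simp add: y_def \<omega>_def r_def power_mult)
      have 2: "P w + P' w = 2 * cos (\<theta> + y w) * Re w"
        unfolding P_def P'_def by (simp add: cos_minus[of "\<theta> + y w"] sin_minus[of "\<theta> + y w"] del: minus_add_distrib)
      have "2 * ((cos (\<theta> + y w) - cos \<theta> + y w * sin \<theta>) * Re w)
          = 2 * cos (\<theta> + y w) * Re w - 2 * cos \<theta> * Re w + 2 * (y w * sin \<theta>) * Re w"
        by (simp add: algebra_simps)
      then show "2 * ((cos (\<theta> + y w) - cos \<theta> + y w * sin \<theta>) * Re w)
          = P w + P' w - t * Re w - k * r w ^ m * Re w"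
        unfolding 1 2 t(1) by simp
    qed
  qed
  define E where "E w = (P w + h P w) + (P' w + h P' w) + (P w + h P w) * (P' w + h P' w)
      - t * (Re w + h Re w) - C * (Re w + h Re w)\<^sup>2" for w
  \<comment> \<open>The defect at the true angle is written as the one at \<open>\<theta>\<close>
    plus changes in one factor at a time; the two terms \<open>k * r^m * X\<close> cancel.\<close>
  have "vanishes (2 * m + 2) (\<lambda>w. (P w + P' w - t * Re w - k * r w ^ m * Re w) + (h P w - h A w) + (h P' w - h A' w)
      + (((P w - A w) + (h P w - h A w)) * (P' w + h P' w) + (A w + h A w) * ((P' w - A' w) + (h P' w - h A' w)))
      + (EA w + k * r w ^ m * Re w))"
    by (rule vanishes_mono, (rule S EA hdiff[OF P(1) A(1) PA(1)] hdiff[OF P(2) A(2) PA(2)]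
      PA vanishes_rules P A hx)+) simp
  then have E: "vanishes (2 * m + 2) E"
  proof (rule vanishes_cong)
    fix w
    show "(P w + P' w - t * Re w - k * r w ^ m * Re w) + (h P w - h A w) + (h P' w - h A' w)
      + (((P w - A w) + (h P w - h A w)) * (P' w + h P' w) + (A w + h A w) * ((P' w - A' w) + (h P' w - h A' w)))
      + (EA w + k * r w ^ m * Re w) = E w"
    proof -
      have A': "A' w = t * Re w - A w" using e1[of w] by simp
      obtain Z where Z: "Z = k * r w ^ m * Re w" by simp
      show ?thesis unfolding EA_def E_def A' Z[symmetric] by algebra
    qed
  qed
  have Keq: "K (cis (\<theta> + y w) * w) = P w + h P w" "K (cis (- (\<theta> + y w)) * w) = P' w + h P' w" "K w = Re w + h Re w" for w
    by (simp_all only: K_def P_def P'_def h_def h2_def h3_def h4_def h5_def hpart_def r_def norm_mult norm_cis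
        mult_1_left add.assoc)
  from E have "vanishes (2 * m + 2) (\<lambda>w.
    curve_defect t C K (cis (\<theta> + y w) * w) (cis (- (\<theta> + y w)) * w) w)"
    by (rule vanishes_cong) (simp only: curve_defect_def E_def Keq(1,2), simp only: Keq(3))
  then show ?thesis using m \<omega> unfolding y_def by blast
qed

section \<open>Conjugation to a perturbed rotation\<close>

text \<open>The quadratic form preserved by \<open>(d1, d2) -> (d2, t * d2 - d1)\<close>, which is
  the differential of the map at a fixed point.\<close>

definition elliptic_form :: "real \<Rightarrow> real^2 \<Rightarrow> real" where
  "elliptic_form t d = (d$1)\<^sup>2 - t * d$1 * d$2 + (d$2)\<^sup>2"

text \<open>The coordinates \<open>(Re w, Re (cis \<theta> * w))\<close> turn rotation by
  \<open>\<theta>\<close> into that differential and the squared modulus, up to a factor, into its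
  invariant form.\<close>

lemma rotation_quadratic_form:
  "(Re w)\<^sup>2 - 2 * cos \<theta> * Re w * Re (cis \<theta> * w) + (Re (cis \<theta> * w))\<^sup>2 = (sin \<theta>)\<^sup>2 * (cmod w)\<^sup>2"
proof -
  have "(Re w)\<^sup>2 - 2 * cos \<theta> * Re w * Re (cis \<theta> * w) + (Re (cis \<theta> * w))\<^sup>2
      = (1 - (cos \<theta>)\<^sup>2) * (Re w)\<^sup>2 + (sin \<theta>)\<^sup>2 * (Im w)\<^sup>2"
    by (simp add: power2_eq_square algebra_simps)
  also have "1 - (cos \<theta>)\<^sup>2 = (sin \<theta>)\<^sup>2" by (simp add: sin_squared_eq)
  finally show ?thesis by (simp add: cmod_power2 algebra_simps)
qed

lemma elliptic_trace_bound:
  fixes \<theta> :: real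
  assumes "sin \<theta> \<noteq> 0" shows "-2 < 2 * cos \<theta>" "2 * cos \<theta> < 2"
proof -
  have "0 < (sin \<theta>)\<^sup>2" using assms by simp
  then have "(cos \<theta>)\<^sup>2 < 1" using sin_cos_squared_add[of \<theta>] by linarith
  then show "-2 < 2 * cos \<theta>" "2 * cos \<theta> < 2" by (auto simp: abs_square_less_1)
qed

lemma norm_vec2_le: "norm (z :: real^2) \<le> \<bar>z$1\<bar> + \<bar>z$2\<bar>"
  using norm_le_l1_cart[of z] by (simp add: sum_2)

lemma vec2_eq_iff: "(z :: 'a^2) = w \<longleftrightarrow> z$1 = w$1 \<and> z$2 = w$2"
  by (simp add: vec_eq_iff forall_2)

lemma F_map_nth [simp]: "F_map A B C z $ 1 = z$2" "F_map A B C z $ 2 = (A + B * z$2 + C * (z$2)\<^sup>2) / z$1"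
  by (simp_all add: F_map_def)

section \<open>Lipschitz calculus near the origin\<close>

definition lip0 :: "(complex \<Rightarrow> 'a::real_normed_vector) \<Rightarrow> bool" where
  "lip0 f \<longleftrightarrow> f 0 = 0 \<and> (\<exists>L r. 0 < r \<and>
     (\<forall>w w'. cmod w < r \<longrightarrow> cmod w' < r \<longrightarrow> norm (f w - f w') \<le> L * cmod (w - w')))"

text \<open>On the disc of radius \<open>r\<close> the Lipschitz constant is \<open>o(r^n)\<close>;
  for \<open>n = 0\<close> this is strict differentiability at 0 with derivative zero. Pairs of
  points are compared because injectivity of the parametrisation and growth of the integral along
  rays cannot be read off from the size of single values.\<close>

definition flat :: "nat \<Rightarrow> (complex \<Rightarrow> 'a::real_normed_vector) \<Rightarrow> bool" where
  "flat n f \<longleftrightarrow> (\<forall>\<epsilon>>0. \<exists>r>0. \<forall>w w'. cmod w < r \<longrightarrow> cmod w' < r \<longrightarrow>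
     norm (f w - f w') \<le> \<epsilon> * max (cmod w) (cmod w') ^ n * cmod (w - w'))"

lemma lip0E:
  assumes "lip0 f"
  obtains L r where "0 < L" "0 < r" "f 0 = 0"
    "\<And>w w'. cmod w < r \<Longrightarrow> cmod w' < r \<Longrightarrow> norm (f w - f w') \<le> L * cmod (w - w')"
    "\<And>w. cmod w < r \<Longrightarrow> norm (f w) \<le> L * cmod w"
proof -
  from assms obtain L r where *: "0 < r" "f 0 = 0"
    "\<And>w w'. cmod w < r \<Longrightarrow> cmod w' < r \<Longrightarrow> norm (f w - f w') \<le> L * cmod (w - w')"
    by (auto simp: lip0_def)
  have lip: "norm (f w - f w') \<le> max L 1 * cmod (w - w')" if "cmod w < r" "cmod w' < r" for w w'
  proof -
    have "L * cmod (w - w') \<le> max L 1 * cmod (w - w')" by (intro mult_right_mono) auto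
    with *(3)[OF that] show ?thesis by simp
  qed
  moreover have "norm (f w) \<le> max L 1 * cmod w" if "cmod w < r" for w
    using lip[of w 0] that * by simp
  ultimately show thesis using that[of "max L 1" r] *(1,2) by simp
qed

lemma flatE:
  assumes "flat n f" "0 < \<epsilon>"
  obtains r where "0 < r" "\<And>w w'. cmod w < r \<Longrightarrow> cmod w' < r \<Longrightarrow>
     norm (f w - f w') \<le> \<epsilon> * max (cmod w) (cmod w') ^ n * cmod (w - w')"
  using assms by (auto simp: flat_def)

lemma flat_lip0:
  assumes "flat 0 f" "f 0 = 0" shows "lip0 f"
proof -
  from flatE[OF assms(1), of 1] obtain r where "0 < r"
    "\<And>w w'. cmod w < r \<Longrightarrow> cmod w' < r \<Longrightarrow> norm (f w - f w') \<le> 1 * cmod (w - w')" by auto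
  with assms(2) show ?thesis unfolding lip0_def by blast
qed

lemma flat_add:
  assumes "flat n f" "flat n g" shows "flat n (\<lambda>w. f w + g w)"
  unfolding flat_def
proof (intro allI impI)
  fix \<epsilon> :: real assume e: "0 < \<epsilon>"
  from flatE[OF assms(1), of "\<epsilon> / 2"] e obtain r where r: "0 < r" "\<And>w w'. cmod w < r \<Longrightarrow> cmod w' < r \<Longrightarrow>
     norm (f w - f w') \<le> \<epsilon> / 2 * max (cmod w) (cmod w') ^ n * cmod (w - w')" by auto
  from flatE[OF assms(2), of "\<epsilon> / 2"] e obtain r' where r': "0 < r'" "\<And>w w'. cmod w < r'
      \<Longrightarrow> cmod w' < r' \<Longrightarrow>
     norm (g w - g w') \<le> \<epsilon> / 2 * max (cmod w) (cmod w') ^ n * cmod (w - w')" by auto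
  have "norm ((f w + g w) - (f w' + g w')) \<le> \<epsilon> * max (cmod w) (cmod w') ^ n * cmod (w - w')"
    if "cmod w < min r r'" "cmod w' < min r r'" for w w'
  proof -
    have "norm ((f w + g w) - (f w' + g w')) \<le> norm (f w - f w') + norm (g w - g w')"
      by (metis add_diff_add norm_triangle_ineq)
    with r(2)[of w w'] r'(2)[of w w'] that show ?thesis by simp
  qed
  with r(1) r'(1) show "\<exists>r>0. \<forall>w w'. cmod w < r \<longrightarrow> cmod w' < r \<longrightarrow>
     norm ((f w + g w) - (f w' + g w')) \<le> \<epsilon> * max (cmod w) (cmod w') ^ n * cmod (w - w')"
    by (intro exI[of _ "min r r'"]) auto
qed

lemma flat_dominated:
  assumes "flat n f" "0 \<le> c" "\<And>w w'. norm (g w - g w') \<le> c * norm (f w - f w')"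
  shows "flat n g"
  unfolding flat_def
proof (intro allI impI)
  fix \<epsilon> :: real assume e: "0 < \<epsilon>"
  from flatE[OF assms(1), of "\<epsilon> / (c + 1)"] e assms(2) obtain r where r: "0 < r"
    "\<And>w w'. cmod w < r \<Longrightarrow> cmod w' < r \<Longrightarrow>
     norm (f w - f w') \<le> \<epsilon> / (c + 1) * max (cmod w) (cmod w') ^ n * cmod (w - w')"
    by auto
  have "norm (g w - g w') \<le> \<epsilon> * max (cmod w) (cmod w') ^ n * cmod (w - w')"
    if "cmod w < r" "cmod w' < r" for w w'
  proof -
    have "norm (g w - g w') \<le> c * (\<epsilon> / (c + 1) * max (cmod w) (cmod w') ^ n * cmod (w - w'))"
      using assms(3)[of w w'] mult_left_mono[OF r(2)[OF that] assms(2)] by linarith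
    also have "\<dots> = c / (c + 1) * (\<epsilon> * max (cmod w) (cmod w') ^ n * cmod (w - w'))" by simp
    also have "\<dots> \<le> 1 * (\<epsilon> * max (cmod w) (cmod w') ^ n * cmod (w - w'))"
      using e assms(2) by (intro mult_right_mono) (auto simp: le_max_iff_disj)
    finally show ?thesis by simp
  qed
  with r(1) show "\<exists>r>0. \<forall>w w'. cmod w < r \<longrightarrow> cmod w' < r \<longrightarrow>
     norm (g w - g w') \<le> \<epsilon> * max (cmod w) (cmod w') ^ n * cmod (w - w')" by blast
qed

lemma flat_cmult:
  fixes c :: real
  assumes "flat n f" shows "flat n (\<lambda>w. c * f w)"
  by (rule flat_dominated[OF assms, of "\<bar>c\<bar>"]) (simp_all add: abs_mult flip: right_diff_distrib)

lemma flat_diff: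
  fixes f g :: "complex \<Rightarrow> real"
  assumes "flat n f" "flat n g" shows "flat n (\<lambda>w. f w - g w)"
  using flat_add[OF assms(1) flat_cmult[OF assms(2), of "-1"]] by simp

lemma lip0_add:
  assumes "lip0 f" "lip0 g" shows "lip0 (\<lambda>w. f w + g w)"
proof -
  from assms(1) obtain L r where 1: "0 < L" "0 < r" "f 0 = 0"
    "\<And>w w'. cmod w < r \<Longrightarrow> cmod w' < r \<Longrightarrow> norm (f w - f w') \<le> L * cmod (w - w')" by (rule lip0E) blast
  from assms(2) obtain L' r' where 2: "0 < L'" "0 < r'" "g 0 = 0"
    "\<And>w w'. cmod w < r' \<Longrightarrow> cmod w' < r' \<Longrightarrow> norm (g w - g w') \<le> L' * cmod (w - w')" by (rule lip0E) blast
  have "norm ((f w + g w) - (f w' + g w')) \<le> (L + L') * cmod (w - w')"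
    if "cmod w < min r r'" "cmod w' < min r r'" for w w'
  proof -
    have "norm ((f w + g w) - (f w' + g w')) \<le> norm (f w - f w') + norm (g w - g w')"
      by (metis add_diff_add norm_triangle_ineq)
    with 1(4)[of w w'] 2(4)[of w w'] that show ?thesis by (simp add: distrib_right)
  qed
  then show ?thesis using 1 2 unfolding lip0_def
    by (intro conjI exI[of _ "L + L'"] exI[of _ "min r r'"]) auto
qed

lemma product_difference_bound:
  fixes f g :: "complex \<Rightarrow> 'a::real_normed_algebra"
  assumes "norm (f w) \<le> a" "norm (g w - g w') \<le> b" "norm (g w') \<le> c" "norm (f w - f w') \<le> d"
  shows "norm (f w * g w - f w' * g w') \<le> a * b + d * c"
proof -
  have "f w * g w - f w' * g w' = f w * (g w - g w') + (f w - f w') * g w'" by (simp add: algebra_simps)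
  then have "norm (f w * g w - f w' * g w') \<le> norm (f w * (g w - g w')) + norm ((f w - f w') * g w')"
    by (metis norm_triangle_ineq)
  also have "\<dots> \<le> norm (f w) * norm (g w - g w') + norm (f w - f w') * norm (g w')"
    by (intro add_mono norm_mult_ineq)
  also have "\<dots> \<le> a * b + d * c"
    using assms norm_ge_zero order_trans by (intro add_mono mult_mono) (blast+)
  finally show ?thesis .
qed

text \<open>In the product rule for differences each term keeps one factor that is small because it
  vanishes at 0.\<close>

lemma flat_mult:
  fixes f g :: "complex \<Rightarrow> 'a::real_normed_algebra"
  assumes "lip0 f" "lip0 g" shows "flat 0 (\<lambda>w. f w * g w)"
  unfolding flat_def
proof (intro allI impI)
  fix \<epsilon> :: real assume e: "0 < \<epsilon>"
  from assms(1) obtain L r where 1: "0 < L" "0 < r" "f 0 = 0"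
    "\<And>w w'. cmod w < r \<Longrightarrow> cmod w' < r \<Longrightarrow> norm (f w - f w') \<le> L * cmod (w - w')"
    "\<And>w. cmod w < r \<Longrightarrow> norm (f w) \<le> L * cmod w" by (rule lip0E) blast
  from assms(2) obtain L' r' where 2: "0 < L'" "0 < r'" "g 0 = 0"
    "\<And>w w'. cmod w < r' \<Longrightarrow> cmod w' < r' \<Longrightarrow> norm (g w - g w') \<le> L' * cmod (w - w')"
    "\<And>w. cmod w < r' \<Longrightarrow> norm (g w) \<le> L' * cmod w" by (rule lip0E) blast
  define s where "s = min (min r r') (\<epsilon> / (2 * L * L'))"
  have s: "0 < s" "s \<le> r" "s \<le> r'" "2 * L * L' * s \<le> \<epsilon>"
  proof -
    show "0 < s" "s \<le> r" "s \<le> r'" using 1 2 e by (auto simp: s_def)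
    have "s \<le> \<epsilon> / (2 * L * L')" by (simp add: s_def)
    then show "2 * L * L' * s \<le> \<epsilon>" using 1 2 by (simp add: field_simps)
  qed
  have "norm (f w * g w - f w' * g w') \<le> \<epsilon> * max (cmod w) (cmod w') ^ 0 * cmod (w - w')"
    if w: "cmod w < s" "cmod w' < s" for w w'
  proof -
    have "norm (f w * g w - f w' * g w') \<le> (L * s) * (L' * cmod (w - w')) + (L * cmod (w - w')) * (L' * s)"
    proof (rule product_difference_bound)
      show "norm (f w) \<le> L * s" using 1(5)[of w] w s 1(1) mult_left_mono[of "cmod w" s L] by linarith
      show "norm (g w') \<le> L' * s" using 2(5)[of w'] w s 2(1) mult_left_mono[of "cmod w'" s L'] by linarith
    qed (use 1(4) 2(4) w s in auto)
    also have "\<dots> = (2 * L * L' * s) * cmod (w - w')" by simp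
    also have "\<dots> \<le> \<epsilon> * cmod (w - w')" by (intro mult_right_mono s) auto
    finally show ?thesis by simp
  qed
  with s(1) show "\<exists>r>0. \<forall>w w'. cmod w < r \<longrightarrow> cmod w' < r \<longrightarrow>
     norm (f w * g w - f w' * g w') \<le> \<epsilon> * max (cmod w) (cmod w') ^ 0 * cmod (w - w')" by blast
qed

lemma flat_mult1:
  fixes f g :: "complex \<Rightarrow> 'a::real_normed_algebra"
  assumes "lip0 f" "flat 0 g" "g 0 = 0" shows "flat 1 (\<lambda>w. f w * g w)"
  unfolding flat_def
proof (intro allI impI)
  fix \<epsilon> :: real assume e: "0 < \<epsilon>"
  from assms(1) obtain L r where 1: "0 < L" "0 < r" "f 0 = 0"
    "\<And>w w'. cmod w < r \<Longrightarrow> cmod w' < r \<Longrightarrow> norm (f w - f w') \<le> L * cmod (w - w')"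
    "\<And>w. cmod w < r \<Longrightarrow> norm (f w) \<le> L * cmod w" by (rule lip0E) blast
  define d where "d = \<epsilon> / (2 * L)"
  have d: "0 < d" "2 * L * d = \<epsilon>" using e 1 by (auto simp: d_def)
  from flatE[OF assms(2) d(1)] obtain r' where 2: "0 < r'"
    "\<And>w w'. cmod w < r' \<Longrightarrow> cmod w' < r' \<Longrightarrow> norm (g w - g w') \<le> d * cmod (w - w')" by auto
  have "norm (f w * g w - f w' * g w') \<le> \<epsilon> * max (cmod w) (cmod w') ^ 1 * cmod (w - w')"
    if w: "cmod w < min r r'" "cmod w' < min r r'" for w w'
  proof -
    let ?m = "max (cmod w) (cmod w')"
    have "norm (f w * g w - f w' * g w') \<le> (L * ?m) * (d * cmod (w - w')) + (L * cmod (w - w')) * (d * ?m)"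
    proof (rule product_difference_bound)
      show "norm (f w) \<le> L * ?m" using 1(5)[of w] w 1(1) mult_left_mono[of "cmod w" ?m L] by linarith
      have "norm (g w') \<le> d * cmod w'" using 2(1) 2(2)[of w' 0] assms(3) w by simp
      also have "\<dots> \<le> d * ?m" using d(1) by (intro mult_left_mono) auto
      finally show "norm (g w') \<le> d * ?m" .
    qed (use 1(4) 2(2) w in auto)
    also have "\<dots> = (2 * L * d) * ?m * cmod (w - w')" by simp
    finally show ?thesis by (simp add: d)
  qed
  with 1(2) 2(1) show "\<exists>r>0. \<forall>w w'. cmod w < r \<longrightarrow> cmod w' < r \<longrightarrow>
     norm (f w * g w - f w' * g w') \<le> \<epsilon> * max (cmod w) (cmod w') ^ 1 * cmod (w - w')"
    by (intro exI[of _ "min r r'"]) auto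
qed

lemma lip0_Re: "lip0 Re"
proof -
  have "norm (Re w - Re w') \<le> 1 * cmod (w - w')" for w w'
    using abs_Re_le_cmod[of "w - w'"] by simp
  then show ?thesis unfolding lip0_def by (metis zero_complex.sel(1) zero_less_one)
qed

lemma lip0_cmod: "lip0 cmod"
proof -
  have "norm (cmod w - cmod w') \<le> 1 * cmod (w - w')" for w w'
    using norm_triangle_ineq3[of w w'] by simp
  then show ?thesis unfolding lip0_def by (metis norm_zero zero_less_one)
qed

lemma lip0_mult_const: "lip0 (\<lambda>w. c * w)"
proof -
  have "norm (c * w - c * w') \<le> cmod c * cmod (w - w')" for w w'
    by (simp add: norm_mult flip: right_diff_distrib)
  then show ?thesis unfolding lip0_def by (metis mult_zero_right zero_less_one)
qed

lemma flat_compose: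
  assumes "flat n f" and "\<And>w. cmod (g w) = cmod w"
    and "0 < r0" "\<And>w w'. cmod w < r0 \<Longrightarrow> cmod w' < r0 \<Longrightarrow> cmod (g w - g w') \<le> 2 * cmod (w - w')"
  shows "flat n (\<lambda>w. f (g w))"
  unfolding flat_def
proof (intro allI impI)
  fix \<epsilon> :: real assume e: "0 < \<epsilon>"
  from flatE[OF assms(1), of "\<epsilon> / 2"] e obtain r where r: "0 < r" "\<And>w w'. cmod w < r \<Longrightarrow> cmod w' < r \<Longrightarrow>
     norm (f w - f w') \<le> \<epsilon> / 2 * max (cmod w) (cmod w') ^ n * cmod (w - w')" by auto
  have "norm (f (g w) - f (g w')) \<le> \<epsilon> * max (cmod w) (cmod w') ^ n * cmod (w - w')"
    if "cmod w < min r r0" "cmod w' < min r r0" for w w'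
  proof -
    have "norm (f (g w) - f (g w')) \<le> \<epsilon> / 2 * max (cmod w) (cmod w') ^ n * cmod (g w - g w')"
      using r(2)[of "g w" "g w'"] that by (simp add: assms(2))
    also have "\<dots> \<le> \<epsilon> / 2 * max (cmod w) (cmod w') ^ n * (2 * cmod (w - w'))"
      using assms(4)[of w w'] that e by (intro mult_left_mono) (auto simp: le_max_iff_disj)
    finally show ?thesis by simp
  qed
  with r(1) assms(3) show "\<exists>r>0. \<forall>w w'. cmod w < r \<longrightarrow> cmod w' < r \<longrightarrow>
     norm (f (g w) - f (g w')) \<le> \<epsilon> * max (cmod w) (cmod w') ^ n * cmod (w - w')"
    by (intro exI[of _ "min r r0"]) auto
qed

text \<open>Since the angle is a positive power of \<open>cmod w\<close>, \<open>cis\<close> of it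
  minus 1 is Lipschitz and zero at 0, and the other factor \<open>w\<close> is so as well.\<close>

lemma flat_rotation_excess:
  assumes "1 \<le> m"
  shows "flat 0 (\<lambda>w. (cis (\<omega> * cmod w ^ (2 * m)) - 1) * w)"
proof -
  have pow: "lip0 (\<lambda>w. cmod w ^ Suc n)" for n
  proof (induction n)
    case (Suc n)
    show ?case using flat_lip0[OF flat_mult[OF lip0_cmod Suc]] by simp
  qed (simp add: lip0_cmod)
  obtain n where n: "2 * m = Suc n" using assms by (cases "2 * m") auto
  from pow[of n] obtain L r where L: "0 < L" "0 < r"
    "\<And>w w'. cmod w < r \<Longrightarrow> cmod w' < r \<Longrightarrow> \<bar>cmod w ^ (2 * m) - cmod w' ^ (2 * m)\<bar> \<le> L * cmod (w - w')"
    unfolding n by (elim lip0E) (auto simp: n)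
  have cis: "cmod (cis a - cis b) \<le> 2 * \<bar>a - b\<bar>" for a b
    using cmod_le[of "cis a - cis b"] cos_sin_perturb(1,2)[of b "a - b"] by simp
  have "lip0 (\<lambda>w. cis (\<omega> * cmod w ^ (2 * m)) - 1)"
    unfolding lip0_def
  proof (intro conjI exI allI impI)
    fix w w' assume "cmod w < r" "cmod w' < r"
    have "cmod ((cis (\<omega> * cmod w ^ (2 * m)) - 1) - (cis (\<omega> * cmod w' ^ (2 * m)) - 1))
        \<le> 2 * \<bar>\<omega>\<bar> * \<bar>cmod w ^ (2 * m) - cmod w' ^ (2 * m)\<bar>"
      using cis[of "\<omega> * cmod w ^ (2 * m)" "\<omega> * cmod w' ^ (2 * m)"] by (simp add: abs_mult flip: right_diff_distrib)
    also have "\<dots> \<le> 2 * \<bar>\<omega>\<bar> * (L * cmod (w - w'))"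
      using L(3) \<open>cmod w < r\<close> \<open>cmod w' < r\<close> by (intro mult_left_mono) auto
    finally show "cmod ((cis (\<omega> * cmod w ^ (2 * m)) - 1) - (cis (\<omega> * cmod w' ^ (2 * m)) - 1))
        \<le> (2 * \<bar>\<omega>\<bar> * L) * cmod (w - w')" by simp
  qed (use assms L in \<open>auto simp: power_0_left\<close>)
  from flat_mult[OF this lip0_mult_const[of 1]] show ?thesis by simp
qed

lemma flat_hpart:
  "flat 0 (\<lambda>w. hpart al be ga de ep io et xi (Re w) ((cmod w)\<^sup>2))"
proof -
  note X = lip0_Re
  have X2: "lip0 (\<lambda>w. Re w * Re w)" by (rule flat_lip0[OF flat_mult[OF X X]]) simp
  have X3: "lip0 (\<lambda>w. Re w * (Re w * Re w))" by (rule flat_lip0[OF flat_mult[OF X X2]]) simp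
  have r: "lip0 (\<lambda>w. cmod w * cmod w)" by (rule flat_lip0[OF flat_mult[OF lip0_cmod lip0_cmod]]) simp
  have "flat 0 (\<lambda>w. al * (cmod w * cmod w) + be * (Re w * Re w) + ga * (Re w * (Re w * Re w))
      + (de * (cmod w * cmod w * (cmod w * cmod w)) + ep * (cmod w * cmod w * (Re w * Re w))
         + io * (Re w * Re w * (Re w * Re w)))
      + (et * (Re w * Re w * (Re w * (Re w * Re w))) + xi * (Re w * (Re w * Re w) * (cmod w * cmod w))))"
    by (intro flat_add flat_cmult flat_mult X X2 X3 r lip0_cmod)
  moreover have "al * (cmod w * cmod w) + be * (Re w * Re w) + ga * (Re w * (Re w * Re w))
      + (de * (cmod w * cmod w * (cmod w * cmod w)) + ep * (cmod w * cmod w * (Re w * Re w))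
         + io * (Re w * Re w * (Re w * Re w)))
      + (et * (Re w * Re w * (Re w * (Re w * Re w))) + xi * (Re w * (Re w * Re w) * (cmod w * cmod w)))
      = hpart al be ga de ep io et xi (Re w) ((cmod w)\<^sup>2)" for w
    unfolding hpart_def by algebra
  ultimately show ?thesis by simp
qed

lemma flat_Re:
  assumes "flat n f" shows "flat n (\<lambda>w. Re (c * f w))"
proof (rule flat_dominated[OF assms, of "cmod c"])
  show "norm (Re (c * f w) - Re (c * f w')) \<le> cmod c * norm (f w - f w')" for w w'
    using abs_Re_le_cmod[of "c * (f w - f w')"]
    by (simp only: right_diff_distrib minus_complex.sel real_norm_def flip: norm_mult)
qed simp

lemma odd_power_neq_1:
  fixes C :: real
  assumes "C \<noteq> 1" "odd N" shows "C ^ N \<noteq> 1"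
proof
  assume *: "C ^ N = 1"
  then have "0 \<le> C" using zero_le_odd_power[OF assms(2), of C] by simp
  with * assms show False using power_eq_iff_eq_base[of N C 1] by (simp add: odd_pos)
qed

text \<open>
  The parametrisation conjugates the map to a perturbed rotation, and the conjugate has
  infinitely many cycles of some odd length, whereas the recurrence has only finitely many.
\<close>

lemma no_first_integral:
  fixes A B C x0 \<theta> t a :: real and V :: "real^2 \<Rightarrow> real" and U :: "(real^2) set"
  assumes C: "C \<noteq> 0" "C \<noteq> 1" and x0: "x0 \<noteq> 0" and fixp: "A + B * x0 + C * x0\<^sup>2 = x0\<^sup>2"
    and t: "t = B / x0 + 2 * C" "t = 2 * cos \<theta>" "sin \<theta> \<noteq> 0" "t \<noteq> -1" "t \<noteq> 0" "t\<^sup>2 + t - 1 \<noteq> 0"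
    and p: "p = vector [x0, x0]" and U: "open U" "p \<in> U"
    and inv: "\<And>x. x \<in> U \<Longrightarrow> F_map A B C x \<in> U \<Longrightarrow> V (F_map A B C x) = V x"
    and a: "a \<noteq> 0"
    and V: "\<And>\<epsilon>. 0 < \<epsilon> \<Longrightarrow> \<exists>r>0. \<forall>d d'. norm d < r \<longrightarrow> norm d' < r \<longrightarrow>
      \<bar>V (p + d') - V (p + d) - a * (elliptic_form t d' - elliptic_form t d)\<bar> \<le> \<epsilon> * max (norm d) (norm d') * norm (d' - d)"
  shows False
proof -
  have t2: "-2 < t" "t < 2" using elliptic_trace_bound[OF t(3)] by (simp_all add: t(2))
  from param_eqs_exist[OF t2 t(4-6) C(1)] obtain k1 k2 al be ga de ep io et xi
    where eqs: "param_eqs t C k1 k2 al be ga de ep io et xi" by blast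
  define h where "h w = hpart al be ga de ep io et xi (Re w) ((cmod w)\<^sup>2)" for w
  define K where "K w = Re w + h w" for w
  from approx_invariance[OF eqs t(2,3), folded h_def, folded K_def] obtain m \<omega> where
    m: "1 \<le> m" and \<omega>: "\<omega> \<noteq> 0" and van: "vanishes (2 * m + 2) (\<lambda>w.
    curve_defect t C K (cis (\<theta> + \<omega> * cmod w ^ (2 * m)) * w) (cis (- (\<theta> + \<omega> * cmod w ^ (2 * m))) * w) w)" by blast
  define R where "R w = cis (\<theta> + \<omega> * cmod w ^ (2 * m)) * w" for w
  have Rnorm: "cmod (R w) = cmod w" for w by (simp add: R_def norm_mult)
  from van obtain M ra where M: "0 \<le> M" "0 < ra"
    and M': "\<And>w. cmod w < ra \<Longrightarrow> \<bar>curve_defect t C K (cis (\<theta> + \<omega> * cmod w ^ (2 * m)) * w)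
      (cis (- (\<theta> + \<omega> * cmod w ^ (2 * m))) * w) w\<bar> \<le> M * cmod w ^ (2 * m + 2)"
    by (rule vanishesE) blast
  \<comment> \<open>The estimate \<open>M'\<close> is applied at \<open>R w\<close>. The angle
    depends on the modulus only, which \<open>R\<close> keeps, so the backward rotate of
    \<open>R w\<close> is \<open>w\<close> itself.\<close>
  have residual: "\<bar>K (R (R w)) + K w + K (R (R w)) * K w - t * K (R w) - C * (K (R w))\<^sup>2\<bar> \<le> M * cmod w ^ (2 * m + 2)"
    if "cmod w < ra" for w
  proof -
    have "cis (\<theta> + \<omega> * cmod (R w) ^ (2 * m)) * R w = R (R w)" by (simp add: R_def)
    moreover have "cis (- (\<theta> + \<omega> * cmod (R w) ^ (2 * m))) * R w = w"
      unfolding Rnorm by (simp only: R_def cis_mult flip: mult.assoc) simp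
    ultimately show ?thesis using M'[of "R w"] that by (simp only: Rnorm curve_defect_def)
  qed
  have h0: "h 0 = 0" by (simp add: h_def hpart_def)
  have R0: "R 0 = 0" by (simp add: R_def)
  have fh: "flat 0 h" unfolding h_def by (rule flat_hpart)
  define E where "E w = (cis (\<omega> * cmod w ^ (2 * m)) - 1) * w" for w
  have fE: "flat 0 E" unfolding E_def by (rule flat_rotation_excess[OF m])
  have RE: "R w = cis \<theta> * w + cis \<theta> * E w" for w
    by (simp add: R_def E_def algebra_simps flip: cis_mult)
  from flatE[OF fE, of 1] obtain rb where rb: "0 < rb"
    "\<And>w w'. cmod w < rb \<Longrightarrow> cmod w' < rb \<Longrightarrow> cmod (E w - E w') \<le> cmod (w - w')" by auto
  have R2: "cmod (R w - R w') \<le> 2 * cmod (w - w')" if "cmod w < rb" "cmod w' < rb" for w w'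
  proof -
    have "R w - R w' = cis \<theta> * ((w - w') + (E w - E w'))" by (simp add: RE algebra_simps)
    then have "cmod (R w - R w') = cmod ((w - w') + (E w - E w'))" by (simp add: norm_mult)
    also have "\<dots> \<le> cmod (w - w') + cmod (E w - E w')" by (rule norm_triangle_ineq)
    finally show ?thesis using rb(2)[OF that] by simp
  qed
  define S where "S w = Re (cis \<theta> * w)" for w
  define h' where "h' w = Re (cis \<theta> * E w) + h (R w)" for w
  have KR: "K (R w) = S w + h' w" for w by (simp add: K_def S_def h'_def RE)
  have fh': "flat 0 h'" unfolding h'_def
    by (intro flat_add flat_Re fE flat_compose[OF fh Rnorm rb(1)] R2)
  have h'0: "h' 0 = 0" by (simp add: h'_def E_def R0 h0)
  have lX: "lip0 Re" by (rule lip0_Re)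
  have lS: "lip0 S"
  proof -
    have "norm (S w - S w') \<le> 1 * cmod (w - w')" for w w'
    proof -
      have "S w - S w' = Re (cis \<theta> * (w - w'))" by (simp add: S_def algebra_simps)
      then show ?thesis using abs_Re_le_cmod[of "cis \<theta> * (w - w')"] by (simp add: norm_mult)
    qed
    moreover have "S 0 = 0" by (simp add: S_def)
    ultimately show ?thesis unfolding lip0_def using zero_less_one by blast
  qed
  have lh: "lip0 h" and lh': "lip0 h'" by (rule flat_lip0 fh h0 fh' h'0)+
  define v where "v w = K (R w)" for w
  have vS: "v w = S w + h' w" for w by (simp only: v_def KR)
  have lu: "lip0 K" unfolding K_def by (rule lip0_add[OF lX lh])
  have lv: "lip0 v" unfolding v_def KR by (rule lip0_add[OF lS lh'])
  \<comment> \<open>Points of the plane are pairs of consecutive terms, hence \<open>K\<close> at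
    \<open>w\<close> and at \<open>R w\<close>. Then \<open>F_map\<close> at \<open>G w\<close> has
    exactly the first coordinate of \<open>G (R w)\<close>.\<close>
  define D :: "complex \<Rightarrow> real^2" where "D w = vector [x0 * K w, x0 * v w]" for w
  have D12: "D w $ 1 = x0 * K w" "D w $ 2 = x0 * v w" for w by (simp_all add: D_def)
  define G where "G w = p + D w" for w
  have K0: "K 0 = 0" by (simp add: K_def h0)
  have v0: "v 0 = 0" by (simp add: v_def R0 K0)
  have D0: "D 0 = 0" by (simp add: vec2_eq_iff D12 K0 v0)
  have G0: "G 0 = p" by (simp add: G_def D0)
  have G12: "G w $ 1 = x0 * (1 + K w)" "G w $ 2 = x0 * (1 + v w)" for w
    by (simp_all add: G_def D12 p distrib_left)
  from lip0E[OF lu] obtain Lu ru where Lu: "0 < Lu" "0 < ru"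
    "\<And>w w'. cmod w < ru \<Longrightarrow> cmod w' < ru \<Longrightarrow> norm (K w - K w') \<le> Lu * cmod (w - w')"
    "\<And>w. cmod w < ru \<Longrightarrow> norm (K w) \<le> Lu * cmod w" by metis
  from lip0E[OF lv] obtain Lv rv where Lv: "0 < Lv" "0 < rv"
    "\<And>w w'. cmod w < rv \<Longrightarrow> cmod w' < rv \<Longrightarrow> norm (v w - v w') \<le> Lv * cmod (w - w')" by metis
  define L where "L = \<bar>x0\<bar> * (Lu + Lv)"
  define rD where "rD = min ru rv"
  have L: "0 < L" "0 < rD" using x0 Lu Lv by (auto simp: L_def rD_def)
  have DL: "norm (D w - D w') \<le> L * cmod (w - w')" if "cmod w < rD" "cmod w' < rD" for w w'
  proof -
    have "norm (D w - D w') \<le> \<bar>x0\<bar> * \<bar>K w - K w'\<bar> + \<bar>x0\<bar> * \<bar>v w - v w'\<bar>"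
      using norm_vec2_le[of "D w - D w'"] by (simp add: D12 abs_mult flip: right_diff_distrib)
    also have "\<dots> \<le> \<bar>x0\<bar> * (Lu * cmod (w - w')) + \<bar>x0\<bar> * (Lv * cmod (w - w'))"
      using Lu(3)[of w w'] Lv(3)[of w w'] that by (intro add_mono mult_left_mono) (auto simp: rD_def)
    finally show ?thesis by (simp add: L_def algebra_simps)
  qed
  have DL0: "norm (D w) \<le> L * cmod w" if "cmod w < rD" for w
    using DL[OF that, of 0] L(2) by (simp add: D0)
  define s where "s = \<bar>sin \<theta>\<bar>"
  have s: "0 < s" using t(3) by (simp add: s_def)
  have quad: "(Re w)\<^sup>2 - t * Re w * S w + (S w)\<^sup>2 = s\<^sup>2 * (cmod w)\<^sup>2" for w
    using rotation_quadratic_form[of w \<theta>] by (simp add: t(2) S_def s_def)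
  define c where "c = \<bar>x0\<bar> * s / 4"
  have c: "0 < c" using x0 s by (simp add: c_def)
  from flatE[OF fh, of "s / 4"] s obtain rh where rh: "0 < rh"
    "\<And>w w'. cmod w < rh \<Longrightarrow> cmod w' < rh \<Longrightarrow> \<bar>h w - h w'\<bar> \<le> s / 4 * cmod (w - w')" by auto
  from flatE[OF fh', of "s / 4"] s obtain rh' where rh': "0 < rh'"
    "\<And>w w'. cmod w < rh' \<Longrightarrow> cmod w' < rh' \<Longrightarrow> \<bar>h' w - h' w'\<bar> \<le> s / 4 * cmod (w - w')" by auto
  define r0 where "r0 = min rD (min rh rh')"
  have r0: "0 < r0" using L rh rh' by (simp add: r0_def)
  \<comment> \<open>Because \<open>\<bar>t\<bar> < 2\<close>, the invariant form bounds the linear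
    part of \<open>G\<close> from below, and the flat parts \<open>h\<close> and \<open>h'\<close>
    use up at most half of this bound. The other factor 2 in \<open>c\<close> comes from estimating
    both coordinates by the norm.\<close>
  have low: "c * cmod (w - w') \<le> norm (G w - G w')" if w: "cmod w < r0" "cmod w' < r0" for w w'
  proof -
    define x y where "x = \<bar>Re (w - w')\<bar>" and "y = \<bar>S (w - w')\<bar>"
    have "(s * cmod (w - w'))\<^sup>2 \<le> (x + y)\<^sup>2"
    proof -
      have "- (t * Re (w - w') * S (w - w')) \<le> \<bar>t\<bar> * (x * y)"
        unfolding x_def y_def by (metis abs_ge_minus_self abs_mult mult.assoc)
      also have "\<dots> \<le> 2 * (x * y)" using t2 by (intro mult_right_mono) (auto simp: x_def y_def)
      finally have "(Re (w - w'))\<^sup>2 - t * Re (w - w') * S (w - w') + (S (w - w'))\<^sup>2 \<le> (x + y)\<^sup>2"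
        by (simp add: x_def y_def power2_sum)
      then show ?thesis unfolding quad power_mult_distrib .
    qed
    then have 1: "s * cmod (w - w') \<le> x + y" by (rule power2_le_imp_le) (simp add: x_def y_def)
    have "S w - S w' = S (w - w')" by (simp add: S_def algebra_simps)
    then have 2: "y \<le> \<bar>v w - v w'\<bar> + \<bar>h' w - h' w'\<bar>" unfolding y_def v_def KR by linarith
    have 3: "x \<le> \<bar>K w - K w'\<bar> + \<bar>h w - h w'\<bar>" unfolding x_def K_def minus_complex.sel by linarith
    have "\<bar>h w - h w'\<bar> \<le> s / 4 * cmod (w - w')" "\<bar>h' w - h' w'\<bar> \<le> s / 4 * cmod (w - w')"
      using rh(2)[of w w'] rh'(2)[of w w'] w by (simp_all add: r0_def)
    with 1 2 3 have "s / 2 * cmod (w - w') \<le> \<bar>K w - K w'\<bar> + \<bar>v w - v w'\<bar>" by linarith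
    then have "\<bar>x0\<bar> * (s / 2 * cmod (w - w')) \<le> \<bar>x0\<bar> * (\<bar>K w - K w'\<bar> + \<bar>v w - v w'\<bar>)"
      by (intro mult_left_mono) auto
    also have "\<dots> = \<bar>(G w - G w') $ 1\<bar> + \<bar>(G w - G w') $ 2\<bar>"
      by (simp add: G_def D12 distrib_left abs_mult flip: right_diff_distrib)
    also have "\<dots> \<le> norm (G w - G w') + norm (G w - G w')"
      by (intro add_mono component_le_norm_cart)
    finally show ?thesis by (simp add: c_def)
  qed
  have Glip: "norm (G w - G w') \<le> L * cmod (w - w')" if "cmod w < r0" "cmod w' < r0" for w w'
    using DL[of w w'] that by (simp add: G_def r0_def)
  have Gcont: "continuous_on (ball 0 r0) G"
    by (rule lipschitz_on_continuous_on[of L], rule lipschitz_onI)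
      (use Glip L in \<open>auto simp: dist_norm\<close>)
  have Ginj: "inj_on G (ball 0 r0)"
  proof (rule inj_onI)
    fix w w' assume "w \<in> ball 0 r0" "w' \<in> ball 0 r0" "G w = G w'"
    with low[of w w'] c show "w = w'" by (simp add: mult_le_0_iff)
  qed
  have Gopen: "open (G ` ball 0 r0)"
    by (rule invariance_of_domain_gen) (use Gcont Ginj in auto)
  define \<zeta> where "\<zeta> = inv_into (ball 0 r0) G"
  have \<zeta>: "cmod (\<zeta> y) < r0" "G (\<zeta> y) = y" if "y \<in> G ` ball 0 r0" for y
    using inv_into_into[OF that] f_inv_into_f[OF that] by (auto simp: \<zeta>_def)
  have \<zeta>lip: "cmod (\<zeta> y - w) \<le> 1 / c * norm (y - G w)" if "y \<in> G ` ball 0 r0" "cmod w < r0" for y w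
    using low[of "\<zeta> y" w] \<zeta>[OF that(1)] that(2) c by (simp add: field_simps)
  have \<zeta>cont: "continuous_on (G ` ball 0 r0) \<zeta>"
  proof (rule lipschitz_on_continuous_on[of "1 / c"], rule lipschitz_onI)
    fix y y' assume "y \<in> G ` ball 0 r0" "y' \<in> G ` ball 0 r0"
    then show "dist (\<zeta> y) (\<zeta> y') \<le> 1 / c * dist y y'"
      using \<zeta>lip[of y "\<zeta> y'"] \<zeta>[of y'] by (simp add: dist_norm)
  qed (use c in auto)
  have fq: "flat 1 (\<lambda>w. K w * K w - t * (K w * v w) + v w * v w - s\<^sup>2 * (cmod w)\<^sup>2)"
  proof -
    have "flat 1 (\<lambda>w. 2 * (Re w * h w) + h w * h w - t * (Re w * h' w + S w * h w + h w * h' w)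
        + 2 * (S w * h' w) + h' w * h' w)"
      by (intro flat_add flat_diff flat_cmult flat_mult1 lX lS lh lh' fh fh' h0 h'0)
    moreover have "2 * (Re w * h w) + h w * h w - t * (Re w * h' w + S w * h w + h w * h' w)
        + 2 * (S w * h' w) + h' w * h' w = K w * K w - t * (K w * v w) + v w * v w - s\<^sup>2 * (cmod w)\<^sup>2" for w
      unfolding quad[symmetric] vS K_def by algebra
    ultimately show ?thesis by simp
  qed
  have qD: "elliptic_form t (D w) = x0\<^sup>2 * (K w * K w - t * (K w * v w) + v w * v w)" for w
    unfolding elliptic_form_def D12 by algebra
  have fV: "flat 1 (\<lambda>w. V (G w) - a * elliptic_form t (D w))"
    unfolding flat_def
  proof (intro allI impI)
    fix \<epsilon> :: real assume e: "0 < \<epsilon>"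
    then have "0 < \<epsilon> / L\<^sup>2" using L by simp
    from V[OF this] obtain r where r: "0 < r" "\<And>d d'. norm d < r \<Longrightarrow> norm d' < r \<Longrightarrow>
      \<bar>V (p + d') - V (p + d) - a * (elliptic_form t d'
          - elliptic_form t d)\<bar> \<le> \<epsilon> / L\<^sup>2 * max (norm d) (norm d') * norm (d' - d)"
      by blast
    have "norm ((V (G w) - a * elliptic_form t (D w)) - (V (G w')
        - a * elliptic_form t (D w'))) \<le> \<epsilon> * max (cmod w) (cmod w') ^ 1 * cmod (w - w')"
      if w: "cmod w < min rD (r / L)" "cmod w' < min rD (r / L)" for w w'
    proof -
      have lt: "norm (D z) < r" if "cmod z < min rD (r / L)" for z
        using DL0[of z] that L by (simp add: field_simps)
      have "norm ((V (G w) - a * elliptic_form t (D w)) - (V (G w') - a * elliptic_form t (D w'))) =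
          \<bar>V (p + D w) - V (p + D w') - a * (elliptic_form t (D w) - elliptic_form t (D w'))\<bar>"
        by (simp add: G_def algebra_simps)
      also have "\<dots> \<le> \<epsilon> / L\<^sup>2 * max (norm (D w')) (norm (D w)) * norm (D w - D w')"
        by (rule r(2)[OF lt[OF w(2)] lt[OF w(1)]])
      also have "\<dots> \<le> \<epsilon> / L\<^sup>2 * (L * max (cmod w) (cmod w')) * (L * cmod (w - w'))"
      proof -
        have "L * cmod w \<le> L * max (cmod w) (cmod w')" "L * cmod w' \<le> L * max (cmod w) (cmod w')"
          using L by (auto intro!: mult_left_mono)
        then have "max (norm (D w')) (norm (D w)) \<le> L * max (cmod w) (cmod w')"
          using DL0[of w] DL0[of w'] w by auto
        then show ?thesis
          using DL[of w w'] w e L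
          by (intro mult_mono mult_left_mono mult_nonneg_nonneg) (auto simp: le_max_iff_disj)
      qed
      also have "\<dots> = \<epsilon> * max (cmod w) (cmod w') ^ 1 * cmod (w - w')"
        using L by (simp add: power2_eq_square)
      finally show ?thesis .
    qed
    with r(1) L show "\<exists>r>0. \<forall>w w'. cmod w < r \<longrightarrow> cmod w' < r \<longrightarrow>
        norm ((V (G w) - a * elliptic_form t (D w)) - (V (G w')
            - a * elliptic_form t (D w'))) \<le> \<epsilon> * max (cmod w) (cmod w') ^ 1 * cmod (w - w')"
      by (intro exI[of _ "min rD (r / L)"]) auto
  qed
  \<comment> \<open>Normalised to have quadratic part \<open>(cmod w)^2\<close>: \<open>a\<close>
    belongs to \<open>V\<close>, \<open>x0^2\<close> to the scale of \<open>D\<close> and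
    \<open>s^2\<close> to the elliptic form.\<close>
  define W where "W w = V (G w) / (a * x0\<^sup>2 * s\<^sup>2)" for w
  have fW: "flat 1 (\<lambda>w. W w - (cmod w)\<^sup>2)"
  proof -
    have "flat 1 (\<lambda>w. 1 / (a * x0\<^sup>2 * s\<^sup>2) * ((V (G w) - a * elliptic_form t (D w))
        + (a * x0\<^sup>2) * (K w * K w - t * (K w * v w) + v w * v w - s\<^sup>2 * (cmod w)\<^sup>2)))"
      by (intro flat_add flat_cmult fV fq)
    moreover have "1 / (a * x0\<^sup>2 * s\<^sup>2) * ((V (G w) - a * elliptic_form t (D w))
        + (a * x0\<^sup>2) * (K w * K w - t * (K w * v w) + v w * v w - s\<^sup>2 * (cmod w)\<^sup>2)) = W w - (cmod w)\<^sup>2" for w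
    proof -
      have "V (G w) - a * elliptic_form t (D w) + (a * x0\<^sup>2) * (K w * K w - t * (K w * v w) + v w * v w - s\<^sup>2 * (cmod w)\<^sup>2)
          = V (G w) - (a * x0\<^sup>2 * s\<^sup>2) * (cmod w)\<^sup>2" unfolding qD by algebra
      moreover have "a * x0\<^sup>2 * s\<^sup>2 \<noteq> 0" using a x0 s by simp
      ultimately show ?thesis by (simp add: W_def field_simps)
    qed
    ultimately show ?thesis by simp
  qed
  from flatE[OF fW, of "1 / 4"] obtain rW where rW: "0 < rW"
    "\<And>w w'. cmod w < rW \<Longrightarrow> cmod w' < rW \<Longrightarrow>
      \<bar>(W w - (cmod w)\<^sup>2) - (W w' - (cmod w')\<^sup>2)\<bar> \<le> 1 / 4 * max (cmod w) (cmod w') * cmod (w - w')" by auto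
  define r1 where "r1 = min r0 (1 / (2 * Lu))"
  have r1: "0 < r1" "r1 \<le> r0" using r0 Lu by (auto simp: r1_def)
  have Khalf: "1 / 2 \<le> 1 + K w" if "cmod w < r1" for w
  proof -
    have "\<bar>K w\<bar> \<le> Lu * cmod w" using Lu(4)[of w] that by (simp add: r1_def r0_def rD_def)
    also have "\<dots> \<le> 1 / 2" using that Lu(1) by (simp add: r1_def field_simps)
    finally show ?thesis by linarith
  qed
  let ?F = "F_map A B C"
  have G1: "G w $ 1 \<noteq> 0" if "cmod w < r1" for w using Khalf[OF that] x0 by (simp add: G12)
  have FGcont: "continuous_on (ball 0 r1) (\<lambda>w. ?F (G w))"
  proof -
    have Gc: "continuous_on (ball 0 r1) G" by (rule continuous_on_subset[OF Gcont]) (use r1 in auto)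
    have "continuous_on (ball 0 r1) (\<lambda>w. ?F (G w) $ i)" for i
    proof (cases "i = 1")
      case True
      then show ?thesis by (simp add: continuous_on_component[OF Gc])
    next
      case False
      then have "i = 2" using exhaust_2 by blast
      then show ?thesis
        using G1 by (auto intro!: continuous_intros continuous_on_component[OF Gc])
    qed
    then have "continuous_on (ball 0 r1) (\<lambda>w. \<chi> i. ?F (G w) $ i)" by (rule continuous_on_vec_lambda)
    then show ?thesis by simp
  qed
  have Fp: "?F p = p" using x0 fixp by (simp add: vec2_eq_iff p power2_eq_square)
  have "open (ball 0 r1 \<inter> (\<lambda>w. ?F (G w)) -` (G ` ball 0 r0))"
    by (rule continuous_open_preimage[OF FGcont _ Gopen]) simp
  moreover have "0 \<in> ball 0 r1 \<inter> (\<lambda>w. ?F (G w)) -` (G ` ball 0 r0)"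
    using r0 r1 by (auto simp: G0 Fp intro!: image_eqI[of _ _ 0])
  ultimately obtain r2 where r2: "0 < r2" "ball 0 r2 \<subseteq> ball 0 r1 \<inter> (\<lambda>w. ?F (G w)) -` (G ` ball 0 r0)"
    by (meson open_contains_ball)
  have "open (ball 0 r0 \<inter> G -` U)"
    by (rule continuous_open_preimage[OF Gcont _ U(1)]) simp
  moreover have "0 \<in> ball 0 r0 \<inter> G -` U" using r0 U(2) by (simp add: G0)
  ultimately obtain r3 where r3: "0 < r3" "ball 0 r3 \<subseteq> ball 0 r0 \<inter> G -` U"
    by (meson open_contains_ball)
  define \<rho> where "\<rho> = min (min r2 r3) (min rW ra)"
  have \<rho>: "0 < \<rho>" using r2 r3 rW M by (simp add: \<rho>_def)
  have sub: "cmod w < r1" "?F (G w) \<in> G ` ball 0 r0" "cmod w < r0" "G w \<in> U" "cmod w < rW" "cmod w < ra"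
    if "cmod w < \<rho>" for w
  proof -
    have "w \<in> ball 0 r2" "w \<in> ball 0 r3" using that by (auto simp: \<rho>_def)
    then show "cmod w < r1" "?F (G w) \<in> G ` ball 0 r0" "cmod w < r0" "G w \<in> U" using r2(2) r3(2) by auto
    show "cmod w < rW" "cmod w < ra" using that by (auto simp: \<rho>_def)
  qed
  define f where "f w = \<zeta> (?F (G w))" for w
  have Gf: "G (f w) = ?F (G w)" if "cmod w < \<rho>" for w
    using \<zeta>(2)[OF sub(2)[OF that]] by (simp add: f_def)
  have fcont: "continuous_on (ball 0 \<rho>) f"
    unfolding f_def
    by (rule continuous_on_compose2[OF \<zeta>cont continuous_on_subset[OF FGcont]]) (use sub in auto)
  \<comment> \<open>Only the second coordinates of \<open>?F (G w)\<close> and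
    \<open>G (R w)\<close> differ, by \<open>x0\<close> times the residual over
    \<open>1 + K w\<close>, whose denominator is at least 1/2. The inverse \<open>\<zeta>\<close>
    has Lipschitz constant \<open>1 / c\<close>.\<close>
  have fest: "cmod (f w - cis (\<theta> + \<omega> * cmod w ^ (2 * m)) * w) \<le> (1 / c * (2 * \<bar>x0\<bar> * M)) * cmod w ^ (2 * m + 2)"
    if w: "cmod w < \<rho>" for w
  proof -
    define u where "u = K (R w)"
    have num: "A + B * (x0 * (1 + u)) + C * (x0 * (1 + u))\<^sup>2 = x0\<^sup>2 * (1 + t * u + C * u\<^sup>2)"
    proof -
      have "B = (t - 2 * C) * x0" using t(1) x0 by (simp add: field_simps)
      then show ?thesis using fixp by algebra
    qed
    have kw: "1 / 2 \<le> 1 + K w" using Khalf[OF sub(1)[OF w]] .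
    have "?F (G w) $ 2 = x0\<^sup>2 * (1 + t * u + C * u\<^sup>2) / (x0 * (1 + K w))"
      by (simp add: G12 v_def num flip: u_def)
    also have "\<dots> = x0 * (1 + t * u + C * u\<^sup>2) / (1 + K w)" using x0 by (simp add: power2_eq_square)
    finally have F2: "?F (G w) $ 2 = x0 * (1 + t * u + C * u\<^sup>2) / (1 + K w)" .
    have F1: "?F (G w) $ 1 = G (R w) $ 1" by (simp add: G12 v_def)
    define e where "e = K (R (R w)) + K w + K (R (R w)) * K w - t * u - C * u\<^sup>2"
    have e: "\<bar>e\<bar> \<le> M * cmod w ^ (2 * m + 2)"
      unfolding e_def u_def by (rule residual[OF sub(6)[OF w]])
    have "(?F (G w) - G (R w)) $ 2 = x0 * (1 + t * u + C * u\<^sup>2) / (1 + K w) - x0 * (1 + v (R w))"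
      by (simp only: vector_minus_component F2 G12)
    also have "\<dots> = - x0 * e / (1 + K w)"
      using kw by (simp add: v_def e_def field_simps)
    finally have "(?F (G w) - G (R w)) $ 2 = - x0 * e / (1 + K w)" .
    then have "\<bar>(?F (G w) - G (R w)) $ 2\<bar> = \<bar>x0\<bar> * \<bar>e\<bar> / (1 + K w)"
      using kw by (simp add: abs_mult)
    also have "\<dots> \<le> \<bar>x0\<bar> * \<bar>e\<bar> / (1 / 2)"
      using kw by (intro divide_left_mono) auto
    also have "\<dots> \<le> 2 * \<bar>x0\<bar> * (M * cmod w ^ (2 * m
        + 2))" using mult_left_mono[OF e, of "2 * \<bar>x0\<bar>"] by (simp add: mult_ac)
    finally have "norm (?F (G w) - G (R w)) \<le> 2 * \<bar>x0\<bar> * (M * cmod w ^ (2 * m + 2))"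
      using norm_vec2_le[of "?F (G w) - G (R w)"] F1 by simp
    then have "1 / c * norm (?F (G w) - G (R w)) \<le> 1 / c * (2 * \<bar>x0\<bar> * (M * cmod w ^ (2 * m + 2)))"
      using c by (intro mult_left_mono) auto
    moreover have "cmod (f w - R w) \<le> 1 / c * norm (?F (G w) - G (R w))"
      unfolding f_def by (rule \<zeta>lip[OF sub(2)[OF w]]) (simp add: Rnorm sub(3)[OF w])
    ultimately have "cmod (f w - R w) \<le> 1 / c * (2 * \<bar>x0\<bar> * (M * cmod w ^ (2 * m + 2)))"
      by linarith
    then show ?thesis by (simp only: R_def mult.assoc)
  qed
  have West: "\<bar>W w' - W w - ((cmod w')\<^sup>2 - (cmod w)\<^sup>2)\<bar> \<le> 1 / 4 * max (cmod w) (cmod w') * cmod (w' - w)"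
    if "cmod w < \<rho>" "cmod w' < \<rho>" for w w'
    using rW(2)[OF sub(5)[OF that(2)] sub(5)[OF that(1)]] by (simp add: algebra_simps max.commute)
  have Winv: "W (f w) = W w" if "cmod w < \<rho>" "cmod (f w) < \<rho>" for w
    using inv[OF sub(4)[OF that(1)]] sub(4)[OF that(2)] by (simp add: W_def Gf[OF that(1)])
  from twist_periodic[OF \<rho> fcont m \<omega> fest West Winv] obtain N where N: "odd N"
    "infinite {w. (\<forall>j. cmod ((f ^^ j) w) < \<rho>) \<and> (f ^^ N) w = w}" (is "infinite ?P") by blast
  \<comment> \<open>A periodic point of \<open>f\<close> gives, through the injective
    \<open>G\<close>, two consecutive terms of a cycle, and each term has only finitely many
    possible values.\<close>
  define T where "T j = {x j |x. QRT_cycle A B C N x}" for j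
  have "finite (T j)" for j
    unfolding T_def by (rule finite_QRT_cycles) (use N(1) C odd_power_neq_1 in \<open>auto simp: odd_pos\<close>)
  then have "finite ((\<lambda>(x, y). vector [x, y] :: real^2) ` (T 0 \<times> T 1))" by blast
  moreover have "G ` ?P \<subseteq> (\<lambda>(x, y). vector [x, y] :: real^2) ` (T 0 \<times> T 1)"
  proof
    fix z assume "z \<in> G ` ?P"
    then obtain w where w: "z = G w" "\<And>j. cmod ((f ^^ j) w) < \<rho>" "(f ^^ N) w = w" by blast
    define x where "x j = G ((f ^^ j) w) $ 1" for j
    have x1: "x (Suc j) = G ((f ^^ j) w) $ 2" for j by (simp add: x_def Gf[OF w(2)])
    have "QRT_cycle A B C N x"
      unfolding QRT_cycle_def
    proof (intro allI conjI)
      fix i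
      show "x (i + N) = x i" by (simp add: x_def funpow_add w(3))
      have "x (Suc (Suc i)) = G (f ((f ^^ i) w)) $ 2" unfolding x1 by simp
      also have "\<dots> = (A + B * x (Suc i) + C * (x (Suc i))\<^sup>2) / x i"
        unfolding Gf[OF w(2)] F_map_nth x1 by (simp add: x_def)
      finally show "x i * x (i + 2) = A + B * x (i + 1) + C * (x (i + 1))\<^sup>2"
        using G1[OF sub(1)[OF w(2)[of i]]] by (simp add: x_def[symmetric])
    qed
    then have "x 0 \<in> T 0" "x 1 \<in> T 1" unfolding T_def by blast+
    moreover have "z = vector [x 0, x 1]"
      using x1[of 0] by (simp add: vec2_eq_iff w(1) x_def)
    ultimately show "z \<in> (\<lambda>(x, y). vector [x, y] :: real^2) ` (T 0 \<times> T 1)" by force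
  qed
  ultimately have "finite (G ` ?P)" by (rule finite_subset[rotated])
  moreover have "inj_on G ?P"
  proof (rule inj_on_subset[OF Ginj], rule subsetI)
    fix w assume "w \<in> ?P"
    then have "cmod ((f ^^ 0) w) < \<rho>" by blast
    then show "w \<in> ball 0 r0" using sub(3)[of w] by simp
  qed
  ultimately show False using N(2) finite_imageD by blast
qed

section \<open>The Hessian of a first integral\<close>

lemma vec2_axis: "(v :: real^2) = v$1 *\<^sub>R axis 1 1 + v$2 *\<^sub>R axis 2 1"
  by (simp add: vec2_eq_iff axis_def)

text \<open>The derivative along \<open>d\<close> of the derivative along \<open>v\<close>. The four
  entries are kept apart because symmetry of the matrix is only proved below.\<close>

definition hform :: "real^2^2 \<Rightarrow> real^2 \<Rightarrow> real^2 \<Rightarrow> real" where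
  "hform h d v = d$1 * v$1 * h$1$1 + d$1 * v$2 * h$1$2 + d$2 * v$1 * h$2$1 + d$2 * v$2 * h$2$2"

lemma gradient_expansion:
  fixes V :: "real^2 \<Rightarrow> real"
  assumes U: "open U" "p \<in> U" and Ck: "Ck_on (Suc (Suc n)) V U"
    and crit: "(V has_derivative (\<lambda>_. 0)) (at p)" and e: "0 < \<epsilon>"
  shows "\<exists>r>0. ball p r \<subseteq> U \<and> (\<forall>d v. norm d < r \<longrightarrow>
     \<bar>frechet_derivative V (at (p + d)) v - hform (hessian V p) d v\<bar> \<le> \<epsilon> * norm d * norm v)"
proof -
  let ?g = "\<lambda>j x. frechet_derivative V (at x) (axis j 1)"
  have V: "V differentiable (at x)" if "x \<in> U" for x using Ck that by simp
  have g0: "?g j p = 0" for j using frechet_derivative_at[OF crit] by metis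
  have "\<exists>r>0. \<forall>d. norm d < r \<longrightarrow> \<bar>?g j (p + d) - (d$1 * hessian V p $ 1 $ j
      + d$2 * hessian V p $ 2 $ j)\<bar> \<le> \<epsilon> / 2 * norm d" for j
  proof -
    have "?g j differentiable (at p)" using Ck U(2) by simp
    then have D: "(?g j has_derivative frechet_derivative (?g j) (at p)) (at p)"
      by (simp add: frechet_derivative_works)
    then have lin: "linear (frechet_derivative (?g j) (at p))" by (rule has_derivative_linear)
    have val: "frechet_derivative (?g j) (at p) d = d$1 * hessian V p $ 1 $ j + d$2 * hessian V p $ 2 $ j" for d
      by (subst vec2_axis[of d]) (simp add: linear_add[OF lin] linear_scale[OF lin] hessian_def)
    from D e obtain r where r: "0 < r" "\<And>y. norm (y - p) < r \<Longrightarrow>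
        norm (?g j y - ?g j p - frechet_derivative (?g j) (at p) (y - p)) \<le> \<epsilon> / 2 * norm (y - p)"
      unfolding has_derivative_at_alt by (metis half_gt_zero)
    have "\<bar>?g j (p + d) - (d$1 * hessian V p $ 1 $ j + d$2 * hessian V p $ 2 $ j)\<bar> \<le> \<epsilon> / 2 * norm d"
      if "norm d < r" for d
      using r(2)[of "p + d"] that by (simp add: g0 val)
    with r(1) show ?thesis by blast
  qed
  then obtain r where r: "\<And>j. 0 < r j" "\<And>j d. norm d < r j \<Longrightarrow>
      \<bar>?g j (p + d) - (d$1 * hessian V p $ 1 $ j + d$2 * hessian V p $ 2 $ j)\<bar> \<le> \<epsilon> / 2 * norm d" by metis
  from U obtain r0 where r0: "0 < r0" "ball p r0 \<subseteq> U" by (meson open_contains_ball)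
  define s where "s = min r0 (min (r 1) (r 2))"
  have s: "0 < s" "ball p s \<subseteq> U" using r0 r(1) by (auto simp: s_def)
  have "\<bar>frechet_derivative V (at (p + d)) v - hform (hessian V p) d v\<bar> \<le> \<epsilon> * norm d * norm v"
    if d: "norm d < s" for d v
  proof -
    have "p + d \<in> U" using d s(2) by (auto simp: dist_norm)
    then have "linear (frechet_derivative V (at (p + d)))"
      using V by (simp add: linear_frechet_derivative)
    then have "frechet_derivative V (at (p + d)) v = v$1 * ?g 1 (p + d) + v$2 * ?g 2 (p + d)"
      by (subst vec2_axis[of v]) (simp add: linear_add linear_scale)
    then have "frechet_derivative V (at (p + d)) v - hform (hessian V p) d v =
        v$1 * (?g 1 (p + d) - (d$1 * hessian V p $ 1 $ 1 + d$2 * hessian V p $ 2 $ 1))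
        + v$2 * (?g 2 (p + d) - (d$1 * hessian V p $ 1 $ 2 + d$2 * hessian V p $ 2 $ 2))"
      by (simp add: hform_def algebra_simps)
    also have "\<bar>\<dots>\<bar> \<le> \<bar>v$1\<bar> * \<bar>?g 1 (p + d) - (d$1 * hessian V p $ 1 $ 1 + d$2 * hessian V p $ 2 $ 1)\<bar>
        + \<bar>v$2\<bar> * \<bar>?g 2 (p + d) - (d$1 * hessian V p $ 1 $ 2 + d$2 * hessian V p $ 2 $ 2)\<bar>"
      unfolding abs_mult[symmetric] by (rule abs_triangle_ineq)
    also have "\<dots> \<le> norm v * (\<epsilon> / 2 * norm d) + norm v * (\<epsilon> / 2 * norm d)"
      using d e by (intro add_mono mult_mono component_le_norm_cart r(2)) (auto simp: s_def)
    finally show ?thesis by simp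
  qed
  with s show ?thesis by blast
qed

lemma hform_add_left: "hform h (a + b) v = hform h a v + hform h b v"
  and hform_scale_left: "hform h (c *\<^sub>R a) v = c * hform h a v"
  by (simp_all add: hform_def algebra_simps)

text \<open>Mean value theorem on the segment from \<open>p + a\<close> to \<open>p + a + b\<close>.
  The point is the factor \<open>norm b\<close> in the error: expanding separately at both ends
  would not make the error small for nearby points.\<close>

lemma second_order_increment:
  fixes V :: "real^2 \<Rightarrow> real"
  assumes U: "open U" "p \<in> U" and Ck: "Ck_on (Suc (Suc n)) V U"
    and crit: "(V has_derivative (\<lambda>_. 0)) (at p)" and e: "0 < \<epsilon>"
  defines "h \<equiv> hessian V p"
  shows "\<exists>r>0. \<forall>a b. norm a + norm b < r \<longrightarrow>
     \<bar>V (p + a + b) - V (p + a) - hform h a b - hform h b b / 2\<bar> \<le> \<epsilon> * (norm a + norm b) * norm b"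
proof -
  from gradient_expansion[OF U Ck crit e] obtain r where r: "0 < r" "ball p r \<subseteq> U"
    "\<And>d v. norm d < r \<Longrightarrow> \<bar>frechet_derivative V (at (p + d)) v - hform h d v\<bar> \<le> \<epsilon> * norm d * norm v"
    unfolding h_def by blast
  have "\<bar>V (p + a + b) - V (p + a) - hform h a b - hform h b b / 2\<bar> \<le> \<epsilon> * (norm a + norm b) * norm b"
    if ab: "norm a + norm b < r" for a b
  proof -
    define \<phi> where "\<phi> s = V (p + (a + s *\<^sub>R b)) - s * hform h a b - s\<^sup>2 / 2 * hform h b b" for s :: real
    have nrm: "norm (a + s *\<^sub>R b) \<le> norm a + norm b" if "0 \<le> s" "s \<le> 1" for s
    proof -
      have "norm (a + s *\<^sub>R b) \<le> norm a + \<bar>s\<bar> * norm b" by (metis norm_scaleR norm_triangle_ineq)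
      also have "\<bar>s\<bar> * norm b \<le> 1 * norm b" using that by (intro mult_right_mono) auto
      finally show ?thesis by simp
    qed
    have der: "DERIV \<phi> s :> frechet_derivative V (at (p + (a + s *\<^sub>R b))) b - hform h (a + s *\<^sub>R b) b"
      if s: "0 \<le> s" "s \<le> 1" for s
    proof -
      have "dist p (p + x) = norm x" for x :: "real^2" by (simp add: dist_norm)
      then have "p + (a + s *\<^sub>R b) \<in> ball p r" using nrm[OF s] ab by simp
      then have "p + (a + s *\<^sub>R b) \<in> U" using r(2) by blast
      then have "V differentiable (at (p + (a + s *\<^sub>R b)))" using Ck by simp
      then have D: "(V has_derivative frechet_derivative V (at (p + (a + s *\<^sub>R b)))) (at (p + (a + s *\<^sub>R b)))"
        by (simp add: frechet_derivative_works)
      have "((\<lambda>s. p + (a + s *\<^sub>R b)) has_derivative (\<lambda>ds. ds *\<^sub>R b)) (at s)"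
        by (auto intro!: derivative_eq_intros)
      from has_derivative_compose[OF this D]
      have "((\<lambda>s. V (p + (a + s *\<^sub>R b))) has_derivative (\<lambda>ds. frechet_derivative V (at (p + (a
          + s *\<^sub>R b))) (ds *\<^sub>R b))) (at s)" .
      then have "DERIV (\<lambda>s. V (p + (a + s *\<^sub>R b))) s :> frechet_derivative V (at (p + (a + s *\<^sub>R b))) b"
        using linear_scale[OF has_derivative_linear[OF D]]
        by (simp add: has_field_derivative_def mult.commute[of _ "frechet_derivative _ _ _"])
      then show ?thesis
        unfolding \<phi>_def hform_add_left hform_scale_left by (auto intro!: derivative_eq_intros)
    qed
    from MVT2[of 0 1 \<phi>, OF _ der] obtain z where z: "0 < z" "z < 1"
      "\<phi> 1 - \<phi> 0 = frechet_derivative V (at (p + (a + z *\<^sub>R b))) b - hform h (a + z *\<^sub>R b) b" by auto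
    have nz: "norm (a + z *\<^sub>R b) \<le> norm a + norm b" using nrm z by simp
    have "\<bar>\<phi> 1 - \<phi> 0\<bar> \<le> \<epsilon> * norm (a + z *\<^sub>R b) * norm b"
      unfolding z(3) by (rule r(3)) (use nz ab in simp)
    also have "\<dots> \<le> \<epsilon> * (norm a + norm b) * norm b"
      using nz e by (intro mult_right_mono mult_left_mono) auto
    also have "\<phi> 1 - \<phi> 0 = V (p + a + b) - V (p + a) - hform h a b - hform h b b / 2"
      by (simp add: \<phi>_def add.assoc)
    finally show ?thesis .
  qed
  with r(1) show ?thesis by blast
qed

text \<open>The corner \<open>p + a + b\<close> of a square is reached along two pairs of sides. The
  four increments have errors adding up to \<open>6 * \<epsilon> * s^2\<close>, half of what an
  asymmetry of \<open>12 * \<epsilon>\<close> would produce.\<close>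

lemma hessian_symmetric:
  fixes V :: "real^2 \<Rightarrow> real"
  assumes U: "open U" "p \<in> U" and Ck: "Ck_on (Suc (Suc n)) V U"
    and crit: "(V has_derivative (\<lambda>_. 0)) (at p)"
  shows "hessian V p $ 1 $ 2 = hessian V p $ 2 $ 1"
proof (rule ccontr)
  let ?h = "hessian V p"
  assume ne: "?h $ 1 $ 2 \<noteq> ?h $ 2 $ 1"
  define \<epsilon> where "\<epsilon> = \<bar>?h $ 1 $ 2 - ?h $ 2 $ 1\<bar> / 12"
  have e: "0 < \<epsilon>" using ne by (simp add: \<epsilon>_def)
  from second_order_increment[OF U Ck crit e] obtain r where r: "0 < r"
    "\<And>a b. norm a + norm b < r \<Longrightarrow>
     \<bar>V (p + a + b) - V (p + a) - hform ?h a b - hform ?h b b / 2\<bar> \<le> \<epsilon> * (norm a + norm b) * norm b" by blast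
  define s where "s = r / 3"
  have s: "0 < s" "2 * s < r" using r(1) by (auto simp: s_def)
  define a b :: "real^2" where "a = s *\<^sub>R axis 1 1" and "b = s *\<^sub>R axis 2 1"
  have nab: "norm a = s" "norm b = s" using s by (auto simp: a_def b_def norm_axis_1)
  have ab: "a$1 = s" "a$2 = 0" "b$1 = 0" "b$2 = s" by (simp_all add: a_def b_def axis_def)
  have "\<bar>V (p + 0 + a) - V (p + 0) - hform ?h 0 a - hform ?h a a / 2\<bar> \<le> \<epsilon> * (norm (0::real^2) + norm a) * norm a"
    "\<bar>V (p + 0 + b) - V (p + 0) - hform ?h 0 b - hform ?h b b / 2\<bar> \<le> \<epsilon> * (norm (0::real^2) + norm b) * norm b"
    "\<bar>V (p + a + b) - V (p + a) - hform ?h a b - hform ?h b b / 2\<bar> \<le> \<epsilon> * (norm a + norm b) * norm b"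
    "\<bar>V (p + b + a) - V (p + b) - hform ?h b a - hform ?h a a / 2\<bar> \<le> \<epsilon> * (norm b + norm a) * norm a"
    using s nab by (intro r(2); simp)+
  moreover have "p + b + a = p + a + b" by (simp add: algebra_simps)
  moreover have "hform ?h 0 a = 0" "hform ?h 0 b = 0" by (simp_all add: hform_def)
  ultimately have "\<bar>hform ?h a b - hform ?h b a\<bar> \<le> 6 * (\<epsilon> * s * s)" by (simp add: nab)
  also have "hform ?h a b - hform ?h b a = (?h $ 1 $ 2 - ?h $ 2 $ 1) * (s * s)"
    by (simp add: hform_def ab algebra_simps)
  also have "\<bar>(?h $ 1 $ 2 - ?h $ 2 $ 1) * (s * s)\<bar> = 12 * (\<epsilon> * s * s)"
    by (simp add: abs_mult \<epsilon>_def)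
  finally show False using e s by simp
qed

lemma second_order_limit:
  fixes V :: "real^2 \<Rightarrow> real" and \<delta> :: "real \<Rightarrow> real^2"
  assumes U: "open U" "p \<in> U" and Ck: "Ck_on (Suc (Suc n)) V U"
    and crit: "(V has_derivative (\<lambda>_. 0)) (at p)"
    and lim: "((\<lambda>s. (1 / s) *\<^sub>R \<delta> s) \<longlongrightarrow> e) (at_right 0)"
  shows "((\<lambda>s. (V (p + \<delta> s) - V p) / s\<^sup>2) \<longlongrightarrow> hform (hessian V p) e e / 2) (at_right 0)"
proof -
  let ?h = "hessian V p"
  have pos: "eventually (\<lambda>s::real. 0 < s) (at_right 0)" by (rule eventually_at_right_less)
  have "((\<lambda>s. s *\<^sub>R ((1 / s) *\<^sub>R \<delta> s)) \<longlongrightarrow> 0 *\<^sub>R e) (at_right 0)"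
    by (intro tendsto_scaleR lim tendsto_ident_at)
  moreover have "eventually (\<lambda>s. s *\<^sub>R ((1 / s) *\<^sub>R \<delta> s) = \<delta> s) (at_right 0)"
    using pos by eventually_elim simp
  ultimately have \<delta>0: "(\<delta> \<longlongrightarrow> 0) (at_right 0)" by (simp add: tendsto_cong)
  have "((\<lambda>s. (V (p + \<delta> s) - V p) / s\<^sup>2
      - hform ?h ((1 / s) *\<^sub>R \<delta> s) ((1 / s) *\<^sub>R \<delta> s) / 2) \<longlongrightarrow> 0) (at_right 0)"
  proof (rule tendstoI)
    fix \<epsilon> :: real assume e: "0 < \<epsilon>"
    define k where "k = \<epsilon> / (2 * (norm e + 1)\<^sup>2)"
    have ne: "0 < (norm e + 1)\<^sup>2" by (intro zero_less_power add_nonneg_pos) auto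
    have k: "0 < k" using e ne by (simp add: k_def)
    from second_order_increment[OF U Ck crit k] obtain r where r: "0 < r"
      "\<And>a b. norm a + norm b < r \<Longrightarrow>
       \<bar>V (p + a + b) - V (p + a) - hform ?h a b - hform ?h b b / 2\<bar> \<le> k * (norm a + norm b) * norm b" by blast
    have "eventually (\<lambda>s. norm (\<delta> s) < r) (at_right 0)"
      using tendstoD[OF \<delta>0 r(1)] by simp
    moreover have "eventually (\<lambda>s. norm ((1 / s) *\<^sub>R \<delta> s) < norm e + 1) (at_right 0)"
      by (rule order_tendstoD[OF tendsto_norm[OF lim]]) simp
    ultimately show "eventually (\<lambda>s. dist ((V (p + \<delta> s) - V p) / s\<^sup>2
        - hform ?h ((1 / s) *\<^sub>R \<delta> s) ((1 / s) *\<^sub>R \<delta> s) / 2) 0 < \<epsilon>) (at_right 0)"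
      using pos
    proof eventually_elim
      case (elim s)
      let ?u = "(1 / s) *\<^sub>R \<delta> s"
      have u: "\<delta> s = s *\<^sub>R ?u" using elim(3) by simp
      have "\<bar>V (p + 0 + \<delta> s) - V (p + 0) - hform ?h 0 (\<delta> s) - hform ?h (\<delta> s) (\<delta> s) / 2\<bar>
          \<le> k * (norm (0::real^2) + norm (\<delta> s)) * norm (\<delta> s)"
        using elim(1) by (intro r(2)) simp
      then have "\<bar>V (p + \<delta> s) - V p - hform ?h (\<delta> s) (\<delta> s) / 2\<bar> \<le> k * (norm (\<delta> s))\<^sup>2"
        by (simp add: hform_def power2_eq_square)
      also have "norm (\<delta> s) = s * norm ?u" using elim(3) by simp
      finally have "\<bar>V (p + \<delta> s) - V p - hform ?h (\<delta> s) (\<delta> s) / 2\<bar> \<le> s\<^sup>2 * (k * (norm ?u)\<^sup>2)"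
        by (simp only: power_mult_distrib mult_ac)
      moreover have "hform ?h (\<delta> s) (\<delta> s) = s\<^sup>2 * hform ?h ?u ?u"
        by (subst (1 2) u) (simp add: hform_def power2_eq_square algebra_simps)
      ultimately have "\<bar>V (p + \<delta> s) - V p - s\<^sup>2 * hform ?h ?u ?u / 2\<bar> / s\<^sup>2 \<le> s\<^sup>2 * (k
          * (norm ?u)\<^sup>2) / s\<^sup>2"
        by (intro divide_right_mono) auto
      then have "\<bar>V (p + \<delta> s) - V p - s\<^sup>2 * hform ?h ?u ?u / 2\<bar> / s\<^sup>2 \<le> k * (norm ?u)\<^sup>2"
        using elim(3) by simp
      moreover have "\<bar>V (p + \<delta> s) - V p - s\<^sup>2 * hform ?h ?u ?u / 2\<bar> / s\<^sup>2
          = \<bar>(V (p + \<delta> s) - V p) / s\<^sup>2 - hform ?h ?u ?u / 2\<bar>"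
      proof -
        have "(V (p + \<delta> s) - V p) / s\<^sup>2 - hform ?h ?u ?u / 2 = (V (p + \<delta> s) - V p - s\<^sup>2 * hform ?h ?u ?u / 2) / s\<^sup>2"
          using elim(3) by (simp add: diff_divide_distrib)
        then show ?thesis by (simp add: abs_divide)
      qed
      moreover have "k * (norm ?u)\<^sup>2 \<le> k * (norm e + 1)\<^sup>2"
        using elim(2) k by (intro mult_left_mono power_mono) auto
      moreover have "k * (norm e + 1)\<^sup>2 < \<epsilon>" using ne e by (simp add: k_def)
      ultimately show ?case by (simp only: dist_real_def diff_0_right)
    qed
  qed
  moreover have "((\<lambda>s. hform ?h ((1 / s) *\<^sub>R \<delta> s) ((1 / s) *\<^sub>R \<delta> s) / 2) \<longlongrightarrow> hform ?h e e / 2) (at_right 0)"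
    unfolding hform_def by (intro tendsto_intros lim) simp_all
  ultimately have "((\<lambda>s. ((V (p + \<delta> s) - V p) / s\<^sup>2 - hform ?h ((1 / s) *\<^sub>R \<delta> s) ((1 / s) *\<^sub>R \<delta> s) / 2)
      + hform ?h ((1 / s) *\<^sub>R \<delta> s) ((1 / s) *\<^sub>R \<delta> s) / 2) \<longlongrightarrow> 0 + hform ?h e e / 2) (at_right 0)"
    by (rule tendsto_add)
  then show ?thesis by simp
qed

text \<open>\<open>V\<close> takes the same values along a ray from \<open>p\<close> and along its
  image, so the two second-order limits coincide. The image has the tangent
  \<open>vector [\<eta>, t * \<eta> - \<xi>]\<close>, by the differential of the map.\<close>

lemma hessian_invariant:
  fixes A B C x0 t :: real and V :: "real^2 \<Rightarrow> real"
  assumes U: "open U" "p \<in> U" and Ck: "Ck_on (Suc (Suc n)) V U"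
    and crit: "(V has_derivative (\<lambda>_. 0)) (at p)"
    and inv: "\<And>x. x \<in> U \<Longrightarrow> F_map A B C x \<in> U \<Longrightarrow> V (F_map A B C x) = V x"
    and x0: "x0 \<noteq> 0" and fixp: "A + B * x0 + C * x0\<^sup>2 = x0\<^sup>2" and t: "t = B / x0 + 2 * C"
    and p: "p = vector [x0, x0]"
  shows "hform (hessian V p) (vector [\<eta>, t * \<eta> - \<xi>]) (vector [\<eta>, t * \<eta> - \<xi>])
       = hform (hessian V p) (vector [\<xi>, \<eta>]) (vector [\<xi>, \<eta>])"
proof -
  define e e' :: "real^2" where "e = vector [\<xi>, \<eta>]" and "e' = vector [\<eta>, t * \<eta> - \<xi>]"
  define \<delta> where "\<delta> s = F_map A B C (p + s *\<^sub>R e) - p" for s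
  have p12: "p $ 1 = x0" "p $ 2 = x0" by (simp_all add: p)
  have pos: "eventually (\<lambda>s::real. 0 < s) (at_right 0)" by (rule eventually_at_right_less)
  have l1: "((\<lambda>s. (1 / s) *\<^sub>R (s *\<^sub>R e)) \<longlongrightarrow> e) (at_right 0)"
  proof (rule Lim_transform_eventually)
    show "eventually (\<lambda>s. e = (1 / s) *\<^sub>R (s *\<^sub>R e)) (at_right 0)"
      using pos by eventually_elim simp
  qed simp
  have nz: "eventually (\<lambda>s. x0 + s * \<xi> \<noteq> 0) (at_right 0)"
  proof -
    have "((\<lambda>s. x0 + s * \<xi>) \<longlongrightarrow> x0 + 0 * \<xi>) (at_right 0)" by (intro tendsto_intros)
    then show ?thesis using x0 by (intro tendsto_imp_eventually_ne[of _ x0]) auto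
  qed
  have num: "B = (t - 2 * C) * x0" "A = x0\<^sup>2 - B * x0 - C * x0\<^sup>2" using x0 t fixp by (auto simp: field_simps)
  have l2: "((\<lambda>s. (1 / s) *\<^sub>R \<delta> s) \<longlongrightarrow> e') (at_right 0)"
  proof (rule vec_tendstoI)
    fix i :: 2
    show "((\<lambda>s. ((1 / s) *\<^sub>R \<delta> s) $ i) \<longlongrightarrow> e' $ i) (at_right 0)"
    proof (cases "i = 1")
      case True
      have "eventually (\<lambda>s. \<eta> = ((1 / s) *\<^sub>R \<delta> s) $ i) (at_right 0)"
        using pos by eventually_elim (simp add: True \<delta>_def e_def p12)
      from Lim_transform_eventually[OF tendsto_const this] show ?thesis
        by (simp add: True e'_def)
    next
      case False
      then have i: "i = 2" using exhaust_2 by blast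
      have L: "((\<lambda>s. (x0 * t * \<eta> + C * s * \<eta>\<^sup>2 - x0 * \<xi>) / (x0 + s * \<xi>)) \<longlongrightarrow>
          (x0 * t * \<eta> + C * 0 * \<eta>\<^sup>2 - x0 * \<xi>) / (x0 + 0 * \<xi>)) (at_right 0)"
        using x0 by (intro tendsto_intros) auto
      have v: "(x0 * t * \<eta> + C * 0 * \<eta>\<^sup>2 - x0 * \<xi>) / (x0 + 0 * \<xi>) = e' $ i"
        using x0 by (simp add: i e'_def field_simps)
      have ev: "eventually (\<lambda>s. (x0 * t * \<eta> + C * s * \<eta>\<^sup>2 - x0 * \<xi>) / (x0
          + s * \<xi>) = ((1 / s) *\<^sub>R \<delta> s) $ i) (at_right 0)"
        using pos nz
      proof eventually_elim
        case (elim s)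
        have "\<delta> s $ 2 = (A + B * (x0 + s * \<eta>) + C * (x0 + s * \<eta>)\<^sup>2) / (x0 + s * \<xi>) - x0"
          by (simp add: \<delta>_def e_def p12)
        also have "\<dots> = s * ((x0 * t * \<eta> + C * s * \<eta>\<^sup>2 - x0 * \<xi>) / (x0 + s * \<xi>))"
        proof -
          have "A + B * (x0 + s * \<eta>) + C * (x0 + s * \<eta>)\<^sup>2 - x0 * (x0 + s * \<xi>) = s * (x0 * t * \<eta>
              + C * s * \<eta>\<^sup>2 - x0 * \<xi>)"
            unfolding num by algebra
          then show ?thesis using elim(2) by (simp add: field_simps)
        qed
        finally show ?case using elim(1) by (simp add: i)
      qed
      show ?thesis using Lim_transform_eventually[OF L[unfolded v] ev] .
    qed
  qed
  note L1 = second_order_limit[OF U Ck crit l1] and L2 = second_order_limit[OF U Ck crit l2]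
  have "((\<lambda>s. s *\<^sub>R ((1 / s) *\<^sub>R \<delta> s)) \<longlongrightarrow> 0 *\<^sub>R e') (at_right 0)"
    by (intro tendsto_scaleR l2 tendsto_ident_at)
  moreover have "eventually (\<lambda>s. s *\<^sub>R ((1 / s) *\<^sub>R \<delta> s) = \<delta> s) (at_right 0)"
    using pos by eventually_elim simp
  ultimately have "(\<delta> \<longlongrightarrow> 0) (at_right 0)" by (simp add: tendsto_cong)
  then have "((\<lambda>s. p + \<delta> s) \<longlongrightarrow> p + 0) (at_right 0)" by (intro tendsto_intros)
  then have in1: "eventually (\<lambda>s. p + \<delta> s \<in> U) (at_right 0)" using U by (auto dest: topological_tendstoD)
  have "((\<lambda>s. p + s *\<^sub>R e) \<longlongrightarrow> p + 0 *\<^sub>R e) (at_right 0)" by (intro tendsto_intros)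
  then have in2: "eventually (\<lambda>s. p + s *\<^sub>R e \<in> U) (at_right 0)" using U by (auto dest: topological_tendstoD)
  have "eventually (\<lambda>s. (V (p + \<delta> s) - V p) / s\<^sup>2 = (V (p + s *\<^sub>R e) - V p) / s\<^sup>2) (at_right 0)"
    using in1 in2
  proof eventually_elim
    case (elim s)
    have "p + \<delta> s = F_map A B C (p + s *\<^sub>R e)" by (simp add: \<delta>_def)
    with inv[OF elim(2)] elim(1) show ?case by simp
  qed
  from Lim_transform_eventually[OF L2 this] L1
  have "hform (hessian V p) e' e' / 2 = hform (hessian V p) e e / 2"
    by (intro tendsto_unique[OF trivial_limit_at_right_real])
  then show ?thesis by (simp add: e_def e'_def)
qed

text \<open>Invariance on the two axes makes the Hessian form \<open>2 * a\<close> times the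
  elliptic form, and \<open>a \<noteq> 0\<close> by non-degeneracy. Increments of a quadratic form
  are exact, so the error is that of \<open>second_order_increment\<close>.\<close>

lemma first_integral_quadratic:
  fixes A B C x0 t :: real and V :: "real^2 \<Rightarrow> real"
  assumes U: "open U" "p \<in> U" and Ck: "Ck_on (Suc (Suc n)) V U"
    and crit: "(V has_derivative (\<lambda>_. 0)) (at p)" and det: "det (hessian V p) \<noteq> 0"
    and inv: "\<And>x. x \<in> U \<Longrightarrow> F_map A B C x \<in> U \<Longrightarrow> V (F_map A B C x) = V x"
    and x0: "x0 \<noteq> 0" and fixp: "A + B * x0 + C * x0\<^sup>2 = x0\<^sup>2" and t: "t = B / x0 + 2 * C" "t \<noteq> 0"
    and p: "p = vector [x0, x0]"
  shows "\<exists>a. a \<noteq> 0 \<and> (\<forall>\<epsilon>>0. \<exists>r>0. \<forall>d d'. norm d < r \<longrightarrow> norm d' < r \<longrightarrow>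
      \<bar>V (p + d') - V (p + d) - a * (elliptic_form t d' - elliptic_form t d)\<bar> \<le> \<epsilon> * max (norm d) (norm d') * norm (d' - d))"
proof -
  define h where "h = hessian V p"
  note hi = hessian_invariant[OF U Ck crit inv x0 fixp t(1) p, folded h_def]
  have sym: "h $ 1 $ 2 = h $ 2 $ 1" unfolding h_def by (rule hessian_symmetric[OF U Ck crit])
  \<comment> \<open>The variables of \<open>hi\<close> come in the order \<open>\<eta>\<close>,
    \<open>\<xi>\<close>: this is the vector \<open>(1, 0)\<close>, and the next use is
    \<open>(0, 1)\<close>.\<close>
  have h22: "h $ 2 $ 2 = h $ 1 $ 1" using hi[of 0 1] by (simp add: hform_def)
  have "t * (h $ 1 $ 1 * t + 2 * h $ 2 $ 1) = 0"
    using hi[of 1 0] by (simp add: hform_def sym h22 algebra_simps)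
  then have h21: "h $ 2 $ 1 = - (h $ 1 $ 1 * t) / 2" using t(2) by simp
  define a where "a = h $ 1 $ 1 / 2"
  have a: "a \<noteq> 0"
  proof
    assume "a = 0"
    then have "det h = 0" by (simp add: det_2 sym h21 a_def)
    with det show False by (simp add: h_def)
  qed
  have aq: "a * (elliptic_form t (d + b) - elliptic_form t d) = hform h d b + hform h b b / 2" for d b
    by (simp add: elliptic_form_def hform_def sym h21 h22 a_def power2_eq_square field_simps)
  have "\<exists>r>0. \<forall>d d'. norm d < r \<longrightarrow> norm d' < r \<longrightarrow>
      \<bar>V (p + d') - V (p + d) - a * (elliptic_form t d'
          - elliptic_form t d)\<bar> \<le> \<epsilon> * max (norm d) (norm d') * norm (d' - d)" if e: "0 < \<epsilon>" for \<epsilon>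
  proof -
    from second_order_increment[OF U Ck crit, of "\<epsilon> / 3", folded h_def] e obtain r where r: "0 < r"
      "\<And>a b. norm a + norm b < r \<Longrightarrow>
       \<bar>V (p + a + b) - V (p + a) - hform h a b - hform h b b / 2\<bar> \<le> \<epsilon> / 3 * (norm a + norm b) * norm b" by auto
    have "\<bar>V (p + d') - V (p + d) - a * (elliptic_form t d' - elliptic_form t d)\<bar> \<le> \<epsilon> * max (norm d) (norm d') * norm (d' - d)"
      if d: "norm d < r / 3" "norm d' < r / 3" for d d'
    proof -
      have tri: "norm (d' - d) \<le> norm d' + norm d" by (rule norm_triangle_ineq4)
      have "\<bar>V (p + d + (d' - d)) - V (p + d) - hform h d (d' - d) - hform h (d' - d) (d' - d) / 2\<bar>
          \<le> \<epsilon> / 3 * (norm d + norm (d' - d)) * norm (d' - d)"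
        by (rule r(2)) (use tri d in linarith)
      also have "\<dots> \<le> \<epsilon> / 3 * (3 * max (norm d) (norm d')) * norm (d' - d)"
        using tri e by (intro mult_right_mono mult_left_mono) auto
      finally show ?thesis using aq[of d "d' - d"] by (simp add: diff_diff_eq)
    qed
    with r(1) show ?thesis by (intro exI[of _ "r / 3"]) auto
  qed
  with a show ?thesis by blast
qed

section \<open>Elliptic fixed points\<close>

lemma F_map_has_derivative:
  fixes A B C x0 t :: real
  assumes x0: "x0 \<noteq> 0" and fixp: "A + B * x0 + C * x0\<^sup>2 = x0\<^sup>2" and t: "t = B / x0 + 2 * C"
    and p: "p = vector [x0, x0]"
  shows "(F_map A B C has_derivative (\<lambda>d. vector [d$2, t * d$2 - d$1])) (at p)"
proof -
  have nth: "((\<lambda>z. z $ i) has_derivative (\<lambda>d. d $ i)) (at p)" for i :: 2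
    by (rule bounded_linear.has_derivative[OF bounded_linear_vec_nth]) simp
  have "((\<lambda>z. z$2 *\<^sub>R (axis 1 1 :: real^2) + ((A + B * z$2 + C * (z$2)\<^sup>2) / z$1) *\<^sub>R axis 2 1) has_derivative
      (\<lambda>d. d$2 *\<^sub>R (axis 1 1 :: real^2) + (t * d$2 - d$1) *\<^sub>R axis 2 1)) (at p)"
  proof (intro has_derivative_add has_derivative_scaleR_left nth)
    have N: "((\<lambda>z. A + B * z$2 + C * (z$2)\<^sup>2) has_derivative (\<lambda>d. B * d$2 + C * (2 * (p$2 * d$2)))) (at p)"
      unfolding power2_eq_square
      by (rule has_derivative_eq_rhs, (rule has_derivative_add has_derivative_const has_derivative_mult nth)+)
        (simp add: fun_eq_iff algebra_simps)
    from has_derivative_divide'[OF N nth[of 1]] x0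
    have "((\<lambda>z. (A + B * z$2 + C * (z$2)\<^sup>2) / z$1) has_derivative
        (\<lambda>d. ((B * d$2 + C * (2 * (p$2 * d$2))) * p$1 - (A + B * p$2 + C * (p$2)\<^sup>2) * d$1) / (p$1 * p$1))) (at p)"
      by (simp add: p)
    moreover have "((B * d$2 + C * (2 * (p$2 * d$2))) * p$1 - (A + B * p$2 + C * (p$2)\<^sup>2) * d$1) / (p$1 * p$1)
        = t * d$2 - d$1" for d :: "real^2"
    proof -
      have p12: "p$1 = x0" "p$2 = x0" by (simp_all add: p)
      show ?thesis unfolding p12 fixp t using x0 by (simp add: field_simps power2_eq_square)
    qed
    ultimately show "((\<lambda>z. (A + B * z$2 + C * (z$2)\<^sup>2) / z$1) has_derivative (\<lambda>d. t * d$2 - d$1)) (at p)"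
      by simp
  qed
  moreover have "z$2 *\<^sub>R (axis 1 1 :: real^2) + ((A + B * z$2 + C * (z$2)\<^sup>2) / z$1) *\<^sub>R axis 2 1 = F_map A B C z" for z
    by (simp add: vec2_eq_iff axis_def)
  moreover have "d$2 *\<^sub>R (axis 1 1 :: real^2) + (t * d$2 - d$1) *\<^sub>R axis 2 1 = vector [d$2, t * d$2 - d$1]" for d :: "real^2"
    by (simp add: vec2_eq_iff axis_def)
  ultimately show ?thesis by simp
qed

text \<open>Fixed points lie on the diagonal because the first coordinate of the image is
  \<open>y\<close>. The eigenvalue satisfies \<open>\<mu>^2 - t * \<mu> + 1 = 0\<close>, so
  \<open>t = 2 cos \<theta>\<close>, and the excluded values of \<open>t\<close> are the traces for
  \<open>\<mu>\<close> of order 3, 4 and 5.\<close>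

lemma elliptic_F_map:
  fixes A B C :: real
  assumes "elliptic_fixed_point F_dom (F_map A B C) p" and nr: "\<not> resonant 5 (F_map A B C) p"
  obtains x0 t \<theta> :: real where "x0 \<noteq> 0" "A + B * x0 + C * x0\<^sup>2 = x0\<^sup>2" "t = B / x0 + 2 * C"
    "t = 2 * cos \<theta>" "sin \<theta> \<noteq> 0" "t \<noteq> -1" "t \<noteq> 0" "t\<^sup>2 + t - 1 \<noteq> 0" "p = vector [x0, x0]"
proof -
  let ?F = "F_map A B C"
  let ?M = "jacobian ?F (at p)"
  from assms(1) obtain \<mu> where dom: "p \<in> F_dom" and Fp: "?F p = p"
    and \<mu>: "cmod \<mu> = 1" "\<mu> \<noteq> 1" "\<mu> \<noteq> -1" and ev: "{\<nu>. complex_eigenvalue ?M \<nu>} = {\<mu>, cnj \<mu>}"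
    unfolding elliptic_fixed_point_def by blast
  define x0 where "x0 = p$1"
  have x0: "x0 \<noteq> 0" using dom by (simp add: F_dom_def x0_def)
  have p2: "p$2 = x0" using arg_cong[OF Fp, of "\<lambda>z. z$1"] by (simp add: x0_def)
  have p: "p = vector [x0, x0]" by (simp add: vec2_eq_iff p2 x0_def[symmetric])
  have "(A + B * x0 + C * x0\<^sup>2) / x0 = x0"
    using arg_cong[OF Fp, of "\<lambda>z. z$2"] by (simp add: p2 x0_def[symmetric])
  then have fixp: "A + B * x0 + C * x0\<^sup>2 = x0\<^sup>2" using x0 by (simp add: field_simps power2_eq_square)
  define t where "t = B / x0 + 2 * C"
  have "frechet_derivative ?F (at p) = (\<lambda>d. vector [d$2, t * d$2 - d$1])"
    using frechet_derivative_at[OF F_map_has_derivative[OF x0 fixp t_def p]] by simp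
  then have M: "?M $ 1 $ 1 = 0" "?M $ 1 $ 2 = 1" "?M $ 2 $ 1 = -1" "?M $ 2 $ 2 = t"
    by (simp_all add: jacobian_def matrix_def axis_def)
  have eig: "complex_eigenvalue ?M \<mu>" using ev by blast
  then obtain v :: "complex^2" where v: "v \<noteq> 0" "map_matrix complex_of_real ?M *v v = \<mu> *s v"
    unfolding complex_eigenvalue_def by blast
  have v2: "v$2 = \<mu> * v$1"
    using arg_cong[OF v(2), of "\<lambda>z. z$1"] by (simp add: matrix_vector_mult_def sum_2 M map_matrix_def)
  have "- v$1 + of_real t * v$2 = \<mu> * v$2"
    using arg_cong[OF v(2), of "\<lambda>z. z$2"] by (simp add: matrix_vector_mult_def sum_2 M map_matrix_def)
  then have "v$1 * (\<mu>\<^sup>2 - of_real t * \<mu> + 1) = 0" unfolding v2 by algebra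
  moreover have "v$1 \<noteq> 0" using v(1) v2 by (auto simp: vec2_eq_iff)
  ultimately have char: "\<mu>\<^sup>2 - of_real t * \<mu> + 1 = 0" by simp
  define \<theta> where "\<theta> = Arg \<mu>"
  have \<mu>0: "\<mu> \<noteq> 0" using \<mu>(1) by auto
  have cis: "\<mu> = cis \<theta>" using cis_Arg[OF \<mu>0] \<mu>(1) by (simp add: \<theta>_def sgn_eq)
  have "cnj \<mu> * (\<mu>\<^sup>2 - of_real t * \<mu> + 1) = \<mu> - of_real t + cnj \<mu>"
  proof -
    have "cnj \<mu> * \<mu> = 1" using \<mu>(1) by (metis complex_norm_square mult.commute of_real_1 one_power2)
    then show ?thesis by algebra
  qed
  with char have "of_real t = \<mu> + cnj \<mu>" by algebra
  then have t\<theta>: "t = 2 * cos \<theta>" by (simp add: cis complex_eq_iff)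
  have s: "sin \<theta> \<noteq> 0"
  proof
    assume s0: "sin \<theta> = 0"
    then have "cos \<theta> = 1 \<or> cos \<theta> = -1" by (rule sin_zero_abs_cos_one[THEN abs_eq_iff'[THEN iffD1, THEN conjunct2]])
    with s0 \<mu>(2,3) show False by (auto simp: cis complex_eq_iff)
  qed
  have res: "\<mu> ^ l \<noteq> 1" if "0 < l" "l \<le> 5" for l
    using nr eig that unfolding resonant_def by blast
  have "t \<noteq> -1"
  proof
    assume "t = -1"
    with char have "\<mu>\<^sup>2 + \<mu> + 1 = 0" by simp
    then have "\<mu> ^ 3 = 1" by algebra
    with res[of 3] show False by simp
  qed
  moreover have "t \<noteq> 0"
  proof
    assume "t = 0"
    with char have "\<mu>\<^sup>2 + 1 = 0" by simp
    then have "\<mu> ^ 4 = 1" by algebra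
    with res[of 4] show False by simp
  qed
  moreover have "t\<^sup>2 + t - 1 \<noteq> 0"
  proof
    assume "t\<^sup>2 + t - 1 = 0"
    then have "complex_of_real (t\<^sup>2 + t - 1) = 0" by simp
    then have "(of_real t)\<^sup>2 + of_real t - 1 = (0::complex)" by simp
    \<comment> \<open>Since \<open>t = \<mu> + 1 / \<mu>\<close>, multiplying
      \<open>t^2 + t - 1\<close> by \<open>\<mu>^2\<close> gives the fifth cyclotomic
      polynomial.\<close>
    with char have "\<mu> ^ 5 = 1" by algebra
    with res[of 5] show False by simp
  qed
  ultimately show thesis using that x0 fixp t_def t\<theta> s p by blast
qed

section \<open>The integrable case\<close>

lemma Ck_on_cong:
  assumes "open U" "\<And>x. x \<in> U \<Longrightarrow> f x = g x" "Ck_on k f U"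
  shows "Ck_on k g U"
  using assms(2,3)
proof (induction k arbitrary: f g)
  case 0
  then show ?case by (metis Ck_on.simps(1) continuous_on_cong)
next
  case (Suc k)
  have D: "(g has_derivative frechet_derivative f (at x)) (at x)" if "x \<in> U" for x
  proof (rule has_derivative_transform_within_open[OF _ assms(1) that])
    show "(f has_derivative frechet_derivative f (at x)) (at x)"
      using Suc.prems(2) that by (simp add: frechet_derivative_works)
  qed (use Suc.prems(1) in auto)
  have "Ck_on k (\<lambda>x. frechet_derivative g (at x) v) U" for v
  proof (rule Suc.IH)
    show "Ck_on k (\<lambda>x. frechet_derivative f (at x) v) U" using Suc.prems(2) by simp
    show "frechet_derivative f (at x) v = frechet_derivative g (at x) v" if "x \<in> U" for x
      using frechet_derivative_at[OF D[OF that]] by simp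
  qed
  with D show ?case by (auto simp: differentiable_def)
qed

text \<open>Replaces the chosen \<open>frechet_derivative\<close> by an explicit formula
  \<open>D\<close>, so that the rules below can recurse on it.\<close>

lemma Ck_on_SucI:
  assumes "open U" "\<And>x. x \<in> U \<Longrightarrow> (f has_derivative D x) (at x)" "\<And>v. Ck_on k (\<lambda>x. D x v) U"
  shows "Ck_on (Suc k) f U"
proof -
  have "Ck_on k (\<lambda>x. frechet_derivative f (at x) v) U" for v
    by (rule Ck_on_cong[OF assms(1) _ assms(3)[of v]]) (metis assms(2) frechet_derivative_at)
  with assms(2) show ?thesis by (auto simp: differentiable_def)
qed

lemma Ck_on_Suc_imp: "Ck_on (Suc k) f U \<Longrightarrow> Ck_on k f U"
proof (induction k arbitrary: f)
  case 0
  then show ?case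
    by (auto intro!: differentiable_imp_continuous_on simp: differentiable_on_def differentiable_at_withinI)
qed auto

lemma Ck_on_has_derivative:
  "Ck_on (Suc k) f U \<Longrightarrow> x \<in> U \<Longrightarrow> (f has_derivative frechet_derivative f (at x)) (at x)"
  by (simp add: frechet_derivative_works)

lemma Ck_on_const: "open U \<Longrightarrow> Ck_on k (\<lambda>x. c) U"
proof (induction k arbitrary: c)
  case (Suc k)
  show ?case by (rule Ck_on_SucI[where D = "\<lambda>_ _. 0"]) (use Suc in auto)
qed simp

lemma Ck_on_nth: "open U \<Longrightarrow> Ck_on k (\<lambda>x :: real^'n. x $ i) U"
proof (cases k)
  case (Suc l)
  assume "open U"
  then show ?thesis unfolding Suc
    by (intro Ck_on_SucI[where D = "\<lambda>_ d. d $ i"] Ck_on_const)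
      (auto intro: bounded_linear_imp_has_derivative bounded_linear_vec_nth)
qed (auto intro!: continuous_intros)

lemma Ck_on_add:
  assumes "open U" "Ck_on k f U" "Ck_on k g U" shows "Ck_on k (\<lambda>x. f x + g x) U"
  using assms(2,3)
proof (induction k arbitrary: f g)
  case (Suc k)
  show ?case
  proof (rule Ck_on_SucI[OF assms(1) has_derivative_add])
    show "(f has_derivative frechet_derivative f (at x)) (at x)"
      "(g has_derivative frechet_derivative g (at x)) (at x)" if "x \<in> U" for x
      using that Suc.prems by (simp_all add: frechet_derivative_works)
    show "Ck_on k (\<lambda>x. frechet_derivative f (at x) v + frechet_derivative g (at x) v) U" for v
      using Suc.prems by (intro Suc.IH) auto
  qed
qed (auto intro: continuous_on_add)

lemma Ck_on_mult:
  fixes f g :: "'a::euclidean_space \<Rightarrow> real"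
  assumes "open U" "Ck_on k f U" "Ck_on k g U" shows "Ck_on k (\<lambda>x. f x * g x) U"
  using assms(2,3)
proof (induction k arbitrary: f g)
  case (Suc k)
  show ?case
  proof (rule Ck_on_SucI[OF assms(1) has_derivative_mult])
    show "(f has_derivative frechet_derivative f (at x)) (at x)"
      "(g has_derivative frechet_derivative g (at x)) (at x)" if "x \<in> U" for x
      using that Suc.prems by (simp_all add: frechet_derivative_works)
    show "Ck_on k (\<lambda>x. f x * frechet_derivative g (at x) v + frechet_derivative f (at x) v * g x) U" for v
      using Suc.prems Ck_on_Suc_imp[OF Suc.prems(1)] Ck_on_Suc_imp[OF Suc.prems(2)]
      by (intro Ck_on_add[OF assms(1)] Suc.IH) auto
  qed
qed (auto intro: continuous_on_mult)

lemma Ck_on_inverse: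
  fixes f :: "'a::euclidean_space \<Rightarrow> real"
  assumes "open U" "\<And>x. x \<in> U \<Longrightarrow> f x \<noteq> 0" "Ck_on k f U" shows "Ck_on k (\<lambda>x. inverse (f x)) U"
  using assms(3)
proof (induction k)
  case 0
  then show ?case using assms(2) by (auto intro!: continuous_on_inverse)
next
  case (Suc k)
  show ?case
  proof (rule Ck_on_SucI[OF assms(1)])
    show "((\<lambda>x. inverse (f x)) has_derivative
        (\<lambda>v. (-1) * (inverse (f x) * frechet_derivative f (at x) v * inverse (f x)))) (at x)" if "x \<in> U" for x
      using Deriv.has_derivative_inverse[OF assms(2)[OF that] Ck_on_has_derivative[OF Suc.prems that]] by simp
    show "Ck_on k (\<lambda>x. (-1) * (inverse (f x) * frechet_derivative f (at x) v * inverse (f x))) U" for v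
    proof -
      have i: "Ck_on k (\<lambda>x. inverse (f x)) U" by (rule Suc.IH[OF Ck_on_Suc_imp[OF Suc.prems]])
      have d: "Ck_on k (\<lambda>x. frechet_derivative f (at x) v) U" using Suc.prems by simp
      show ?thesis by (intro Ck_on_mult[OF assms(1)] Ck_on_const[OF assms(1)] i d)
    qed
  qed
qed

section \<open>The rational first integral\<close>

definition QRT :: "real \<Rightarrow> real \<Rightarrow> real^2 \<Rightarrow> real" where
  "QRT A B z = ((z$1)\<^sup>2 + (z$2)\<^sup>2 + B * (z$1 + z$2) + A) / (z$1 * z$2)"

lemma open_off_axes: "open {z :: real^2. z$1 \<noteq> 0 \<and> z$2 \<noteq> 0}"
  by (intro open_Collect_conj open_Collect_neq continuous_intros)

lemma Ck_on_QRT: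
  assumes "open U" "U \<subseteq> {z. z$1 \<noteq> 0 \<and> z$2 \<noteq> 0}"
  shows "Ck_on k (QRT A B) U"
proof -
  have "Ck_on k (\<lambda>z :: real^2. (z$1 * z$1 + z$2 * z$2 + B * (z$1 + z$2) + A) * inverse (z$1 * z$2)) U"
    using assms(2)
    by (intro Ck_on_mult Ck_on_add Ck_on_inverse Ck_on_const Ck_on_nth assms(1)) auto
  then show ?thesis
    by (rule Ck_on_cong[OF assms(1), rotated]) (simp add: QRT_def divide_inverse power2_eq_square)
qed

text \<open>On a horizontal segment \<open>QRT A B z = c\<close> is a quadratic equation with
  leading coefficient 1, but the second difference \<open>2 * h^2\<close> of such a polynomial is
  not zero.\<close>

lemma QRT_locally_nonconstant:
  assumes "U \<subseteq> {z. z$1 \<noteq> 0 \<and> z$2 \<noteq> 0}"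
  shows "locally_nonconstant_on U (QRT A B)"
  unfolding locally_nonconstant_on_def
proof (intro allI impI notI)
  fix W assume W: "open W \<and> W \<noteq> {} \<and> W \<subseteq> U" and "QRT A B constant_on W"
  then obtain c where c: "\<And>z. z \<in> W \<Longrightarrow> QRT A B z = c" by (auto simp: constant_on_def)
  from W obtain z where z: "z \<in> W" by blast
  from W z obtain e where e: "0 < e" "ball z e \<subseteq> W" by (meson open_contains_ball)
  have eq: "(z$1 + d)\<^sup>2 + (z$2)\<^sup>2 + B * ((z$1 + d) + z$2) + A = c * ((z$1 + d) * z$2)" if "\<bar>d\<bar> < e" for d
  proof -
    let ?z = "z + d *\<^sub>R axis 1 1"
    have "?z \<in> W" using e(2) that by (auto simp: dist_norm norm_axis_1)
    then have *: "QRT A B ?z = c" "?z $ 1 \<noteq> 0" "?z $ 2 \<noteq> 0" using c W assms by blast+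
    have z: "?z $ 1 = z$1 + d" "?z $ 2 = z$2" by (simp_all add: axis_def)
    show ?thesis using * unfolding QRT_def z by (simp add: divide_eq_eq)
  qed
  define h where "h = e / 2"
  have h: "\<bar>h\<bar> < e" "\<bar>- h\<bar> < e" "\<bar>0\<bar> < e" "h \<noteq> 0" using e(1) by (simp_all add: h_def)
  define x y where "x = z$1" and "y = z$2"
  note eq' = eq[folded x_def y_def]
  have "2 * h\<^sup>2 = (((x + h)\<^sup>2 + y\<^sup>2 + B * ((x + h) + y) + A) - c * ((x + h) * y))
      + (((x + - h)\<^sup>2 + y\<^sup>2 + B * ((x + - h) + y) + A) - c * ((x + - h) * y))
      - 2 * (((x + 0)\<^sup>2 + y\<^sup>2 + B * ((x + 0) + y) + A) - c * ((x + 0) * y))"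
    by algebra
  also have "\<dots> = 0" unfolding eq'[OF h(1)] eq'[OF h(2)] eq'[OF h(3)] by simp
  finally show False using h(4) by simp
qed

text \<open>For fixed \<open>y\<close> a level curve is quadratic in \<open>x\<close>, and its two
  roots have the product \<open>A + B * y + y^2\<close>. So the map replaces \<open>x\<close> by the
  other root and then exchanges the coordinates, under which the function is symmetric.\<close>

lemma QRT_F_map:
  assumes "z$1 \<noteq> 0" "z$2 \<noteq> 0" "F_map A B 1 z $ 2 \<noteq> 0"
  shows "QRT A B (F_map A B 1 z) = QRT A B z"
proof -
  define x y w where "x = z$1" and "y = z$2" and "w = F_map A B 1 z $ 2"
  have nz: "x \<noteq> 0" "y \<noteq> 0" "w \<noteq> 0" using assms by (simp_all add: x_def y_def w_def)
  have xw: "x * w = A + B * y + y\<^sup>2" using nz(1) by (simp add: w_def x_def y_def)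
  have "(y\<^sup>2 + w\<^sup>2 + B * (y + w) + A) * (x * y) = (x\<^sup>2 + y\<^sup>2 + B * (x + y) + A) * (y * w)"
    using xw by algebra
  then have "(y\<^sup>2 + w\<^sup>2 + B * (y + w) + A) / (y * w) = (x\<^sup>2 + y\<^sup>2 + B * (x + y) + A) / (x * y)"
    using nz by (simp add: frac_eq_eq)
  moreover have "F_map A B 1 z $ 1 = y" by (simp add: y_def)
  ultimately show ?thesis unfolding QRT_def w_def[symmetric] x_def[symmetric] y_def[symmetric]
    by (simp add: y_def w_def)
qed

lemma first_integral_QRT:
  assumes "U \<subseteq> {z. z$1 \<noteq> 0 \<and> z$2 \<noteq> 0}"
  shows "first_integral F_dom (F_map A B 1) U (QRT A B)"
  unfolding first_integral_def
proof (intro conjI ballI impI)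
  show "U \<subseteq> F_dom" using assms by (auto simp: F_dom_def)
  show "locally_nonconstant_on U (QRT A B)" by (rule QRT_locally_nonconstant[OF assms])
  fix z assume z: "z \<in> U" "F_map A B 1 z \<in> U"
  then have "z \<in> {z. z$1 \<noteq> 0 \<and> z$2 \<noteq> 0}" "F_map A B 1 z \<in> {z. z$1 \<noteq> 0 \<and> z$2 \<noteq> 0}" using assms by blast+
  then show "QRT A B (F_map A B 1 z) = QRT A B z" by (intro QRT_F_map) auto
qed

text \<open>The image of the open disc is open by invariance of domain, and its frontier lies on the
  curve. So the component of the complement containing the centre cannot leave that image and is
  bounded.\<close>

lemma closed_curve_surrounding_image:
  fixes \<Gamma> :: "complex \<Rightarrow> real^2"
  assumes cont: "continuous_on (ball 0 \<rho>) \<Gamma>" and inj: "inj_on \<Gamma> (ball 0 \<rho>)" and r: "0 < r" "r < \<rho>"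
  shows "closed_curve_surrounding (\<Gamma> 0) (\<Gamma> ` sphere 0 r)"
proof -
  let ?c = "circlepath 0 r" and ?S = "\<Gamma> ` sphere 0 r" and ?I = "\<Gamma> ` ball 0 r"
  have im: "path_image ?c = sphere 0 r" using r by (simp add: path_image_circlepath)
  have sub: "cball 0 r \<subseteq> ball 0 \<rho>" "sphere 0 r \<subseteq> ball 0 \<rho>" "ball 0 r \<subseteq> ball 0 \<rho>" using r by auto
  have "simple_path (\<Gamma> \<circ> ?c)"
    using r sub(2) by (intro simple_path_continuous_image)
      (auto simp: im simple_path_circlepath intro: continuous_on_subset[OF cont] inj_on_subset[OF inj])
  moreover have "pathfinish (\<Gamma> \<circ> ?c) = pathstart (\<Gamma> \<circ> ?c)"
    by (simp add: pathfinish_compose pathstart_compose)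
  moreover have pi: "path_image (\<Gamma> \<circ> ?c) = ?S" using r by (simp add: path_image_compose)
  moreover have "\<Gamma> 0 \<in> inside ?S"
  proof -
    have disj: "?I \<inter> ?S = {}"
    proof -
      have "?I \<inter> ?S = \<Gamma> ` (ball 0 r \<inter> sphere 0 r)"
        by (rule inj_on_image_Int[OF inj sub(3) sub(2), symmetric])
      then show ?thesis by auto
    qed
    have p: "\<Gamma> 0 \<in> ?I" using r by auto
    have op: "open ?I"
      by (rule invariance_of_domain_gen)
        (use sub(3) in \<open>auto intro: continuous_on_subset[OF cont] inj_on_subset[OF inj]\<close>)
    have comp: "compact (\<Gamma> ` cball 0 r)"
      using sub(1) by (intro compact_continuous_image continuous_on_subset[OF cont]) auto
    have "closure ?I \<subseteq> \<Gamma> ` cball 0 r"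
      by (rule closure_minimal[OF _ compact_imp_closed[OF comp]]) auto
    moreover have "cball 0 r = ball 0 r \<union> sphere (0::complex) r" by auto
    then have "\<Gamma> ` cball 0 r = ?I \<union> ?S" by (simp only: image_Un)
    ultimately have fr: "frontier ?I \<subseteq> ?S"
      using op by (auto simp: frontier_def interior_open)
    let ?K = "connected_component_set (- ?S) (\<Gamma> 0)"
    have "?K \<subseteq> ?I"
    proof (rule ccontr)
      assume "\<not> ?K \<subseteq> ?I"
      then have "?K - ?I \<noteq> {}" by blast
      moreover have "\<Gamma> 0 \<in> ?K" using p disj by (auto simp: connected_component_refl_eq)
      then have "?K \<inter> ?I \<noteq> {}" using p by blast
      ultimately have "?K \<inter> frontier ?I \<noteq> {}"
        by (intro connected_Int_frontier) auto
      moreover have "?K \<subseteq> - ?S" by (rule connected_component_subset)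
      ultimately show False using fr by blast
    qed
    then have "bounded ?K"
      using bounded_subset[OF compact_imp_bounded[OF comp]] by (metis ball_subset_cball image_mono order_trans)
    then show ?thesis using p disj by (auto simp: inside_def)
  qed
  ultimately show ?thesis unfolding closed_curve_surrounding_def by (metis pi)
qed

text \<open>\<open>A = - B * x0\<close> is the fixed point equation for \<open>C = 1\<close>. In
  relative coordinates the integral is its critical value \<open>t\<close> plus the elliptic form
  over a positive factor near the fixed point.\<close>

lemma QRT_scaled:
  fixes A B x0 t u v :: real
  assumes x0: "x0 \<noteq> 0" and A: "A = - B * x0" and t: "t = B / x0 + 2"
    and z: "z$1 = x0 * (1 + u)" "z$2 = x0 * (1 + v)" and nz: "1 + u \<noteq> 0" "1 + v \<noteq> 0"
  shows "QRT A B z = t + (u\<^sup>2 - t * u * v + v\<^sup>2) / ((1 + u) * (1 + v))"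
proof -
  have B: "B = (t - 2) * x0" using x0 t by (simp add: field_simps)
  have "(x0 * (1 + u))\<^sup>2 + (x0 * (1 + v))\<^sup>2 + B * (x0 * (1 + u) + x0 * (1 + v)) + A
      = x0\<^sup>2 * (t * ((1 + u) * (1 + v)) + (u\<^sup>2 - t * u * v + v\<^sup>2))"
    unfolding A B by algebra
  then have "QRT A B z = (x0\<^sup>2 * (t * ((1 + u) * (1 + v)) + (u\<^sup>2 - t * u * v + v\<^sup>2))) / (x0\<^sup>2 * ((1 + u) * (1 + v)))"
    unfolding QRT_def z by (simp add: power2_eq_square mult_ac)
  also have "\<dots> = (t * ((1 + u) * (1 + v)) + (u\<^sup>2 - t * u * v + v\<^sup>2)) / ((1 + u) * (1 + v))"
    using x0 by simp
  also have "\<dots> = t + (u\<^sup>2 - t * u * v + v\<^sup>2) / ((1 + u) * (1 + v))"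
    using nz by (simp add: add_divide_distrib)
  finally show ?thesis .
qed

text \<open>
  The positive root \<open>k\<close> of \<open>k\<^sup>2 = (1 + k m) (1 + k n)\<close>: scaling by it turns the level ellipses
  of the quadratic form into the level curves of the first integral.
\<close>

definition radial_factor :: "real \<Rightarrow> real \<Rightarrow> real" where
  "radial_factor m n = (m + n + sqrt ((m - n)\<^sup>2 + 4)) / (2 * (1 - m * n))"

lemma radial_factor:
  fixes m n :: real
  assumes "m * n < 1"
  defines "k \<equiv> radial_factor m n"
  shows "0 < k" "k\<^sup>2 = (1 + k * m) * (1 + k * n)" "0 < 1 + k * m" "0 < 1 + k * n"
proof -
  define a S where "a = 1 - m * n" and "S = sqrt ((m - n)\<^sup>2 + 4)"
  have a: "0 < a" using assms by (simp add: a_def)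
  have S2: "S\<^sup>2 = (m + n)\<^sup>2 + 4 * a"
  proof -
    have "S\<^sup>2 = (m - n)\<^sup>2 + 4" by (simp add: S_def)
    then show ?thesis unfolding a_def by algebra
  qed
  have "(m + n)\<^sup>2 < S\<^sup>2" using S2 a by simp
  then have "\<bar>m + n\<bar> < S" by (metis S_def abs_le_square_iff abs_of_nonneg not_le real_sqrt_ge_zero add_nonneg_nonneg zero_le_power2 zero_le_numeral)
  then have pos: "0 < m + n + S" by linarith
  have ak: "2 * a * k = m + n + S" using a by (simp add: k_def radial_factor_def a_def S_def)
  have "a * (a * k\<^sup>2 - (m + n) * k - 1) = 0" using ak S2 by algebra
  then have q: "a * k\<^sup>2 = (m + n) * k + 1" using a by simp
  show k: "0 < k" using ak pos a by (metis mult_pos_pos zero_less_mult_pos zero_less_numeral)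
  show k2: "k\<^sup>2 = (1 + k * m) * (1 + k * n)" using q unfolding a_def by algebra
  \<comment> \<open>The two factors have positive product \<open>k^2\<close> and positive sum
    \<open>1 + a * k^2\<close>, so both are positive.\<close>
  have "0 < k\<^sup>2" using k by simp
  then have prod: "0 < (1 + k * m) * (1 + k * n)" using k2 by simp
  have "0 < a * k\<^sup>2" using a k by simp
  then have "0 < (1 + k * m) + (1 + k * n)" using q by (simp add: algebra_simps)
  with prod show "0 < 1 + k * m" "0 < 1 + k * n" by (auto simp: zero_less_mult_iff)
qed

definition QRTx :: "real \<Rightarrow> real \<Rightarrow> real^2 \<Rightarrow> real" where
  "QRTx A B z = ((z$1)\<^sup>2 - (z$2)\<^sup>2 - B * z$2 - A) / ((z$1)\<^sup>2 * z$2)"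

definition QRTy :: "real \<Rightarrow> real \<Rightarrow> real^2 \<Rightarrow> real" where
  "QRTy A B z = ((z$2)\<^sup>2 - (z$1)\<^sup>2 - B * z$1 - A) / (z$1 * (z$2)\<^sup>2)"

lemma nth_has_derivative: "((\<lambda>z :: real^2. z $ i) has_derivative (\<lambda>d. d $ i)) (at z)"
  by (rule bounded_linear_imp_has_derivative[OF bounded_linear_vec_nth])

lemma QRT_has_derivative:
  assumes "z$1 \<noteq> 0" "z$2 \<noteq> 0"
  shows "(QRT A B has_derivative (\<lambda>d. QRTx A B z * d$1 + QRTy A B z * d$2)) (at z)"
proof -
  have N: "((\<lambda>z :: real^2. z$1 * z$1 + z$2 * z$2 + B * (z$1 + z$2) + A) has_derivative
      (\<lambda>d. 2 * z$1 * d$1 + 2 * z$2 * d$2 + B * (d$1 + d$2))) (at z)"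
    by (rule has_derivative_eq_rhs,
        (rule has_derivative_add has_derivative_const has_derivative_mult nth_has_derivative)+)
      (simp add: fun_eq_iff algebra_simps)
  have M: "((\<lambda>z :: real^2. z$1 * z$2) has_derivative (\<lambda>d. z$1 * d$2 + d$1 * z$2)) (at z)"
    by (rule has_derivative_mult nth_has_derivative)+
  have "((\<lambda>z :: real^2. (z$1 * z$1 + z$2 * z$2 + B * (z$1 + z$2) + A) / (z$1 * z$2)) has_derivative
      (\<lambda>d. QRTx A B z * d$1 + QRTy A B z * d$2)) (at z)"
  proof (rule has_derivative_eq_rhs[OF has_derivative_divide'[OF N M]])
    show "z$1 * z$2 \<noteq> 0" using assms by simp
    show "(\<lambda>d. ((2 * z$1 * d$1 + 2 * z$2 * d$2 + B * (d$1 + d$2)) * (z$1 * z$2) -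
        (z$1 * z$1 + z$2 * z$2 + B * (z$1 + z$2) + A) * (z$1 * d$2 + d$1 * z$2)) / (z$1 * z$2 * (z$1 * z$2)))
        = (\<lambda>d. QRTx A B z * d$1 + QRTy A B z * d$2)"
      using assms by (simp add: fun_eq_iff QRTx_def QRTy_def field_simps power2_eq_square)
  qed
  moreover have "(\<lambda>z :: real^2. (z$1 * z$1 + z$2 * z$2 + B * (z$1 + z$2) + A) / (z$1 * z$2)) = QRT A B"
    by (simp add: fun_eq_iff QRT_def power2_eq_square)
  ultimately show ?thesis by simp
qed

lemma QRT_hessian_det:
  fixes A B x0 t :: real
  assumes x0: "x0 \<noteq> 0" and A: "A = - B * x0" and t: "t = B / x0 + 2" and p: "p = vector [x0, x0]"
  shows "det (hessian (QRT A B) p) = (4 - t\<^sup>2) / x0 ^ 4"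
proof -
  have p12: "p$1 = x0" "p$2 = x0" by (simp_all add: p)
  let ?O = "{z :: real^2. z$1 \<noteq> 0 \<and> z$2 \<noteq> 0}"
  have pO: "p \<in> ?O" using x0 by (simp add: p12)
  have fr: "frechet_derivative (QRT A B) (at z) (axis 1 1) = QRTx A B z"
    "frechet_derivative (QRT A B) (at z) (axis 2 1) = QRTy A B z" if "z \<in> ?O" for z
    using that frechet_derivative_at[OF QRT_has_derivative[of z A B], symmetric] by (simp_all add: axis_def)
  have sq: "((\<lambda>z :: real^2. z$i * z$i) has_derivative (\<lambda>d. z$i * d$i + d$i * z$i)) (at z)" for i z
    by (rule has_derivative_mult nth_has_derivative)+
  \<comment> \<open>The two partial derivatives differ by exchanging the coordinates, so one
    computation with indices \<open>i\<close> and \<open>j\<close> covers both.\<close>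
  have second: "((\<lambda>z :: real^2. (z$i * z$i - z$j * z$j - B * z$j - A) / (z$i * z$i * z$j)) has_derivative
      (\<lambda>d. (2 * d$i - t * d$j) / x0\<^sup>2)) (at p)" for i j
  proof (rule has_derivative_eq_rhs)
    have pij: "p$i = x0" "p$j = x0" using p12 exhaust_2 by metis+
    show "((\<lambda>z :: real^2. (z$i * z$i - z$j * z$j - B * z$j - A) / (z$i * z$i * z$j)) has_derivative
      (\<lambda>d. (((p$i * d$i + d$i * p$i) - (p$j * d$j + d$j * p$j) - (B * d$j + 0 * p$j) - 0) * (p$i * p$i * p$j)
        - (p$i * p$i - p$j * p$j - B * p$j - A) * (p$i * p$i * d$j + (p$i * d$i + d$i * p$i) * p$j))
        / ((p$i * p$i * p$j) * (p$i * p$i * p$j)))) (at p)"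
      by (intro has_derivative_divide' has_derivative_diff has_derivative_mult has_derivative_const
          nth_has_derivative sq) (use x0 in \<open>simp add: pij\<close>)
    show "(\<lambda>d. (((p$i * d$i + d$i * p$i) - (p$j * d$j + d$j * p$j) - (B * d$j + 0 * p$j) - 0) * (p$i * p$i * p$j)
        - (p$i * p$i - p$j * p$j - B * p$j - A) * (p$i * p$i * d$j + (p$i * d$i + d$i * p$i) * p$j))
        / ((p$i * p$i * p$j) * (p$i * p$i * p$j))) = (\<lambda>d. (2 * d$i - t * d$j) / x0\<^sup>2)"
      unfolding pij A t using x0 by (simp add: fun_eq_iff field_simps power2_eq_square)
  qed
  have tr: "frechet_derivative g (at p) = D"
    if "(f has_derivative D) (at p)" "\<And>z. z \<in> ?O \<Longrightarrow> f z = g z" for f g :: "real^2 \<Rightarrow> real" and D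
    using has_derivative_transform_within_open[OF that(1) open_off_axes pO that(2)]
    by (rule frechet_derivative_at[symmetric])
  have "frechet_derivative (\<lambda>z. frechet_derivative (QRT A B) (at z) (axis 1 1)) (at p) = (\<lambda>d. (2 * d$1 - t * d$2) / x0\<^sup>2)"
    by (rule tr[OF second]) (simp add: fr QRTx_def power2_eq_square)
  moreover have "frechet_derivative (\<lambda>z. frechet_derivative (QRT A B) (at z) (axis 2 1)) (at p) = (\<lambda>d. (2 * d$2
      - t * d$1) / x0\<^sup>2)"
    by (rule tr[OF second]) (simp add: fr QRTy_def power2_eq_square mult_ac)
  ultimately have H: "hessian (QRT A B) p $ 1 $ 1 = 2 / x0\<^sup>2" "hessian (QRT A B) p $ 1 $ 2 = - t / x0\<^sup>2"
    "hessian (QRT A B) p $ 2 $ 1 = - t / x0\<^sup>2" "hessian (QRT A B) p $ 2 $ 2 = 2 / x0\<^sup>2"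
    by (simp_all add: hessian_def axis_def)
  show ?thesis unfolding det_2 H using x0 by (simp add: field_simps power2_eq_square power4_eq_xxxx)
qed


text \<open>The sum of the two gradient equations is the line \<open>x + y = 2 * x0\<close>, their
  difference factors into \<open>x = y\<close> and a parallel line, which is distinct because
  \<open>t \<noteq> -2\<close>.\<close>

lemma QRT_critical_points:
  fixes A B x0 t :: real
  assumes x0: "x0 \<noteq> 0" and A: "A = - B * x0" and t: "t = B / x0 + 2" "t \<noteq> 2" "t \<noteq> -2"
    and p: "p = vector [x0, x0]" and U: "p \<in> U" "U \<subseteq> {z. z$1 \<noteq> 0 \<and> z$2 \<noteq> 0}"
  shows "critical_points U (QRT A B) = {p}"
proof -
  have B: "B = (t - 2) * x0" using x0 t(1) by (simp add: field_simps)
  have only: "z = p" if z: "z \<in> U" "(QRT A B has_derivative (\<lambda>_. 0)) (at z)" for z :: "real^2"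
  proof -
    define x y where "x = z$1" and "y = z$2"
    have nz: "x \<noteq> 0" "y \<noteq> 0" using z(1) U(2) by (auto simp: x_def y_def)
    have eq: "(\<lambda>_ :: real^2. 0) = (\<lambda>d. QRTx A B z * d$1 + QRTy A B z * d$2)"
      by (rule has_derivative_unique[OF z(2) QRT_has_derivative]) (use nz in \<open>simp_all add: x_def y_def\<close>)
    have "QRTx A B z = 0" "QRTy A B z = 0"
      using fun_cong[OF eq, of "vector [1, 0]"] fun_cong[OF eq, of "vector [0, 1]"] by simp_all
    then have 1: "x\<^sup>2 - y\<^sup>2 - B * y - A = 0" and 2: "y\<^sup>2 - x\<^sup>2 - B * x - A = 0"
      using nz by (simp_all add: QRTx_def QRTy_def x_def y_def)
    have "(t - 2) * x0 * (x + y - 2 * x0) = 0" using 1 2 A B by algebra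
    then have s: "x + y = 2 * x0" using t(2) x0 by simp
    have "(x - y) * (2 * (x + y) + B) = 0" using 1 2 by algebra
    moreover have "2 * (x + y) + B = (t + 2) * x0" unfolding s B by algebra
    ultimately have "x = y" using t(3) x0 by (auto simp: add_eq_0_iff)
    with s show ?thesis by (simp add: vec2_eq_iff p flip: x_def y_def)
  qed
  have "(QRT A B has_derivative (\<lambda>_. 0)) (at p)"
  proof -
    have "QRTx A B p = 0" "QRTy A B p = 0" using x0 by (simp_all add: QRTx_def QRTy_def p A power2_eq_square)
    then show ?thesis using QRT_has_derivative[of p A B] x0 by (simp add: p)
  qed
  with only U(1) show ?thesis unfolding critical_points_def by blast
qed

text \<open>The neighbourhood is chosen as the image of a disc under \<open>\<Gamma>\<close>, on
  which the integral is \<open>t + (sin \<theta>)^2 * (cmod w)^2\<close>; hence its level sets there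
  are whole images of circles.\<close>

lemma QRT_locally_integrable:
  fixes A B x0 t \<theta> :: real
  assumes x0: "x0 \<noteq> 0" and A: "A = - B * x0" and t: "t = B / x0 + 2" "t = 2 * cos \<theta>" and s: "sin \<theta> \<noteq> 0"
    and p: "p = vector [x0, x0]"
  shows "Cm_locally_integrable k F_dom (F_map A B 1) p"
proof -
  have s2: "0 < (sin \<theta>)\<^sup>2" using s by simp
  have t2: "-2 < t" "t < 2" using elliptic_trace_bound[OF s] by (simp_all add: t(2))
  define m where "m w = Re w" for w
  define n where "n w = Re (cis \<theta> * w)" for w
  \<comment> \<open>On this disc the form stays below \<open>2 - \<bar>t\<bar>\<close>, while it is
    at least \<open>(2 - \<bar>t\<bar>) * \<bar>m w * n w\<bar>\<close>. This gives
    \<open>m w * n w < 1\<close>, as \<open>radial_factor\<close> requires.\<close>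
  define \<rho> where "\<rho> = sqrt (2 - \<bar>t\<bar>) / \<bar>sin \<theta>\<bar>"
  have \<rho>: "0 < \<rho>" using t2 s by (simp add: \<rho>_def)
  have quad: "(m w)\<^sup>2 - t * m w * n w + (n w)\<^sup>2 = (sin \<theta>)\<^sup>2 * (cmod w)\<^sup>2" for w
    using rotation_quadratic_form[of w \<theta>] by (simp add: t(2) m_def n_def)
  have mn: "m w * n w < 1" if "cmod w < \<rho>" for w
  proof -
    have "(cmod w)\<^sup>2 < \<rho>\<^sup>2" using that by (intro power_strict_mono) auto
    then have "(sin \<theta>)\<^sup>2 * (cmod w)\<^sup>2 < (sin \<theta>)\<^sup>2 * \<rho>\<^sup>2" using s2 by (rule mult_strict_left_mono)
    also have "\<dots> = 2 - \<bar>t\<bar>" using t2 s by (simp add: \<rho>_def power_divide)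
    finally have "(m w)\<^sup>2 - t * m w * n w + (n w)\<^sup>2 < 2 - \<bar>t\<bar>" unfolding quad .
    moreover have "t * m w * n w \<le> \<bar>t\<bar> * \<bar>m w * n w\<bar>" by (metis abs_ge_self abs_mult mult.assoc)
    moreover have "2 * \<bar>m w * n w\<bar> \<le> (m w)\<^sup>2 + (n w)\<^sup>2"
      using zero_le_power2[of "\<bar>m w\<bar> - \<bar>n w\<bar>"] by (simp add: power2_diff abs_mult)
    ultimately have "(2 - \<bar>t\<bar>) * \<bar>m w * n w\<bar> < (2 - \<bar>t\<bar>) * 1" by (simp add: left_diff_distrib)
    moreover have "0 < 2 - \<bar>t\<bar>" using t2 by auto
    ultimately have "\<bar>m w * n w\<bar> < 1" using mult_less_cancel_left_pos by blast
    then show ?thesis by linarith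
  qed
  define \<kappa> where "\<kappa> w = radial_factor (m w) (n w)" for w
  define \<Gamma> :: "complex \<Rightarrow> real^2" where "\<Gamma> w = vector [x0 * (1 + \<kappa> w * m w), x0 * (1 + \<kappa> w * n w)]" for w
  have \<Gamma>12: "\<Gamma> w $ 1 = x0 * (1 + \<kappa> w * m w)" "\<Gamma> w $ 2 = x0 * (1 + \<kappa> w * n w)" for w
    by (simp_all add: \<Gamma>_def)
  have kk: "0 < \<kappa> w" "(\<kappa> w)\<^sup>2 = (1 + \<kappa> w * m w) * (1 + \<kappa> w * n w)" "0 < 1
      + \<kappa> w * m w" "0 < 1 + \<kappa> w * n w"
    if "cmod w < \<rho>" for w
    using radial_factor[OF mn[OF that]] by (simp_all add: \<kappa>_def)
  have val: "QRT A B (\<Gamma> w) = t + (sin \<theta>)\<^sup>2 * (cmod w)\<^sup>2" if w: "cmod w < \<rho>" for w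
  proof -
    have "QRT A B (\<Gamma> w) = t + ((\<kappa> w * m w)\<^sup>2 - t * (\<kappa> w * m w) * (\<kappa> w * n w) + (\<kappa> w * n w)\<^sup>2)
        / ((1 + \<kappa> w * m w) * (1 + \<kappa> w * n w))"
      using kk(3,4)[OF w] by (intro QRT_scaled[OF x0 A t(1) \<Gamma>12]) auto
    also have "(\<kappa> w * m w)\<^sup>2 - t * (\<kappa> w * m w) * (\<kappa> w * n w) + (\<kappa> w * n w)\<^sup>2
        = (\<kappa> w)\<^sup>2 * ((m w)\<^sup>2 - t * m w * n w + (n w)\<^sup>2)" by algebra
    also have "\<dots> = (\<kappa> w)\<^sup>2 * ((sin \<theta>)\<^sup>2 * (cmod w)\<^sup>2)" unfolding quad ..
    also have "(\<kappa> w)\<^sup>2 * ((sin \<theta>)\<^sup>2 * (cmod w)\<^sup>2) / ((1 + \<kappa> w * m w) * (1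
        + \<kappa> w * n w)) = (sin \<theta>)\<^sup>2 * (cmod w)\<^sup>2"
      unfolding kk(2)[OF w, symmetric] using kk(1)[OF w] by simp
    finally show ?thesis .
  qed
  \<comment> \<open>The coordinates of \<open>\<Gamma> w\<close> determine both factors
    \<open>1 + \<kappa> w * m w\<close> and \<open>1 + \<kappa> w * n w\<close>, whose product is
    the square of \<open>\<kappa> w\<close>; so \<open>\<kappa> w\<close>, and then
    \<open>m w\<close> and \<open>n w\<close>, can be recovered.\<close>
  have inj: "inj_on \<Gamma> (ball 0 \<rho>)"
  proof (rule inj_onI)
    fix w w' assume "w \<in> ball 0 \<rho>" "w' \<in> ball 0 \<rho>" and eq: "\<Gamma> w = \<Gamma> w'"
    then have w: "cmod w < \<rho>" "cmod w' < \<rho>" by auto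
    from eq have e: "\<kappa> w * m w = \<kappa> w' * m w'" "\<kappa> w * n w = \<kappa> w' * n w'"
      using x0 by (simp_all add: vec2_eq_iff \<Gamma>12)
    have "(\<kappa> w)\<^sup>2 = (\<kappa> w')\<^sup>2" using kk(2)[OF w(1)] kk(2)[OF w(2)] e by simp
    then have "\<kappa> w = \<kappa> w'" using kk(1)[OF w(1)] kk(1)[OF w(2)] by simp
    with e kk(1)[OF w(1)] have "m w = m w'" "n w = n w'" by auto
    then have "Re w = Re w'" "sin \<theta> * Im w = sin \<theta> * Im w'" by (simp_all add: m_def n_def)
    with s show "w = w'" by (simp add: complex_eq_iff)
  qed
  have mnc: "continuous_on S m" "continuous_on S n" for S
    unfolding m_def n_def by (intro continuous_intros)+
  have \<kappa>c: "continuous_on (ball 0 \<rho>) \<kappa>"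
    unfolding \<kappa>_def radial_factor_def using mn
    by (intro continuous_intros mnc) fastforce
  have c1: "continuous_on (ball 0 \<rho>) (\<lambda>w. \<Gamma> w $ 1)" and c2: "continuous_on (ball 0 \<rho>) (\<lambda>w. \<Gamma> w $ 2)"
    unfolding \<Gamma>12 by (intro continuous_intros \<kappa>c mnc)+
  have "continuous_on (ball 0 \<rho>) (\<lambda>w. \<Gamma> w $ i)" for i
  proof (cases "i = 1")
    case True
    then show ?thesis using c1 by (simp only:)
  next
    case False
    then have "i = 2" using exhaust_2 by blast
    then show ?thesis using c2 by (simp only:)
  qed
  then have "continuous_on (ball 0 \<rho>) (\<lambda>w. \<chi> i. \<Gamma> w $ i)" by (rule continuous_on_vec_lambda)
  then have cont: "continuous_on (ball 0 \<rho>) \<Gamma>" by simp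
  define U where "U = \<Gamma> ` ball 0 \<rho>"
  have U: "open U" unfolding U_def by (rule invariance_of_domain_gen[OF _ cont inj]) auto
  have \<Gamma>0: "\<Gamma> 0 = p" by (simp add: vec2_eq_iff \<Gamma>12 m_def n_def p)
  then have pU: "p \<in> U" using \<rho> by (force simp: U_def)
  have off: "U \<subseteq> {z. z$1 \<noteq> 0 \<and> z$2 \<noteq> 0}"
    using kk(3,4) x0 by (fastforce simp: U_def \<Gamma>12)
  have curves: "closed_curve_surrounding p {z \<in> U. QRT A B z = QRT A B q}" if q: "q \<in> U - {p}" for q
  proof -
    from q obtain w where w: "cmod w < \<rho>" "q = \<Gamma> w" by (auto simp: U_def)
    have "w \<noteq> 0" using q w \<Gamma>0 by auto
    have "{z \<in> U. QRT A B z = QRT A B q} = \<Gamma> ` sphere 0 (cmod w)"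
    proof (intro set_eqI iffI)
      fix z assume "z \<in> {z \<in> U. QRT A B z = QRT A B q}"
      then obtain w' where w': "cmod w' < \<rho>" "z = \<Gamma> w'" "QRT A B (\<Gamma> w') = QRT A B (\<Gamma> w)"
        using w by (auto simp: U_def)
      then have "(cmod w')\<^sup>2 = (cmod w)\<^sup>2" using val[OF w'(1)] val[OF w(1)] s by simp
      then have "cmod w' = cmod w" by simp
      with w'(2) show "z \<in> \<Gamma> ` sphere 0 (cmod w)" by auto
    next
      fix z assume "z \<in> \<Gamma> ` sphere 0 (cmod w)"
      then obtain w' where w': "cmod w' = cmod w" "z = \<Gamma> w'" by auto
      then show "z \<in> {z \<in> U. QRT A B z = QRT A B q}" using w val[of w] val[of w'] by (auto simp: U_def)
    qed
    then show ?thesis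
      using closed_curve_surrounding_image[OF cont inj, of "cmod w"] w \<open>w \<noteq> 0\<close> by (simp add: \<Gamma>0)
  qed
  have "det (hessian (QRT A B) p) \<noteq> 0"
  proof -
    have "(2 - t) * (2 + t) \<noteq> 0" using t2 by simp
    moreover have "(2 - t) * (2 + t) = 4 - t\<^sup>2" by algebra
    ultimately show ?thesis using QRT_hessian_det[OF x0 A t(1) p] x0 by simp
  qed
  moreover have "p isolated_in (critical_points U (QRT A B))"
    unfolding isolated_in_def using QRT_critical_points[OF x0 A t(1) _ _ p pU off] t2
    by (auto intro!: exI[of _ UNIV])
  ultimately show ?thesis
    unfolding Cm_locally_integrable_def
    by (intro exI[of _ U] exI[of _ "QRT A B"] conjI ballI U pU Ck_on_QRT[OF U off]
        first_integral_QRT[OF off] curves)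
qed

theorem proposition7:
  fixes A B C :: real and p :: "real^2"
  assumes "C \<noteq> 0"
    and "elliptic_fixed_point F_dom (F_map A B C) p"
    and "\<not> resonant 5 (F_map A B C) p"
  shows "(Cm_locally_integrable 6 F_dom (F_map A B C) p \<longleftrightarrow> C = 1) \<and>
         (C = 1 \<longrightarrow>
           first_integral F_dom (F_map A B C) {z. z$1 \<noteq> 0 \<and> z$2 \<noteq> 0}
             (\<lambda>z. ((z$1)\<^sup>2 + (z$2)\<^sup>2 + B * (z$1 + z$2) + A) / (z$1 * z$2)))"
proof (intro conjI iffI impI)
  from elliptic_F_map[OF assms(2,3)] obtain x0 t \<theta> :: real where
    x0: "x0 \<noteq> 0" and fixp: "A + B * x0 + C * x0\<^sup>2 = x0\<^sup>2" and t: "t = B / x0 + 2 * C" "t = 2 * cos \<theta>"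
    and s: "sin \<theta> \<noteq> 0" and nr: "t \<noteq> -1" "t \<noteq> 0" "t\<^sup>2 + t - 1 \<noteq> 0" and p: "p = vector [x0, x0]"
    by blast
  show "C = 1" if "Cm_locally_integrable 6 F_dom (F_map A B C) p"
  proof (rule ccontr)
    assume C1: "C \<noteq> 1"
    from that obtain U V where U: "open U" "p \<in> U" and Ck: "Ck_on 6 V U"
      and fi: "first_integral F_dom (F_map A B C) U V"
      and crit: "p isolated_in (critical_points U V)" and det: "det (hessian V p) \<noteq> 0"
      unfolding Cm_locally_integrable_def by blast
    have "(6::nat) = Suc (Suc 4)" by simp
    with Ck have Ck': "Ck_on (Suc (Suc 4)) V U" by metis
    \<comment> \<open>Being isolated in the set of critical points includes belonging to it.\<close>
    have crit': "(V has_derivative (\<lambda>_. 0)) (at p)"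
      using crit unfolding isolated_in_def critical_points_def by blast
    have inv: "V (F_map A B C x) = V x" if "x \<in> U" "F_map A B C x \<in> U" for x
      using fi that unfolding first_integral_def by blast
    from first_integral_quadratic[OF U Ck' crit' det inv x0 fixp t(1) nr(2) p]
    obtain a where a: "a \<noteq> 0" and V: "\<And>\<epsilon>. 0 < \<epsilon>
        \<Longrightarrow> \<exists>r>0. \<forall>d d'. norm d < r \<longrightarrow> norm d' < r \<longrightarrow>
      \<bar>V (p + d') - V (p + d) - a * (elliptic_form t d'
          - elliptic_form t d)\<bar> \<le> \<epsilon> * max (norm d) (norm d') * norm (d' - d)" by blast
    show False
      by (rule no_first_integral[OF assms(1) C1 x0 fixp t s nr p U inv a V])
  qed
  show "Cm_locally_integrable 6 F_dom (F_map A B C) p" if C: "C = 1"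
  proof -
    have "A = - B * x0" using fixp C by simp
    moreover have "t = B / x0 + 2" using t(1) C by simp
    ultimately show ?thesis unfolding C by (rule QRT_locally_integrable[OF x0 _ _ t(2) s p])
  qed
  show "first_integral F_dom (F_map A B C) {z. z$1 \<noteq> 0 \<and> z$2 \<noteq> 0}
      (\<lambda>z. ((z$1)\<^sup>2 + (z$2)\<^sup>2 + B * (z$1 + z$2) + A) / (z$1 * z$2))" if "C = 1"
    using first_integral_QRT[OF order_refl, of A B] that by (simp only: QRT_def[abs_def])
qed

end
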